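(* Let $\Omega\subset\mathbb{R}^2$ be a bounded, convex domain which is centrally symmetric, and whose boundary $\partial\Omega$ is connected and of class $C^{2,\varepsilon}$ for some $\varepsilon\in(0,1)$. Then there is a constant $\alpha^*=\alpha^*(\Omega)>0$ with the following property: if for some $\alpha>\alpha^*$ there exists a nontrivial function $u$ solving the overdetermined problem $$\Delta u+\alpha u=0 \text{ in } \Omega,\qquad u=0 \text{ on } \partial\Omega,\qquad \partial_\nu u=c \text{ on }\partial\Omega$$ for some constant $c$, then $\Omega$ is a disk.
   Context: $\nu$ denotes the unit outer normal to $\partial\Omega$. A domain $\Omega$ is centrally symmetric if there is a point $O$ such that $\Omega$ is invariant under the rotation by $180^\circ$ about $O$ (i.e. $x\mapsto 2O-x$). *)

theory Defs
  imports "HOL-Analysis.Analysis"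
begin

definition grad :: "(real^2 \<Rightarrow> real) \<Rightarrow> real^2 \<Rightarrow> real^2" where
  "grad u x = (\<chi> i. frechet_derivative u (at x) (axis i 1))"

definition laplacian :: "(real^2 \<Rightarrow> real) \<Rightarrow> real^2 \<Rightarrow> real" where
  "laplacian u x = (\<Sum>i\<in>UNIV. frechet_derivative (\<lambda>y. grad u y $ i) (at x) (axis i 1))"

definition C2_on :: "(real^2) set \<Rightarrow> (real^2 \<Rightarrow> real) \<Rightarrow> bool" where
  "C2_on S u \<longleftrightarrow>
     (\<forall>x\<in>S. u differentiable (at x)) \<and>
     (\<forall>x\<in>S. \<forall>i. (\<lambda>y. grad u y $ i) differentiable (at x)) \<and>
     (\<forall>i j. continuous_on S (\<lambda>x. frechet_derivative (\<lambda>y. grad u y $ i) (at x) (axis j 1)))"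

definition outer_normal :: "(real^2) set \<Rightarrow> real^2 \<Rightarrow> real^2 \<Rightarrow> bool" where
  "outer_normal \<Omega> p \<nu> \<longleftrightarrow> norm \<nu> = 1 \<and>
     (\<forall>v. v \<bullet> \<nu> < 0 \<longrightarrow> (\<forall>\<^sub>F t in at_right 0. p + t *\<^sub>R v \<in> \<Omega>)) \<and>
     (\<forall>v. v \<bullet> \<nu> > 0 \<longrightarrow> (\<forall>\<^sub>F t in at_right 0. p + t *\<^sub>R v \<notin> closure \<Omega>))"

definition C2_eps_boundary :: "real \<Rightarrow> (real^2) set \<Rightarrow> bool" where
  "C2_eps_boundary \<epsilon> \<Omega> \<longleftrightarrow>
     (\<forall>p\<in>frontier \<Omega>. \<exists>e1 e2 r (g :: real \<Rightarrow> real).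
        norm e1 = 1 \<and> norm e2 = 1 \<and> e1 \<bullet> e2 = 0 \<and> r > 0 \<and>
        (\<forall>s\<in>{-r<..<r}. g differentiable (at s) \<and> deriv g differentiable (at s)) \<and>
        (\<exists>K. \<forall>s\<in>{-r<..<r}. \<forall>t\<in>{-r<..<r}.
            \<bar>deriv (deriv g) s - deriv (deriv g) t\<bar> \<le> K * \<bar>s - t\<bar> powr \<epsilon>) \<and>
        (\<forall>y\<in>ball p r. y \<in> \<Omega> \<longleftrightarrow> (y - p) \<bullet> e2 < g ((y - p) \<bullet> e1)))"

definition centrally_symmetric :: "(real^2) set \<Rightarrow> bool" where
  "centrally_symmetric \<Omega> \<longleftrightarrow> (\<exists>c0. (\<lambda>x. 2 *\<^sub>R c0 - x) ` \<Omega> = \<Omega>)"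

text \<open>Classical solution of the overdetermined problem
  Delta u + alpha u = 0 in Omega, u = 0 and d_nu u = c on the boundary,
  with u in C^2(Omega) and C^1 up to the boundary (G is the continuous
  extension of the gradient to the closure).\<close>
definition overdetermined_solution ::
  "(real^2) set \<Rightarrow> real \<Rightarrow> real \<Rightarrow> (real^2 \<Rightarrow> real) \<Rightarrow> bool" where
  "overdetermined_solution \<Omega> \<alpha> c u \<longleftrightarrow>
     C2_on \<Omega> u \<and> continuous_on (closure \<Omega>) u \<and>
     (\<exists>G. continuous_on (closure \<Omega>) G \<and> (\<forall>x\<in>\<Omega>. G x = grad u x) \<and>
          (\<forall>p\<in>frontier \<Omega>. \<forall>\<nu>. outer_normal \<Omega> p \<nu> \<longrightarrow> G p \<bullet> \<nu> = c)) \<and>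
     (\<forall>x\<in>\<Omega>. laplacian u x + \<alpha> * u x = 0) \<and>
     (\<forall>p\<in>frontier \<Omega>. u p = 0)"

end

theory Submission
  imports Defs
begin

text \<open>
  Integrating the solution over the chords orthogonal to a direction \<open>w\<close> gives a function of one variable
  that solves \<open>W'' + \<alpha> W = - c m\<close> with zero Cauchy data at both ends, where \<open>m\<close> is the push-forward of arc
  length along \<open>w\<close>. Hence the cosine transform of \<open>m\<close> vanishes at \<open>\<surd>\<alpha>\<close>; here \<open>c \<noteq> 0\<close>, since for \<open>c = 0\<close> all
  moments of \<open>u\<close> along the chords vanish. If the extreme point in direction \<open>w\<close> has positive curvature,
  then \<open>m\<close> has an inverse square root singularity there, and by central symmetry the transform is
  asymptotic to a positive multiple of \<open>\<alpha> powr (- 1/4)\<close> times a fixed nonzero \<open>2 \<pi>\<close>-periodic function of \<open>\<surd>\<alpha> h\<close>, where \<open>h\<close> is the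
  support function at \<open>w\<close>. If this happens for arbitrarily large \<open>\<alpha>\<close>, then by Baire's theorem \<open>h\<close> cannot
  take an interval of values on such directions. Now consider the boundary points farthest from the
  centre. The curvature is positive near each of them, so \<open>h\<close> is locally constant there, which forces
  the boundary to be a circular arc about the centre; as the boundary is connected, the domain is a disk.
\<close>

section \<open>Oscillatory integrals\<close>

text \<open>A single direction gives no contradiction: the frequencies \<open>sqrt \<alpha>\<close>
  may be so sparse that \<open>sqrt \<alpha> * h\<close> always falls near a zero of the periodic
  function. The frequency from which the asymptotics hold also depends on the direction, with no
  uniformity; hence Baire's theorem. The asymptotics enter only as an inequality: vanishing of the
  transform bounds a Fresnel integral truncated at \<open>sqrt M\<close> by
  \<open>12 / sqrt M\<close>, and for M = 40000 this contradicts the lower bound 1/10 at phase pi/2.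
  Away from the tip, convexity alone controls the density m, so m is split into monotone parts, to
  which the second mean value theorem applies without any smoothness. Solutions are C^2 only inside
  and C^1 up to the boundary, so the equation in one variable is derived on slices dilated into the
  interior, where second derivatives become boundary terms before the limit is taken. Farthest
  points are the right place to look because, along the boundary, the derivative of h is the
  curvature times half the derivative of the squared distance to the centre.\<close>

lemma cos_ge_one_minus_half_square: "1 - x\<^sup>2 / 2 \<le> cos x" for x :: real
proof -
  have "cos x = 1 - 2 * (sin (x / 2))\<^sup>2"
    using cos_double_sin[of "x / 2"] by simp
  moreover have "(sin (x / 2))\<^sup>2 \<le> (x / 2)\<^sup>2"
    by (subst abs_le_square_iff[symmetric]) (rule abs_sin_x_le_abs_x)
  ultimately show ?thesis
    by (simp add: power_divide)
qed

text \<open>The bound is uniform in \<open>Y\<close>: the gain on [0, 1], estimated through sin x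
  \<ge> x - x^3 / 6, outweighs any loss beyond 1, as 13/42 - 1/4 exceeds 1/20.\<close>

lemma integral_sin_square_ge:
  fixes Y :: real
  assumes "1 \<le> Y"
  shows "integral {0..Y} (\<lambda>z. sin (z\<^sup>2)) \<ge> 1 / 20"
proof -
  have "((\<lambda>z::real. z\<^sup>2 - z ^ 6 / 6) has_integral (1 ^ 3 / 3 - 1 ^ 7 / 42) - (0 ^ 3 / 3 - 0 ^ 7 / 42)) {0..1}"
    by (rule fundamental_theorem_of_calculus)
       (auto intro!: derivative_eq_intros simp flip: has_real_derivative_iff_has_vector_derivative)
  then have poly: "((\<lambda>z::real. z\<^sup>2 - z ^ 6 / 6) has_integral 13 / 42) {0..1}"
    by simp
  have sin_ge: "x - x ^ 3 / 6 \<le> sin x" if "0 \<le> x" for x :: real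
  proof -
    have "x - x ^ 3 / 6 - sin x \<le> 0 - 0 ^ 3 / 6 - sin (0::real)"
    proof (rule DERIV_nonpos_imp_nonincreasing[OF that])
      fix y :: real
      assume "0 \<le> y" "y \<le> x"
      show "\<exists>d. ((\<lambda>x. x - x ^ 3 / 6 - sin x) has_real_derivative d) (at y) \<and> d \<le> 0"
        using cos_ge_one_minus_half_square[of y]
        by (intro exI[of _ "1 - y\<^sup>2 / 2 - cos y"])
           (auto intro!: derivative_eq_intros simp: power2_eq_square)
    qed
    then show ?thesis by simp
  qed
  have int: "(\<lambda>z. sin (z\<^sup>2)) integrable_on {a..b}" for a b :: real
    by (intro integrable_continuous_real continuous_intros)
  have "13 / 42 \<le> integral {0..1} (\<lambda>z::real. sin (z\<^sup>2))"
  proof (rule has_integral_le[OF poly integrable_integral[OF int]])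
    show "z\<^sup>2 - z ^ 6 / 6 \<le> sin (z\<^sup>2)" for z :: real
      using sin_ge[of "z\<^sup>2"] by (simp flip: power_mult)
  qed
  moreover have "- (1 / 4) \<le> integral {1..Y} (\<lambda>z. sin (z\<^sup>2))"
  proof -
    define K :: "real \<Rightarrow> real" where "K z = (1 - cos (z\<^sup>2)) / (2 * z)" for z
    have "((\<lambda>z. sin (z\<^sup>2) - (1 - cos (z\<^sup>2)) / (2 * z\<^sup>2)) has_integral K Y - K 1) {1..Y}"
      unfolding K_def
      by (rule fundamental_theorem_of_calculus[OF assms])
         (auto intro!: derivative_eq_intros simp: field_simps power2_eq_square
            simp flip: has_real_derivative_iff_has_vector_derivative)
    then have "K Y - K 1 \<le> integral {1..Y} (\<lambda>z. sin (z\<^sup>2))"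
      by (rule has_integral_le[OF _ integrable_integral[OF int]]) simp
    moreover have "0 \<le> K Y"
      unfolding K_def using assms by simp
    moreover have "K 1 \<le> 1 / 4"
      unfolding K_def using cos_ge_one_minus_half_square[of 1] by simp
    ultimately show ?thesis by linarith
  qed
  moreover have "integral {0..1} (\<lambda>z. sin (z\<^sup>2)) + integral {1..Y} (\<lambda>z. sin (z\<^sup>2)) = integral {0..Y} (\<lambda>z. sin (z\<^sup>2))"
    using assms by (intro Henstock_Kurzweil_Integration.integral_combine int) auto
  ultimately show ?thesis by simp
qed

text \<open>The second mean value theorem turns the integral into two integrals of the cosine,
  weighted by the end values of \<open>p\<close>, each at most \<open>2 / l\<close> in modulus.
  Monotonicity thus takes the place of smoothness, and the same theorem supplies
  integrability.\<close>

lemma integral_mono_cos_bound: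
  fixes p :: "real \<Rightarrow> real"
  assumes "a \<le> b" "mono_on {a..b} p" "\<And>x. x \<in> {a..b} \<Longrightarrow> 0 \<le> p x" "0 < l"
  shows "(\<lambda>s. p s * cos (l * s)) integrable_on {a..b}"
    and "\<bar>integral {a..b} (\<lambda>s. p s * cos (l * s))\<bar> \<le> 4 * p b / l"
proof -
  have cos_int: "((\<lambda>s. cos (l * s)) has_integral sin (l * d) / l - sin (l * c) / l) {c..d}"
    if "c \<le> d" for c d
    using \<open>0 < l\<close>
    by (intro fundamental_theorem_of_calculus that)
       (auto intro!: derivative_eq_intros simp flip: has_real_derivative_iff_has_vector_derivative)
  have bound: "\<bar>integral {c..d} (\<lambda>s. cos (l * s))\<bar> \<le> 2 / l" if "c \<le> d" for c d
  proof -
    have "integral {c..d} (\<lambda>s. cos (l * s)) = (sin (l * d) - sin (l * c)) / l"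
      using integral_unique[OF cos_int[OF that]] by (simp add: diff_divide_distrib)
    moreover have "\<bar>sin (l * d) - sin (l * c)\<bar> \<le> 2"
      using abs_sin_le_one[of "l * d"] abs_sin_le_one[of "l * c"] by linarith
    ultimately show ?thesis
      using \<open>0 < l\<close> by (simp add: divide_right_mono)
  qed
  have mono: "p x \<le> p y" if "a \<le> x" "x \<le> y" "y \<le> b" for x y
    using that assms(2) by (auto simp: mono_on_def)
  obtain c where c: "c \<in> {a..b}"
    and hi: "((\<lambda>s. p s * cos (l * s)) has_integral
      p a * integral {a..c} (\<lambda>s. cos (l * s)) + p b * integral {c..b} (\<lambda>s. cos (l * s))) {a..b}"
    using second_mean_value_theorem_full[of "\<lambda>s. cos (l * s)" a b p]
      has_integral_integrable[OF cos_int[OF assms(1)]] assms(1) mono by metis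
  show "(\<lambda>s. p s * cos (l * s)) integrable_on {a..b}"
    using hi by blast
  have "\<bar>p a * integral {a..c} (\<lambda>s. cos (l * s))\<bar> \<le> p b * (2 / l)"
    unfolding abs_mult using c assms(1,3) mono[of a b] bound[of a c] by (intro mult_mono) auto
  moreover have "\<bar>p b * integral {c..b} (\<lambda>s. cos (l * s))\<bar> \<le> p b * (2 / l)"
    unfolding abs_mult using c assms(1,3) bound[of c b] by (intro mult_mono) auto
  ultimately show "\<bar>integral {a..b} (\<lambda>s. p s * cos (l * s))\<bar> \<le> 4 * p b / l"
    using integral_unique[OF hi] add_divide_distrib[of "2 * p b" "2 * p b" l] by simp
qed

text \<open>Substituting y = - sqrt (l * (a - x)) absorbs the singularity and turns the phase into l
  * a - y^2. The minus sign makes the substitution increasing, so that the limits stay in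
  order.\<close>

lemma inverse_sqrt_substitution:
  fixes a l s b :: real
  assumes "0 < l" "s \<le> b" "b < a"
  shows "((\<lambda>x. cos (l * x) / sqrt (a - x)) has_integral
           integral {- sqrt (l * (a - s))..- sqrt (l * (a - b))} (\<lambda>y. 2 * cos (l * a - y\<^sup>2)) / sqrt l) {s..b}"
proof -
  have "((\<lambda>x. (l / (2 * sqrt (l * (a - x)))) *\<^sub>R (2 * cos (l * a - (- sqrt (l * (a - x)))\<^sup>2))) has_integral
      integral {- sqrt (l * (a - s))..- sqrt (l * (a - b))} (\<lambda>y. 2 * cos (l * a - y\<^sup>2))) {s..b}"
  proof (rule has_integral_substitution)
    show "- sqrt (l * (a - s)) \<le> - sqrt (l * (a - b))"
      using assms by (simp add: mult_left_mono)
    show "(\<lambda>x. - sqrt (l * (a - x))) ` {s..b} \<subseteq> {- sqrt (l * (a - s))..0}"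
      using assms by (auto simp: mult_left_mono)
    show "continuous_on {- sqrt (l * (a - s))..0} (\<lambda>y. 2 * cos (l * a - y\<^sup>2))"
      by (intro continuous_intros)
    show "((\<lambda>x. - sqrt (l * (a - x))) has_real_derivative l / (2 * sqrt (l * (a - x)))) (at x within {s..b})"
      if "x \<in> {s..b}" for x
      using that assms by (auto intro!: derivative_eq_intros simp: field_simps)
  qed (use assms in auto)
  then have "((\<lambda>x. (1 / sqrt l) * ((l / (2 * sqrt (l * (a - x)))) *\<^sub>R (2 * cos (l * a - (- sqrt (l * (a - x)))\<^sup>2)))) has_integral
      (1 / sqrt l) * integral {- sqrt (l * (a - s))..- sqrt (l * (a - b))} (\<lambda>y. 2 * cos (l * a - y\<^sup>2))) {s..b}"
    by (rule has_integral_mult_right)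
  then show ?thesis
  proof (rule has_integral_eq_rhs[OF has_integral_eq[rotated]])
    fix x assume "x \<in> {s..b}"
    then have "a - x > 0" using assms by simp
    moreover have "l * a - l * (a - x) = l * x"
      by (simp add: algebra_simps)
    moreover have "(sqrt l * sqrt (a - x))\<^sup>2 = l * (a - x)"
      using assms \<open>a - x > 0\<close> by (simp add: power_mult_distrib)
    moreover have "l / (sqrt l * sqrt l) = 1"
      using assms by simp
    moreover have "(1 / m) * ((l / (2 * (m * q))) * (2 * C)) = l / (m * m) * C / q" for m q C :: real
      by (simp add: field_simps)
    ultimately show "(1 / sqrt l) * ((l / (2 * sqrt (l * (a - x)))) *\<^sub>R (2 * cos (l * a - (- sqrt (l * (a - x)))\<^sup>2)))
        = cos (l * x) / sqrt (a - x)"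
      unfolding real_sqrt_mult real_scaleR_def power2_minus by (metis mult_1)
  qed simp
qed

text \<open>Near the end point the density \<open>p\<close> is asymptotic to \<open>A / sqrt (a - s)\<close>, so on the scale
  \<open>a - s \<sim> 1 / l\<close> the cosine integral is a truncated Fresnel integral; beyond that scale, monotonicity of
  \<open>p\<close> and the second mean value theorem make everything else small.\<close>
lemma oscillatory_endpoint_bound:
  fixes p :: "real \<Rightarrow> real"
  assumes "0 < a" "mono_on {-a<..<a} p" "\<And>s. s \<in> {-a<..<a} \<Longrightarrow> 0 \<le> p s"
    and lim: "((\<lambda>s. p s * sqrt (a - s)) \<longlongrightarrow> A) (at_left a)" and "0 < A" and "1 \<le> M"
  shows "\<exists>l0>0. \<forall>l>l0.
    ((\<lambda>b. integral {-b..b} (\<lambda>s. p s * cos (l * s)) - 2 * sin (l * b) / l) \<longlongrightarrow> 0) (at_left a) \<longrightarrow>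
    \<bar>integral {0..sqrt M} (\<lambda>z. 2 * cos (l * a - z\<^sup>2))\<bar> \<le> 12 / sqrt M"
proof -
  have "\<forall>\<^sub>F s in at_left a. dist (p s * sqrt (a - s)) A < A / M"
    using lim assms by (intro tendstoD) auto
  then obtain s0 where "s0 < a" and s0: "\<And>s. s0 < s \<Longrightarrow> s < a \<Longrightarrow> \<bar>p s * sqrt (a - s) - A\<bar> < A / M"
    unfolding eventually_at_left_field dist_real_def by blast
  define \<eta> where "\<eta> = min (a - s0) a"
  have \<eta>: "0 < \<eta>" "\<eta> \<le> a" using \<open>s0 < a\<close> \<open>0 < a\<close> by (auto simp: \<eta>_def)
  \<comment> \<open>The first bound keeps the window of length \<open>M / l\<close> at
    \<open>a\<close> inside the range where \<open>p\<close> is close to its asymptotics and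
    \<open>s\<close> is positive; the second absorbs the contribution of
    \<open>2 * sin (l * b) / l\<close>.\<close>
  define l0 where "l0 = max (M / \<eta>) (4 * M / A\<^sup>2)"
  show ?thesis
  proof (intro exI conjI allI impI)
    show "0 < l0" using \<eta> assms by (auto simp: l0_def less_max_iff_disj)
    fix l assume l: "l0 < l"
      and D: "((\<lambda>b. integral {-b..b} (\<lambda>s. p s * cos (l * s)) - 2 * sin (l * b) / l) \<longlongrightarrow> 0) (at_left a)"
    have "0 < l" using \<open>0 < l0\<close> l by simp
    \<comment> \<open>Left end of the window. The relative tolerance \<open>1 / M\<close> fits its
      length: integrated against \<open>1 / sqrt (a - s)\<close> it costs
      \<open>2 * A / (sqrt M * sqrt l)\<close>, the same order as the part outside the
      window.\<close>
    define s1 where "s1 = a - M / l"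
    have "M / \<eta> < l" using l by (auto simp: l0_def)
    then have "M / l < \<eta>" using \<eta> \<open>0 < l\<close> by (simp add: field_simps)
    then have s1: "s0 < s1" "0 < s1" "s1 < a"
      using \<eta> assms(6) \<open>0 < l\<close> by (auto simp: s1_def \<eta>_def)
    have sq1: "sqrt (a - s1) = sqrt M / sqrt l"
      by (simp add: s1_def real_sqrt_divide)
    define Q where "Q = (\<lambda>b. integral {- sqrt M..- sqrt (l * (a - b))} (\<lambda>y. 2 * cos (l * a - y\<^sup>2)))"
    define Dl where "Dl = (\<lambda>b. integral {-b..b} (\<lambda>s. p s * cos (l * s)) - 2 * sin (l * b) / l)"
    \<comment> \<open>The 10 is 8 + 2: the 8 comes from the monotone part left of \<open>s1\<close>,
      where \<open>p s1\<close> is at most \<open>2 * A * sqrt l / sqrt M\<close>, and the 2 from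
      replacing \<open>p\<close> by \<open>A / sqrt (a - s)\<close> inside the window.\<close>
    have est: "A * \<bar>Q b\<bar> / sqrt l \<le> \<bar>Dl b\<bar> + 2 / l + 10 * A / (sqrt M * sqrt l)"
      if b: "s1 < b" "b < a" for b
    proof -
      have mono: "mono_on {c..d} p" if "-a < c" "d < a" for c d
        using that assms(2) by (auto simp: mono_on_def)
      note mb = integral_mono_cos_bound[of _ _ p, OF _ mono _ \<open>0 < l\<close>]
      have I1: "\<bar>integral {-b..s1} (\<lambda>s. p s * cos (l * s))\<bar> \<le> 8 * A / (sqrt M * sqrt l)"
      proof -
        have first: "\<bar>integral {-b..s1} (\<lambda>s. p s * cos (l * s))\<bar> \<le> 4 * p s1 / l"
          using b s1 assms(3) by (intro mb(2)) auto
        have "p s1 * sqrt (a - s1) \<le> 2 * A"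
        proof -
          have "A / M \<le> A" using assms(5,6) by (simp add: field_simps)
          then show ?thesis using s0[OF s1(1,3)] by linarith
        qed
        then have "p s1 \<le> 2 * A * sqrt l / sqrt M"
          using \<open>0 < l\<close> assms(6) unfolding sq1 by (simp add: field_simps)
        then have "4 * p s1 / l \<le> 4 * (2 * A * sqrt l / sqrt M) / l"
          using \<open>0 < l\<close> by (intro divide_right_mono mult_left_mono) auto
        also have "\<dots> = (8 * A / sqrt M) * (sqrt l / l)"
          by simp
        also have "sqrt l / l = 1 / sqrt l"
          using real_div_sqrt[of l] \<open>0 < l\<close> by (simp add: field_simps)
        finally show ?thesis using first by simp
      qed
      have sub: "((\<lambda>x. cos (l * x) / sqrt (a - x)) has_integral Q b / sqrt l) {s1..b}"
        using inverse_sqrt_substitution[OF \<open>0 < l\<close>, of s1 b a] b \<open>0 < l\<close> by (simp add: Q_def s1_def)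
      have p_int: "(\<lambda>s. p s * cos (l * s)) integrable_on {s1..b}"
        using b s1 assms(3) by (intro mb(1)) auto
      have "M \<noteq> 0" using assms(6) by simp
      then have "((\<lambda>s. A / M / sqrt (a - s)) has_integral (- 2 * (A / M) * sqrt (a - b)) - (- 2 * (A / M) * sqrt (a - s1))) {s1..b}"
        using b by (intro fundamental_theorem_of_calculus)
          (auto intro!: derivative_eq_intros simp: field_simps simp flip: has_real_derivative_iff_has_vector_derivative)
      then have maj: "((\<lambda>s. A / M / sqrt (a - s)) has_integral 2 * (A / M) * (sqrt (a - s1) - sqrt (a - b))) {s1..b}"
        by (simp add: algebra_simps)
      have E: "\<bar>integral {s1..b} (\<lambda>s. p s * cos (l * s)) - A * (Q b / sqrt l)\<bar> \<le> 2 * A / (sqrt M * sqrt l)"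
      proof -
        have dint: "((\<lambda>s. p s * cos (l * s) - A * (cos (l * s) / sqrt (a - s))) has_integral
            integral {s1..b} (\<lambda>s. p s * cos (l * s)) - A * (Q b / sqrt l)) {s1..b}"
          by (intro has_integral_diff has_integral_mult_right sub integrable_integral p_int)
        have pw: "\<bar>p s * cos (l * s) - A * (cos (l * s) / sqrt (a - s))\<bar> \<le> A / M / sqrt (a - s)"
          if s: "s \<in> {s1..b}" for s
        proof -
          have pos: "0 < sqrt (a - s)" using s b by simp
          have "p s * cos (l * s) - A * (cos (l * s) / sqrt (a - s)) = (p s * sqrt (a - s) - A) * cos (l * s) / sqrt (a - s)"
            using pos by (simp add: field_simps)
          also have "\<bar>\<dots>\<bar> \<le> (A / M) * 1 / sqrt (a - s)"
            unfolding abs_divide abs_mult abs_of_pos[OF pos] using s0[of s] s s1 b pos assms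
            by (intro divide_right_mono mult_mono) auto
          finally show ?thesis by simp
        qed
        have "\<bar>integral {s1..b} (\<lambda>s. p s * cos (l * s)) - A * (Q b / sqrt l)\<bar> \<le> 2 * (A / M) * (sqrt (a - s1) - sqrt (a - b))"
          using integral_norm_bound_integral[OF has_integral_integrable[OF dint] has_integral_integrable[OF maj]] pw
          unfolding integral_unique[OF dint] integral_unique[OF maj] by auto
        also have "\<dots> \<le> 2 * (A / M) * sqrt (a - s1)"
          using assms b by (intro mult_left_mono) auto
        also have "\<dots> = 2 * A / (sqrt M * sqrt l)"
        proof -
          have "M = sqrt M * sqrt M" using assms(6) by simp
          then show ?thesis unfolding sq1 using \<open>0 < l\<close> assms(6) by (simp add: field_simps)
        qed
        finally show ?thesis .
      qed
      have "integral {-b..s1} (\<lambda>s. p s * cos (l * s)) + integral {s1..b} (\<lambda>s. p s * cos (l * s))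
          = integral {-b..b} (\<lambda>s. p s * cos (l * s))"
        using b s1 assms(3) by (intro Henstock_Kurzweil_Integration.integral_combine mb(1)) auto
      moreover have "\<bar>2 * sin (l * b) / l\<bar> \<le> 2 / l"
        using \<open>0 < l\<close> by (simp add: abs_mult divide_right_mono)
      moreover have "A * \<bar>Q b\<bar> / sqrt l = \<bar>A * (Q b / sqrt l)\<bar>"
        using \<open>0 < l\<close> assms(5) by (simp add: abs_mult)
      moreover have "10 * A / (sqrt M * sqrt l) = 8 * A / (sqrt M * sqrt l) + 2 * A / (sqrt M * sqrt l)"
        by (simp add: field_simps)
      ultimately show ?thesis
        using I1 E unfolding Dl_def by linarith
    qed
    define Q0 where "Q0 = integral {0..sqrt M} (\<lambda>z. 2 * cos (l * a - z\<^sup>2))"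
    have "(Q \<longlongrightarrow> Q0) (at_left a)"
    proof -
      define H where "H = (\<lambda>x. integral {- sqrt M..x} (\<lambda>y. 2 * cos (l * a - y\<^sup>2)))"
      have H: "continuous_on {- sqrt M..0} H"
        unfolding H_def by (intro indefinite_integral_continuous_1 integrable_continuous_real continuous_intros)
      have H0: "H 0 = Q0"
        using Henstock_Kurzweil_Integration.integral_reflect_real
          [where a = "- sqrt M" and b = 0 and f = "\<lambda>y. 2 * cos (l * a - y\<^sup>2)"]
        by (simp add: H_def Q0_def)
      have cont: "continuous_on {s1..a} (\<lambda>b. H (- sqrt (l * (a - b))))"
      proof (rule continuous_on_compose2[OF H])
        show "continuous_on {s1..a} (\<lambda>b. - sqrt (l * (a - b)))"
          by (intro continuous_intros)
        have "l * (a - b) \<le> M" if "s1 \<le> b" for b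
          using that \<open>0 < l\<close> by (simp add: s1_def field_simps)
        then show "(\<lambda>b. - sqrt (l * (a - b))) ` {s1..a} \<subseteq> {- sqrt M..0}"
          using \<open>0 < l\<close> by auto
      qed
      have "((\<lambda>b. H (- sqrt (l * (a - b)))) \<longlongrightarrow> H (- sqrt (l * (a - a)))) (at a within {s1..a})"
        using cont[unfolded continuous_on_def, THEN bspec, of a] s1 by simp
      moreover have Q_eq: "Q = (\<lambda>b. H (- sqrt (l * (a - b))))"
        by (simp add: H_def Q_def)
      moreover have "at a within {s1..a} = at_left a"
        using s1 by (simp add: at_within_Icc_at_left)
      ultimately show ?thesis
        using H0 by (simp add: Q_eq)
    qed
    then have "((\<lambda>b. A * \<bar>Q b\<bar> / sqrt l) \<longlongrightarrow> A * \<bar>Q0\<bar> / sqrt l) (at_left a)"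
      using \<open>0 < l\<close> by (intro tendsto_intros) auto
    moreover have "((\<lambda>b. \<bar>Dl b\<bar> + 2 / l + 10 * A / (sqrt M * sqrt l)) \<longlongrightarrow> \<bar>0\<bar> + 2 / l + 10 * A / (sqrt M * sqrt l)) (at_left a)"
      using D unfolding Dl_def[symmetric] by (intro tendsto_intros)
    moreover have "\<forall>\<^sub>F b in at_left a. A * \<bar>Q b\<bar> / sqrt l \<le> \<bar>Dl b\<bar> + 2 / l + 10 * A / (sqrt M * sqrt l)"
      unfolding eventually_at_left_field using s1 est by (intro exI[of _ s1]) auto
    ultimately have "A * \<bar>Q0\<bar> / sqrt l \<le> \<bar>0\<bar> + 2 / l + 10 * A / (sqrt M * sqrt l)"
      by (intro tendsto_le[of "at_left a"]) auto
    then have "sqrt l / A * (A * \<bar>Q0\<bar> / sqrt l) \<le> sqrt l / A * (2 / l + 10 * A / (sqrt M * sqrt l))"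
      using \<open>0 < l\<close> assms(5) by (intro mult_left_mono) auto
    also have "sqrt l / A * (A * \<bar>Q0\<bar> / sqrt l) = \<bar>Q0\<bar>"
      using \<open>0 < l\<close> assms(5) by simp
    also have "sqrt l / A * (2 / l + 10 * A / (sqrt M * sqrt l)) = 2 / (A * sqrt l) + 10 / sqrt M"
    proof -
      have "l = sqrt l * sqrt l" using \<open>0 < l\<close> by simp
      then have "sqrt l / A * (2 / l) = 2 / (A * sqrt l)"
        using \<open>0 < l\<close> assms(5) by (simp add: field_simps)
      then show ?thesis
        using \<open>0 < l\<close> assms(5,6) by (simp add: distrib_left)
    qed
    also have "2 / (A * sqrt l) \<le> 1 / sqrt M"
    proof -
      have "4 * M / A\<^sup>2 \<le> l" using l by (auto simp: l0_def)
      then have "4 * M \<le> A\<^sup>2 * l" using assms(5) by (simp add: field_simps)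
      then have "sqrt (4 * M) \<le> sqrt (A\<^sup>2 * l)" by simp
      then have "2 * sqrt M \<le> A * sqrt l" using assms(5) by (simp add: real_sqrt_mult)
      then show ?thesis using assms(5,6) \<open>0 < l\<close> by (simp add: field_simps)
    qed
    finally show "\<bar>integral {0..sqrt M} (\<lambda>z. 2 * cos (l * a - z\<^sup>2))\<bar> \<le> 12 / sqrt M"
      using assms(6) by (auto simp: Q0_def field_simps)
  qed
qed

text \<open>Baire's theorem makes up for thresholds \<open>K\<close> that depend on \<open>t\<close>
  in an uncontrolled way. If f exceeded \<open>\<kappa>\<close> somewhere, the set of
  \<open>t\<close> where some dilate beyond \<open>k\<close> exceeds \<open>\<kappa>\<close> would
  be open and dense for every \<open>k\<close>; a point common to all these sets violates the
  eventual bound.\<close>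

lemma periodic_bound_of_eventual_dilates:
  fixes f :: "real \<Rightarrow> real"
  assumes "t0 < t1" and unb: "\<And>K. \<exists>l\<in>L. K < l"
    and cont: "continuous_on UNIV f" and per: "\<And>x (n::int). f (x + 2 * pi * of_int n) = f x"
    and ev: "\<And>t. t \<in> {t0..t1} \<Longrightarrow> \<exists>K. \<forall>l\<in>L. K < l \<longrightarrow> \<bar>f (l * t)\<bar> \<le> \<kappa>"
  shows "\<bar>f x\<bar> \<le> \<kappa>"
proof (rule ccontr)
  assume x: "\<not> \<bar>f x\<bar> \<le> \<kappa>"
  define G where "G = (\<lambda>k::nat. \<Union>l\<in>{l\<in>L. real k < l}. {t\<in>{t0..t1}. \<kappa> < \<bar>f (l * t)\<bar>})"
  have ope: "openin (top_of_set {t0..t1}) (G k) \<and> {t0..t1} \<subseteq> closure (G k)" for k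
  proof
    have "openin (top_of_set {t0..t1}) {t \<in> {t0..t1}. \<kappa> < \<bar>f (l * t)\<bar>}" for l
    proof -
      have "continuous_on {t0..t1} (\<lambda>t. \<bar>f (l * t)\<bar>)"
        by (intro continuous_intros continuous_on_compose2[OF cont]) auto
      then have "openin (top_of_set {t0..t1}) ({t0..t1} \<inter> (\<lambda>t. \<bar>f (l * t)\<bar>) -` {\<kappa><..})"
        by (rule continuous_openin_preimage_gen) auto
      also have "{t0..t1} \<inter> (\<lambda>t. \<bar>f (l * t)\<bar>) -` {\<kappa><..} = {t \<in> {t0..t1}. \<kappa> < \<bar>f (l * t)\<bar>}"
        by auto
      finally show ?thesis .
    qed
    then show "openin (top_of_set {t0..t1}) (G k)"
      unfolding G_def by (intro openin_Union) auto
    show "{t0..t1} \<subseteq> closure (G k)"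
    proof
      fix t assume t: "t \<in> {t0..t1}"
      show "t \<in> closure (G k)"
        unfolding closure_approachable
      proof (intro allI impI)
        fix e :: real assume "0 < e"
        define c where "c = max t0 (t - e / 2)"
        define d where "d = min t1 (t + e / 2)"
        have cd: "c < d" "t0 \<le> c" "d \<le> t1" "t - e < c" "d < t + e"
          using t \<open>0 < e\<close> \<open>t0 < t1\<close> by (auto simp: c_def d_def)
        \<comment> \<open>So large that \<open>l * t\<close> covers more than a period while
          \<open>t\<close> runs over \<open>{c..d}\<close>; \<open>n\<close> below selects the first
          translate of \<open>x\<close> that is not below \<open>l * c\<close>.\<close>
        obtain l where l: "l \<in> L" "max (real k) (2 * pi / (d - c)) < l"
          using unb by blast
        then have "real k < l" "2 * pi / (d - c) < l" by auto
        have "0 < l" using \<open>real k < l\<close> by (meson of_nat_0_le_iff le_less_trans)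
        define n where "n = \<lceil>(l * c - x) / (2 * pi)\<rceil>"
        define s where "s = (x + 2 * pi * of_int n) / l"
        have n: "(l * c - x) / (2 * pi) \<le> of_int n" "of_int n < (l * c - x) / (2 * pi) + 1"
          unfolding n_def by linarith+
        have "l * c \<le> x + 2 * pi * of_int n" "x + 2 * pi * of_int n < l * c + 2 * pi"
          using n by (auto simp: field_simps)
        moreover have "2 * pi < l * (d - c)"
          using \<open>2 * pi / (d - c) < l\<close> cd by (simp add: field_simps)
        moreover have "l * s = x + 2 * pi * of_int n"
          using \<open>0 < l\<close> by (simp add: s_def)
        ultimately have "l * c \<le> l * s" "l * s < l * d"
          by (auto simp: right_diff_distrib)
        then have s: "c \<le> s" "s < d" using \<open>0 < l\<close> by auto
        have "f (l * s) = f x"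
          using per \<open>0 < l\<close> by (simp add: s_def)
        then have "s \<in> G k"
          using s cd l \<open>real k < l\<close> x by (auto simp: G_def)
        moreover have "dist s t < e"
          using s cd by (auto simp: dist_real_def)
        ultimately show "\<exists>y\<in>G k. dist y t < e" by blast
      qed
    qed
  qed
  have "{t0..t1} \<subseteq> closure (\<Inter> (range G))"
    using ope by (intro Baire) auto
  then have "\<Inter> (range G) \<noteq> {}"
    using \<open>t0 < t1\<close> by (metis atLeastatMost_empty_iff2 closure_empty less_le not_le subset_empty)
  then obtain t where t: "\<And>k. t \<in> G k" by blast
  then have "t \<in> {t0..t1}" by (auto simp: G_def)
  then obtain K where K: "\<And>l. l \<in> L \<Longrightarrow> K < l \<Longrightarrow> \<bar>f (l * t)\<bar> \<le> \<kappa>"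
    using ev by blast
  obtain k :: nat where "K < real k" using reals_Archimedean2 by blast
  then show False
    using t[of k] K by (auto simp: G_def) (meson le_less_trans less_le not_le less_trans)
qed

section \<open>Differentiation under moving limits\<close>

text \<open>Chain rule for the map (x, y) to \<open>integral {y1..y} (f x)\<close> along the curve
  (s, t s). Its partial derivative in y is \<open>f\<close> itself, so joint continuity of
  \<open>f\<close> makes the map differentiable.\<close>

lemma leibniz_rule_moving_upper:
  fixes f fs :: "real \<Rightarrow> real \<Rightarrow> real" and t :: "real \<Rightarrow> real"
  assumes "0 < \<rho>" and t0: "y1 < t s0" "t s0 < y2"
    and der: "\<And>s y. s \<in> {s0-\<rho>..s0+\<rho>} \<Longrightarrow> y \<in> {y1..y2} \<Longrightarrow> ((\<lambda>s. f s y) has_real_derivative fs s y) (at s)"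
    and cf: "continuous_on ({s0-\<rho>..s0+\<rho>} \<times> {y1..y2}) (\<lambda>(s, y). f s y)"
    and cfs: "continuous_on ({s0-\<rho>..s0+\<rho>} \<times> {y1..y2}) (\<lambda>(s, y). fs s y)"
    and t': "(t has_real_derivative t') (at s0)"
  shows "((\<lambda>s. integral {y1..t s} (f s)) has_real_derivative
            integral {y1..t s0} (fs s0) + f s0 (t s0) * t') (at s0)"
proof -
  define X where "X = {s0-\<rho>..s0+\<rho>}"
  define Y where "Y = {y1..y2}"
  have cfx: "continuous_on Y (f x)" if "x \<in> X" for x
    using that by (intro continuous_on_compose2[OF cf, of Y "Pair x", simplified] continuous_intros)
      (auto simp: X_def Y_def)
  have fx: "((\<lambda>s. integral {y1..t s0} (f s)) has_derivative (*) (integral {y1..t s0} (fs s0))) (at s0 within X)"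
  proof -
    have "((\<lambda>s. integral (cbox y1 (t s0)) (f s)) has_field_derivative integral (cbox y1 (t s0)) (fs s0)) (at s0 within X)"
    proof (rule leibniz_rule_field_derivative)
      show "((\<lambda>s. f s y) has_field_derivative fs s y) (at s within X)" if "s \<in> X" "y \<in> cbox y1 (t s0)" for s y
        using der[of s y] that t0 by (auto simp: X_def intro: has_field_derivative_at_within)
      show "f s integrable_on cbox y1 (t s0)" if "s \<in> X" for s
        using continuous_on_subset[OF cfx[OF that], of "{y1..t s0}"] t0
        by (auto simp: Y_def intro: integrable_continuous_real)
      show "continuous_on (X \<times> cbox y1 (t s0)) (\<lambda>(s, y). fs s y)"
        by (rule continuous_on_subset[OF cfs]) (use t0 in \<open>auto simp: X_def\<close>)
    qed (use \<open>0 < \<rho>\<close> in \<open>auto simp: X_def\<close>)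
    then show ?thesis by (simp add: has_field_derivative_def)
  qed
  have "((\<lambda>(x, y). integral {y1..y} (f x)) has_derivative
      (\<lambda>(tx, ty). integral {y1..t s0} (fs s0) * tx + blinfun_mult_right (f s0 (t s0)) ty)) (at (s0, t s0) within X \<times> Y)"
  proof (rule has_derivative_partialsI[where f = "\<lambda>x y. integral {y1..y} (f x)"])
    show "((\<lambda>s. integral {y1..t s0} (f s)) has_derivative (*) (integral {y1..t s0} (fs s0))) (at s0 within X)"
      by (rule fx)
    show "((\<lambda>y. integral {y1..y} (f x)) has_derivative blinfun_apply (blinfun_mult_right (f x y))) (at y within Y)"
      if "x \<in> X" "y \<in> Y" for x y
      using integral_has_real_derivative[of y1 y2 "f x" y] cfx[OF that(1)] that
      by (simp add: Y_def has_field_derivative_def)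
    have "continuous_on (X \<times> Y) (\<lambda>(x, y). blinfun_mult_right (f x y))"
      using bounded_linear.continuous_on[OF bounded_linear_blinfun_mult_right cf]
      by (simp add: X_def Y_def split_beta)
    then show "continuous (at (s0, t s0) within X \<times> Y) (\<lambda>(x, y). blinfun_mult_right (f x y))"
      using \<open>0 < \<rho>\<close> t0 by (auto simp: continuous_on_eq_continuous_within X_def Y_def)
  qed (use t0 in \<open>auto simp: Y_def\<close>)
  moreover have "at (s0, t s0) within X \<times> Y = at (s0, t s0)"
    using \<open>0 < \<rho>\<close> t0 by (intro at_within_interior) (auto simp: interior_Times X_def Y_def)
  ultimately have F: "((\<lambda>(x, y). integral {y1..y} (f x)) has_derivative
      (\<lambda>(tx, ty). integral {y1..t s0} (fs s0) * tx + f s0 (t s0) * ty)) (at (s0, t s0))"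
    by simp
  have P: "((\<lambda>s. (s, t s)) has_derivative (\<lambda>h. (h, t' * h))) (at s0)"
    using t' by (auto intro!: derivative_eq_intros simp: has_field_derivative_def)
  have "((\<lambda>s. integral {y1..t s} (f s)) has_derivative
      (\<lambda>h. integral {y1..t s0} (fs s0) * h + f s0 (t s0) * (t' * h))) (at s0)"
    using has_derivative_compose[OF P F] by simp
  then show ?thesis
    by (rule has_derivative_imp_has_field_derivative) (simp add: algebra_simps)
qed

text \<open>\<open>D\<close> will be a dilated planar domain, which is not a product. Compactness of
  the segment over \<open>s0\<close> fits a box into \<open>D\<close>, and a base point
  \<open>y1\<close> below both limits reduces the claim to a difference of two integrals with moving
  upper limit.\<close>

lemma leibniz_rule_moving_limits:
  fixes f fs :: "real \<Rightarrow> real \<Rightarrow> real" and b t :: "real \<Rightarrow> real"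
  assumes "open D" and sub: "{s0} \<times> {b s0..t s0} \<subseteq> D" and le: "b s0 \<le> t s0"
    and ev: "\<forall>\<^sub>F s in at s0. b s \<le> t s"
    and der: "\<And>s y. (s, y) \<in> D \<Longrightarrow> ((\<lambda>s. f s y) has_real_derivative fs s y) (at s)"
    and cf: "continuous_on D (\<lambda>(s, y). f s y)"
    and cfs: "continuous_on D (\<lambda>(s, y). fs s y)"
    and b': "(b has_real_derivative b') (at s0)"
    and t': "(t has_real_derivative t') (at s0)"
  shows "((\<lambda>s. integral {b s..t s} (f s)) has_real_derivative
            integral {b s0..t s0} (fs s0) + f s0 (t s0) * t' - f s0 (b s0) * b') (at s0)"
proof -
  obtain e where "0 < e" and e: "(\<Union>x\<in>{s0} \<times> {b s0..t s0}. ball x e) \<subseteq> D"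
    using compact_subset_open_imp_ball_epsilon_subset[OF compact_Times \<open>open D\<close> sub] by auto
  define \<rho> where "\<rho> = e / 3"
  define y1 where "y1 = b s0 - \<rho>"
  define y2 where "y2 = t s0 + \<rho>"
  have "0 < \<rho>" using \<open>0 < e\<close> by (simp add: \<rho>_def)
  have box: "{s0-\<rho>..s0+\<rho>} \<times> {y1..y2} \<subseteq> D"
  proof safe
    fix s y assume s: "s \<in> {s0-\<rho>..s0+\<rho>}" and y: "y \<in> {y1..y2}"
    \<comment> \<open>The point of the segment nearest to \<open>y\<close>; each coordinate moves by
      at most \<open>e / 3\<close>.\<close>
    define y' where "y' = max (b s0) (min (t s0) y)"
    have y': "y' \<in> {b s0..t s0}" "\<bar>y' - y\<bar> \<le> \<rho>"
      using y le \<open>0 < \<rho>\<close> by (auto simp: y'_def y1_def y2_def)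
    have "dist (s0, y') (s, y) \<le> \<bar>s0 - s\<bar> + \<bar>y' - y\<bar>"
      unfolding dist_Pair_Pair dist_real_def by (rule sqrt_sum_squares_le_sum_abs[THEN order_trans]) auto
    also have "\<bar>s0 - s\<bar> + \<bar>y' - y\<bar> \<le> \<rho> + \<bar>y' - y\<bar>"
      using s by auto
    also have "\<rho> + \<bar>y' - y\<bar> < e"
      using y'(2) \<open>0 < e\<close> by (simp add: \<rho>_def)
    finally have "(s, y) \<in> ball (s0, y') e" by simp
    then show "(s, y) \<in> D" using e y'(1) by blast
  qed
  have der': "((\<lambda>s. f s y) has_real_derivative fs s y) (at s)"
    if "s \<in> {s0-\<rho>..s0+\<rho>}" "y \<in> {y1..y2}" for s y
    using der box that by blast
  note up = leibniz_rule_moving_upper[OF \<open>0 < \<rho>\<close> _ _ der' continuous_on_subset[OF cf box] continuous_on_subset[OF cfs box]]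
  have d: "((\<lambda>s. integral {y1..t s} (f s) - integral {y1..b s} (f s)) has_real_derivative
     (integral {y1..t s0} (fs s0) + f s0 (t s0) * t') - (integral {y1..b s0} (fs s0) + f s0 (b s0) * b')) (at s0)"
    using le \<open>0 < \<rho>\<close> by (intro DERIV_diff up t' b') (auto simp: y1_def y2_def)
  have int: "g integrable_on {c..d}" if "continuous_on {y1..y2} g" "y1 \<le> c" "d \<le> y2" for g :: "real \<Rightarrow> real" and c d
    using that by (intro integrable_continuous_real continuous_on_subset[OF that(1)]) auto
  have cslice: "continuous_on {y1..y2} (g s)"
    if "continuous_on D (\<lambda>(s, y). g s y)" "s \<in> {s0-\<rho>..s0+\<rho>}" for g :: "real \<Rightarrow> real \<Rightarrow> real" and s
  proof -
    have "Pair s ` {y1..y2} \<subseteq> D" using box that(2) by auto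
    then show ?thesis
      using continuous_on_compose2[OF that(1), of "{y1..y2}" "Pair s"] by (simp add: continuous_intros)
  qed
  have split: "integral {y1..d} g - integral {y1..c} g = integral {c..d} g"
    if "continuous_on {y1..y2} g" "y1 \<le> c" "c \<le> d" "d \<le> y2" for g :: "real \<Rightarrow> real" and c d
    using Henstock_Kurzweil_Integration.integral_combine[of y1 c d g] int[OF that(1), of y1 d] that by simp
  have "\<forall>\<^sub>F s in at s0. integral {y1..t s} (f s) - integral {y1..b s} (f s) = integral {b s..t s} (f s)"
  proof -
    have "(t \<longlongrightarrow> t s0) (at s0)" "(b \<longlongrightarrow> b s0) (at s0)"
      using t' b' DERIV_isCont isCont_def by blast+
    then have "\<forall>\<^sub>F s in at s0. t s < y2" "\<forall>\<^sub>F s in at s0. y1 < b s"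
      using \<open>0 < \<rho>\<close> by (auto simp: y1_def y2_def order_tendsto_iff)
    moreover have "\<forall>\<^sub>F s in at s0. dist s s0 < \<rho>"
      using \<open>0 < \<rho>\<close> unfolding eventually_at by blast
    ultimately show ?thesis
      using ev
    proof eventually_elim
      case (elim s)
      then show ?case
        by (intro split cslice[OF cf]) (auto simp: dist_real_def)
    qed
  qed
  moreover have f0: "integral {y1..t s0} (f s0) - integral {y1..b s0} (f s0) = integral {b s0..t s0} (f s0)"
    using le \<open>0 < \<rho>\<close> by (intro split cslice[OF cf]) (auto simp: y1_def y2_def)
  ultimately have "\<forall>\<^sub>F s in nhds s0. integral {y1..t s} (f s) - integral {y1..b s} (f s) = integral {b s..t s} (f s)"
    by (simp add: eventually_nhds_conv_at)
  then have "((\<lambda>s. integral {b s..t s} (f s)) has_real_derivative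
     (integral {y1..t s0} (fs s0) + f s0 (t s0) * t') - (integral {y1..b s0} (fs s0) + f s0 (b s0) * b')) (at s0)"
    using d by (subst (asm) DERIV_cong_ev[OF refl _ refl])
  moreover have "integral {y1..t s0} (fs s0) - integral {y1..b s0} (fs s0) = integral {b s0..t s0} (fs s0)"
    using le \<open>0 < \<rho>\<close> by (intro split cslice[OF cfs]) (auto simp: y1_def y2_def)
  ultimately show ?thesis
    by (elim DERIV_cong) linarith
qed

section \<open>Slices of a convex domain\<close>

text \<open>The two projections add up to the identity matrix. In the plane, \<open>D\<close> is the
  determinant of the frame, Lagrange's identity gives D * D = 1, and \<open>t\<close> is
  \<open>D\<close> times \<open>w\<close> turned by a right angle.\<close>

lemma orthonormal_components:
  fixes w t :: "real^2"
  assumes "norm w = 1" "norm t = 1" "w \<bullet> t = 0"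
  shows "w $ i * w $ j + t $ i * t $ j = (if i = j then 1 else 0)"
proof -
  define a b c d where abcd: "a = w $ 1" "b = w $ 2" "c = t $ 1" "d = t $ 2"
  have 1: "a * a + b * b = 1" "c * c + d * d = 1" "a * c + b * d = 0"
    using assms by (auto simp: norm_eq_1 inner_vec_def sum_2 abcd)
  define D where "D = a * d - b * c"
  have "D * D = (a * a + b * b) * (c * c + d * d) - (a * c + b * d) * (a * c + b * d)"
    unfolding D_def by (simp add: algebra_simps)
  then have D1: "D * D = 1" using 1 by simp
  have "- b * D = c * (a * a + b * b) - a * (a * c + b * d)" "a * D = d * (a * a + b * b) - b * (a * c + b * d)"
    unfolding D_def by (simp_all add: algebra_simps)
  then have cd: "c = - b * D" "d = a * D" using 1 by auto
  have "c * c = b * b * (D * D)" "d * d = a * a * (D * D)" "c * d = - (a * b * (D * D))"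
    by (simp_all only: cd) (simp_all add: algebra_simps)
  then have "a * a + c * c = 1" "b * b + d * d = 1" "a * b + c * d = 0"
    using 1 D1 by auto
  then show ?thesis
    using exhaust_2[of i] exhaust_2[of j] by (auto simp: abcd mult.commute)
qed

lemma orthonormal_expansion:
  fixes w t x :: "real^2"
  assumes "norm w = 1" "norm t = 1" "w \<bullet> t = 0"
  shows "x = (x \<bullet> w) *\<^sub>R w + (x \<bullet> t) *\<^sub>R t"
proof -
  note c = orthonormal_components[OF assms]
  have "x $ i = (x \<bullet> w) * w $ i + (x \<bullet> t) * t $ i" for i
  proof -
    have "x $ i = (\<Sum>j\<in>UNIV. x $ j * (if j = i then 1 else 0))"
      by (simp add: if_distrib[of "(*) _"] cong: if_cong)
    also have "\<dots> = (\<Sum>j\<in>UNIV. x $ j * (w $ j * w $ i + t $ j * t $ i))"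
      by (simp add: c)
    also have "\<dots> = (x \<bullet> w) * w $ i + (x \<bullet> t) * t $ i"
      by (simp add: inner_vec_def sum_2 algebra_simps)
    finally show ?thesis .
  qed
  then show ?thesis by (simp add: vec_eq_iff)
qed

text \<open>\<open>outer_normal\<close> speaks only of short pieces of rays. Convexity makes this
  global: the segment from \<open>p\<close> to \<open>x\<close> stays in the closure, so its
  direction cannot be one that leaves it.\<close>

lemma outer_normal_support:
  assumes "convex S" "p \<in> closure S" "outer_normal S p \<nu>" "x \<in> closure S"
  shows "(x - p) \<bullet> \<nu> \<le> 0"
proof (rule ccontr)
  assume "\<not> (x - p) \<bullet> \<nu> \<le> 0"
  then have "\<forall>\<^sub>F \<tau> in at_right 0. p + \<tau> *\<^sub>R (x - p) \<notin> closure S"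
    using assms(3) by (auto simp: outer_normal_def)
  moreover have "\<forall>\<^sub>F \<tau> in at_right (0::real). \<tau> < 1"
    by (intro order_tendstoD) (auto intro: tendsto_intros)
  moreover have "\<forall>\<^sub>F \<tau> in at_right (0::real). 0 < \<tau>"
    by (rule eventually_at_right_less)
  ultimately have "\<forall>\<^sub>F \<tau> in at_right (0::real). False"
  proof eventually_elim
    case (elim \<tau>)
    have "(1 - \<tau>) *\<^sub>R p + \<tau> *\<^sub>R x \<in> closure S"
      using convex_closure[OF assms(1)] assms(2,4) elim by (intro convexD) auto
    then show ?case using elim(1) by (simp add: algebra_simps)
  qed
  then show False by simp
qed

lemma outer_normal_support_strict:
  assumes "open S" "convex S" "p \<in> closure S" "outer_normal S p \<nu>" "x \<in> S"
  shows "(x - p) \<bullet> \<nu> < 0"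
proof -
  obtain e where "0 < e" "cball x e \<subseteq> S"
    using assms(1,5) open_contains_cball by blast
  moreover have "norm \<nu> = 1" using assms(4) by (simp add: outer_normal_def)
  ultimately have "x + e *\<^sub>R \<nu> \<in> closure S"
    using closure_subset by (fastforce simp: dist_norm)
  from outer_normal_support[OF assms(2,3,4) this] have "(x - p) \<bullet> \<nu> + e * (\<nu> \<bullet> \<nu>) \<le> 0"
    by (simp add: inner_simps algebra_simps)
  then show ?thesis
    using \<open>0 < e\<close> \<open>norm \<nu> = 1\<close> by (simp add: norm_eq_1)
qed

locale convex_slices =
  fixes S :: "(real^2) set" and z w t :: "real^2"
  assumes open_S: "open S" and convex_S: "convex S" and bounded_S: "bounded S" and z_in: "z \<in> S"
    and norm_w: "norm w = 1" and norm_t: "norm t = 1" and orth: "w \<bullet> t = 0"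
    and normals: "\<And>p. p \<in> frontier S \<Longrightarrow> \<exists>\<nu>. outer_normal S p \<nu>"
begin

definition pt :: "real \<Rightarrow> real \<Rightarrow> real^2" where "pt s y = z + s *\<^sub>R w + y *\<^sub>R t"
definition shadow :: "real set" where "shadow = {s. \<exists>y. pt s y \<in> S}"
text \<open>Meaningful over \<open>shadow\<close> only, where the slice is a nonempty bounded
  interval; elsewhere it is the supremum of the empty set.\<close>

definition upper :: "real \<Rightarrow> real" where "upper s = Sup {y. pt s y \<in> S}"
definition lower :: "real \<Rightarrow> real" where "lower s = Inf {y. pt s y \<in> S}"

lemma inner_wt [simp]: "w \<bullet> w = 1" "t \<bullet> t = 1" "w \<bullet> t = 0" "t \<bullet> w = 0"
  using norm_w norm_t orth by (auto simp: norm_eq_1 inner_commute)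

lemma pt_coords: "x = pt ((x - z) \<bullet> w) ((x - z) \<bullet> t)"
  using orthonormal_expansion[OF norm_w norm_t orth, of "x - z"]
  unfolding pt_def by (metis add.assoc add_diff_cancel_left' diff_add_cancel add.commute)

lemma pt_diff: "pt s y - pt s' y' = (s - s') *\<^sub>R w + (y - y') *\<^sub>R t"
  by (simp add: pt_def algebra_simps)

lemma continuous_on_pt [continuous_intros]:
  "continuous_on A f \<Longrightarrow> continuous_on A g \<Longrightarrow> continuous_on A (\<lambda>x. pt (f x) (g x))"
  unfolding pt_def by (intro continuous_intros)

text \<open>Changing the sign of \<open>t\<close> exchanges \<open>upper\<close> and
  \<open>- lower\<close>, so facts about the lower arc are instances of facts about the upper
  one.\<close>

lemma reflect: "convex_slices S z w (- t)"
  using open_S convex_S bounded_S z_in norm_w norm_t orth normals by unfold_locales auto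

lemma pt_convex:
  "u + v = 1 \<Longrightarrow> u *\<^sub>R pt s y + v *\<^sub>R pt s' y' = pt (u * s + v * s') (u * y + v * y')"
proof -
  assume "u + v = 1"
  then have "u *\<^sub>R z + v *\<^sub>R z = z" by (metis scaleR_left.add scaleR_one)
  then show ?thesis by (simp add: pt_def algebra_simps)
qed

lemma open_slice: "open {y. pt s y \<in> S}"
proof -
  have "open (pt s -` S)"
    by (intro open_vimage open_S) (auto intro: continuous_intros)
  then show ?thesis by (simp add: vimage_def)
qed

lemma bounded_slice: "\<exists>B. \<forall>s y. pt s y \<in> closure S \<longrightarrow> \<bar>s\<bar> \<le> B \<and> \<bar>y\<bar> \<le> B"
proof -
  obtain B where B: "\<And>x. x \<in> closure S \<Longrightarrow> norm x \<le> B"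
    using bounded_closure[OF bounded_S] by (auto simp: bounded_iff)
  have "\<bar>s\<bar> \<le> B + norm z \<and> \<bar>y\<bar> \<le> B + norm z" if "pt s y \<in> closure S" for s y
  proof -
    have "norm (pt s y - z) \<le> B + norm z"
      using B[OF that] norm_triangle_ineq4[of "pt s y" z] by simp
    moreover have "(pt s y - z) \<bullet> w = s" "(pt s y - z) \<bullet> t = y"
      by (auto simp: pt_def inner_simps)
    ultimately show ?thesis
      using Cauchy_Schwarz_ineq2[of "pt s y - z" w] Cauchy_Schwarz_ineq2[of "pt s y - z" t]
      by (simp add: norm_w norm_t)
  qed
  then show ?thesis by blast
qed

lemma bdd_slice: "bdd_above {y. pt s y \<in> S}" "bdd_below {y. pt s y \<in> S}"
proof -
  obtain B where "\<And>s y. pt s y \<in> closure S \<Longrightarrow> \<bar>y\<bar> \<le> B"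
    using bounded_slice by blast
  then have "- B \<le> y \<and> y \<le> B" if "pt s y \<in> S" for y
    using closure_subset[of S] that by (fastforce simp: abs_le_iff)
  then show "bdd_above {y. pt s y \<in> S}" "bdd_below {y. pt s y \<in> S}"
    unfolding bdd_above_def bdd_below_def by blast+
qed

lemma slice_iff:
  assumes "s \<in> shadow"
  shows "pt s y \<in> S \<longleftrightarrow> lower s < y \<and> y < upper s"
proof -
  let ?A = "{y. pt s y \<in> S}"
  have ne: "?A \<noteq> {}" using assms by (auto simp: shadow_def)
  show ?thesis
  proof
    assume "pt s y \<in> S"
    then obtain e where "0 < e" "cball y e \<subseteq> ?A"
      using open_slice[of s] open_contains_cball by blast
    then have "y + e \<in> ?A" "y - e \<in> ?A" by (auto simp: subset_iff dist_real_def)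
    then have "y + e \<le> upper s" "lower s \<le> y - e"
      unfolding upper_def lower_def by (auto intro: cSup_upper cInf_lower bdd_slice)
    then show "lower s < y \<and> y < upper s" using \<open>0 < e\<close> by simp
  next
    assume "lower s < y \<and> y < upper s"
    then obtain a b where ab: "a \<in> ?A" "a < y" "b \<in> ?A" "y < b"
      unfolding upper_def lower_def using less_cSup_iff[OF ne bdd_slice(1)] cInf_less_iff[OF ne bdd_slice(2)]
      by blast
    define u where "u = (b - y) / (b - a)"
    have u: "0 \<le> u" "0 \<le> 1 - u" using ab by (auto simp: u_def field_simps)
    have "u * a + (1 - u) * b = b - u * (b - a)" by (simp add: algebra_simps)
    also have "\<dots> = y" using ab by (simp add: u_def)
    finally have "u * a + (1 - u) * b = y" .
    then have "pt s y = u *\<^sub>R pt s a + (1 - u) *\<^sub>R pt s b"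
      by (subst pt_convex) (auto simp: algebra_simps)
    then show "pt s y \<in> S"
      using convexD[OF convex_S _ _ u] ab by simp
  qed
qed

lemma lower_less_upper: "s \<in> shadow \<Longrightarrow> lower s < upper s"
  using slice_iff[of s] by (fastforce simp: shadow_def)

lemma pt_closure:
  assumes "s \<in> shadow" "lower s \<le> y" "y \<le> upper s"
  shows "pt s y \<in> closure S"
proof -
  have "y \<in> closure {lower s<..<upper s}"
    using assms lower_less_upper by (simp add: closure_greaterThanLessThan)
  moreover have "pt s ` closure {lower s<..<upper s} \<subseteq> closure S"
    using assms(1) slice_iff
    by (intro image_closure_subset) (auto intro!: continuous_intros subsetD[OF closure_subset])
  ultimately show ?thesis by blast
qed

lemma upper_frontier: "s \<in> shadow \<Longrightarrow> pt s (upper s) \<in> frontier S"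
  using pt_closure[of s "upper s"] lower_less_upper[of s] slice_iff[of s "upper s"]
  by (simp add: frontier_def interior_open[OF open_S])

lemma reflect_eqs:
  "convex_slices.pt z w (- t) s y = pt s (- y)"
  "convex_slices.shadow S z w (- t) = shadow"
  "convex_slices.upper S z w (- t) s = - lower s"
  "convex_slices.lower S z w (- t) s = - upper s"
proof -
  interpret n: convex_slices S z w "- t" by (rule reflect)
  show pt: "n.pt s y = pt s (- y)" for s y by (simp add: n.pt_def pt_def)
  show "n.shadow = shadow"
    unfolding n.shadow_def shadow_def pt by (auto intro: exI[of _ "- y" for y])
  have A: "{y. pt s (- y) \<in> S} = uminus ` {y. pt s y \<in> S}"
    by (auto intro: image_eqI[where x = "- y" for y])
  show "n.upper s = - lower s"
    unfolding n.upper_def lower_def pt A Inf_real_def by simp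
  show "n.lower s = - upper s"
    unfolding n.lower_def upper_def pt A Inf_real_def by (simp add: image_image)
qed

lemma lower_frontier: "s \<in> shadow \<Longrightarrow> pt s (lower s) \<in> frontier S"
  using convex_slices.upper_frontier[OF reflect] by (simp add: reflect_eqs)

lemma open_shadow: "open shadow"
proof -
  have "shadow = (\<Union>y. (\<lambda>s. pt s y) -` S)"
    by (auto simp: shadow_def)
  then show ?thesis
    using open_S by (auto intro!: open_UN open_vimage continuous_intros)
qed

lemma convex_shadow: "convex shadow"
  unfolding convex_def shadow_def
proof (safe)
  fix s s' u v y y' assume *: "pt s y \<in> S" "pt s' y' \<in> S" "0 \<le> u" "0 \<le> v" "u + v = (1::real)"
  show "\<exists>y. pt (u *\<^sub>R s + v *\<^sub>R s') y \<in> S"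
    using convexD[OF convex_S *] pt_convex[OF *(5), of s y s' y'] by auto
qed

context
  fixes s \<nu>
  assumes s: "s \<in> shadow" and \<nu>: "outer_normal S (pt s (upper s)) \<nu>"
begin

text \<open>The chord through the boundary point meets the interior, so it cannot be
  tangent.\<close>

lemma normal_pos: "0 < \<nu> \<bullet> t"
proof -
  define y where "y = (lower s + upper s) / 2"
  have y: "lower s < y" "y < upper s" using lower_less_upper[OF s] by (auto simp: y_def)
  then have "(pt s y - pt s (upper s)) \<bullet> \<nu> < 0"
    using outer_normal_support_strict[OF open_S convex_S _ \<nu>] slice_iff[OF s] pt_closure[OF s, of "upper s"]
    by auto
  then have "(y - upper s) * (t \<bullet> \<nu>) < 0" by (simp add: pt_diff)
  then show ?thesis using y by (simp add: mult_less_0_iff inner_commute)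
qed

lemma upper_le_tangent:
  assumes "s' \<in> shadow"
  shows "upper s' - upper s \<le> - (\<nu> \<bullet> w) / (\<nu> \<bullet> t) * (s' - s)"
proof -
  have "(pt s' (upper s') - pt s (upper s)) \<bullet> \<nu> \<le> 0"
    using lower_less_upper s assms
    by (intro outer_normal_support[OF convex_S _ \<nu>] pt_closure) (auto intro: less_imp_le)
  then have "(s' - s) * (w \<bullet> \<nu>) + (upper s' - upper s) * (t \<bullet> \<nu>) \<le> 0"
    by (simp add: pt_diff inner_add_left)
  then show ?thesis using normal_pos by (simp add: field_simps inner_commute)
qed

lemma upper_ge_along:
  assumes "r \<in> {1, -1}" "0 < e"
  shows "\<forall>\<^sub>F \<tau> in at_right 0. s + r * \<tau> \<in> shadow \<and>
    upper (s + r * \<tau>) \<ge> upper s + - (\<nu> \<bullet> w) / (\<nu> \<bullet> t) * (r * \<tau>) - e * \<tau>"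
proof -
  define m where "m = - (\<nu> \<bullet> w) / (\<nu> \<bullet> t)"
  \<comment> \<open>The tangent direction tilted down by \<open>e\<close>; this makes it point
    strictly inwards, so the ray stays in \<open>S\<close> for a short time.\<close>
  define v where "v = r *\<^sub>R w + (r * m - e) *\<^sub>R t"
  have "v \<bullet> \<nu> = r * (\<nu> \<bullet> w) + (r * m - e) * (\<nu> \<bullet> t)"
    by (simp add: v_def inner_simps inner_commute)
  also have "\<dots> = - e * (\<nu> \<bullet> t)"
    using normal_pos by (simp add: m_def field_simps)
  also have "\<dots> < 0" using normal_pos assms by simp
  finally have "\<forall>\<^sub>F \<tau> in at_right 0. pt s (upper s) + \<tau> *\<^sub>R v \<in> S"
    using \<nu> by (auto simp: outer_normal_def)
  then show ?thesis
  proof eventually_elim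
    case (elim \<tau>)
    have "pt s (upper s) + \<tau> *\<^sub>R v = pt (s + r * \<tau>) (upper s + \<tau> * (r * m - e))"
      by (simp add: pt_def v_def algebra_simps)
    then have in_S: "pt (s + r * \<tau>) (upper s + \<tau> * (r * m - e)) \<in> S" using elim by simp
    then have "s + r * \<tau> \<in> shadow" by (auto simp: shadow_def)
    with in_S show ?case
      using slice_iff by (fastforce simp: m_def algebra_simps)
  qed
qed

text \<open>Squeeze: convexity puts the arc below its tangent line, and the inward rays on both
  sides keep it above that line up to \<open>e / 2\<close> times the distance. An outer normal thus
  yields differentiability.\<close>

lemma upper_has_derivative: "(upper has_real_derivative - (\<nu> \<bullet> w) / (\<nu> \<bullet> t)) (at s)"
proof -
  define m where "m = - (\<nu> \<bullet> w) / (\<nu> \<bullet> t)"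
  have "\<exists>d>0. \<forall>s'. 0 < norm (s' - s) \<and> norm (s' - s) < d \<longrightarrow>
      norm (upper s' - upper s - m * (s' - s)) / norm (s' - s) < e" if "0 < e" for e
  proof -
    have e2: "0 < e / 2" using that by simp
    obtain d1 where "0 < d1" and d1: "\<And>\<tau>. 0 < \<tau> \<Longrightarrow> \<tau> < d1 \<Longrightarrow> s + \<tau> \<in> shadow \<and> upper (s + \<tau>) \<ge> upper s + m * \<tau> - e / 2 * \<tau>"
      using upper_ge_along[of 1, OF _ e2] unfolding eventually_at_right_field m_def[symmetric] by auto
    obtain d2 where "0 < d2" and d2: "\<And>\<tau>. 0 < \<tau> \<Longrightarrow> \<tau> < d2 \<Longrightarrow> s - \<tau> \<in> shadow \<and> upper (s - \<tau>) \<ge> upper s - m * \<tau> - e / 2 * \<tau>"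
      using upper_ge_along[of "-1", OF _ e2] unfolding eventually_at_right_field m_def[symmetric] by auto
    show ?thesis
    proof (intro exI conjI allI impI)
      show "0 < min d1 d2" using \<open>0 < d1\<close> \<open>0 < d2\<close> by simp
      fix s' assume s': "0 < norm (s' - s) \<and> norm (s' - s) < min d1 d2"
      have "s' \<in> shadow \<and> upper s' \<ge> upper s + m * (s' - s) - e / 2 * \<bar>s' - s\<bar>"
      proof (cases "s < s'")
        case True
        then show ?thesis using d1[of "s' - s"] s' by simp
      next
        case False
        then show ?thesis using d2[of "s - s'"] s' by (simp add: algebra_simps)
      qed
      moreover from this have "upper s' - upper s \<le> m * (s' - s)"
        using upper_le_tangent unfolding m_def by blast
      ultimately have "\<bar>upper s' - upper s - m * (s' - s)\<bar> \<le> e / 2 * \<bar>s' - s\<bar>"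
        by linarith
      also have "\<dots> < e * \<bar>s' - s\<bar>" using s' that by simp
      finally show "norm (upper s' - upper s - m * (s' - s)) / norm (s' - s) < e"
        using s' by (simp add: divide_less_eq)
    qed
  qed
  then show ?thesis
    unfolding has_field_derivative_def has_derivative_at' m_def[symmetric]
    by (auto intro: bounded_linear_mult_right)
qed

lemma deriv_upper: "deriv upper s = - (\<nu> \<bullet> w) / (\<nu> \<bullet> t)"
  by (rule DERIV_imp_deriv[OF upper_has_derivative])

text \<open>Converts the prescribed normal derivative into slice coordinates: the length of the
  graph normal is exactly the arc length factor, so \<open>c\<close> will appear multiplied by the
  arc length density.\<close>

lemma upper_normal_eq: "t - deriv upper s *\<^sub>R w = sqrt (1 + (deriv upper s)\<^sup>2) *\<^sub>R \<nu>"
proof -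
  define m where "m = deriv upper s"
  have 1: "\<nu> = (\<nu> \<bullet> t) *\<^sub>R (t - m *\<^sub>R w)"
    using orthonormal_expansion[OF norm_w norm_t orth, of \<nu>] normal_pos
    by (simp add: m_def deriv_upper algebra_simps)
  have "norm (t - m *\<^sub>R w) = sqrt (1 + m\<^sup>2)"
    by (simp add: norm_eq_sqrt_inner inner_diff_left inner_diff_right power2_eq_square)
  moreover have "norm \<nu> = 1" using \<nu> by (simp add: outer_normal_def)
  ultimately have "(\<nu> \<bullet> t) * sqrt (1 + m\<^sup>2) = 1"
    using arg_cong[OF 1, of norm] normal_pos by simp
  then have "sqrt (1 + m\<^sup>2) *\<^sub>R ((\<nu> \<bullet> t) *\<^sub>R (t - m *\<^sub>R w)) = t - m *\<^sub>R w"
    by (simp add: mult.commute)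
  then show ?thesis by (metis 1 m_def)
qed

lemma sqrt_deriv_upper: "sqrt (1 + (deriv upper s)\<^sup>2) = 1 / (\<nu> \<bullet> t)"
proof -
  have "1 = sqrt (1 + (deriv upper s)\<^sup>2) * (\<nu> \<bullet> t)"
    using arg_cong[OF upper_normal_eq, of "\<lambda>x. x \<bullet> t"] by (simp add: inner_diff_left)
  then show ?thesis using normal_pos by (simp add: field_simps)
qed

end

lemma upper_deriv:
  assumes "s \<in> shadow"
  shows "(upper has_real_derivative deriv upper s) (at s)"
proof -
  obtain \<nu> where "outer_normal S (pt s (upper s)) \<nu>"
    using normals upper_frontier[OF assms] by blast
  from upper_has_derivative[OF assms this] deriv_upper[OF assms this] show ?thesis by simp
qed

lemma deriv_upper_antimono:
  assumes "s \<in> shadow" "s' \<in> shadow" "s \<le> s'"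
  shows "deriv upper s' \<le> deriv upper s"
proof (cases "s = s'")
  case False
  obtain \<nu> \<nu>' where n: "outer_normal S (pt s (upper s)) \<nu>" "outer_normal S (pt s' (upper s')) \<nu>'"
    using normals upper_frontier assms by meson
  have "upper s' - upper s \<le> deriv upper s * (s' - s)" "upper s - upper s' \<le> deriv upper s' * (s - s')"
    using upper_le_tangent n assms deriv_upper by metis+
  then have "0 \<le> (deriv upper s - deriv upper s') * (s' - s)"
    by (simp add: algebra_simps)
  then show ?thesis using False assms(3) by (simp add: zero_le_mult_iff)
qed simp

lemma lower_deriv:
  assumes "s \<in> shadow"
  shows "(lower has_real_derivative deriv lower s) (at s)"
    and "convex_slices.upper S z w (- t) = (\<lambda>s. - lower s)"
    and "deriv (convex_slices.upper S z w (- t)) s = - deriv lower s"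
proof -
  interpret n: convex_slices S z w "- t" by (rule reflect)
  show up: "n.upper = (\<lambda>s. - lower s)" by (rule ext) (rule reflect_eqs)
  have "((\<lambda>s. - lower s) has_real_derivative deriv n.upper s) (at s)"
    using n.upper_deriv assms by (simp add: reflect_eqs up)
  from DERIV_minus[OF this] have "(lower has_real_derivative - deriv n.upper s) (at s)"
    by simp
  then show "(lower has_real_derivative deriv lower s) (at s)" "deriv n.upper s = - deriv lower s"
    using DERIV_imp_deriv by fastforce+
qed

lemma lower_normal_eq:
  assumes "s \<in> shadow" "outer_normal S (pt s (lower s)) \<nu>"
  shows "deriv lower s *\<^sub>R w - t = sqrt (1 + (deriv lower s)\<^sup>2) *\<^sub>R \<nu>"
proof -
  interpret n: convex_slices S z w "- t" by (rule reflect)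
  show ?thesis
    using n.upper_normal_eq[of s \<nu>] assms lower_deriv(3)[OF assms(1)] by (simp add: reflect_eqs)
qed

lemma deriv_lower_mono:
  assumes "s \<in> shadow" "s' \<in> shadow" "s \<le> s'"
  shows "deriv lower s \<le> deriv lower s'"
proof -
  interpret n: convex_slices S z w "- t" by (rule reflect)
  show ?thesis
    using n.deriv_upper_antimono[of s s'] assms lower_deriv(3) by (simp add: reflect_eqs)
qed

end

section \<open>Approximation from the interior\<close>

text \<open>The derivative of \<open>grad u \<bullet> e\<close> in direction \<open>v\<close>,
  spelled out in the coordinate partials from which \<open>laplacian\<close> is built.\<close>

definition hess :: "(real^2 \<Rightarrow> real) \<Rightarrow> real^2 \<Rightarrow> real^2 \<Rightarrow> real^2 \<Rightarrow> real" where
  "hess u x e v = (\<Sum>i\<in>UNIV. \<Sum>j\<in>UNIV.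
     frechet_derivative (\<lambda>y. grad u y $ i) (at x) (axis j 1) * e $ i * v $ j)"

lemma linear_axis_expansion:
  fixes f :: "real^2 \<Rightarrow> real"
  assumes "linear f"
  shows "f v = (\<Sum>j\<in>UNIV. f (axis j 1) * v $ j)"
proof -
  have "f v = f (\<Sum>j\<in>UNIV. v $ j *\<^sub>R axis j 1)"
    using basis_expansion[of v] by (simp add: scalar_mult_eq_scaleR)
  also have "\<dots> = (\<Sum>j\<in>UNIV. f (axis j 1) * v $ j)"
    by (simp add: linear_sum[OF assms] linear_cmul[OF assms] mult.commute)
  finally show ?thesis .
qed

lemma C2_on_has_derivative:
  assumes "C2_on S u" "x \<in> S"
  shows "(u has_derivative (\<lambda>v. grad u x \<bullet> v)) (at x)"
proof -
  have D: "(u has_derivative frechet_derivative u (at x)) (at x)"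
    using assms by (auto simp: C2_on_def simp flip: frechet_derivative_works)
  have "frechet_derivative u (at x) = (\<lambda>v. grad u x \<bullet> v)"
    by (rule ext, rule linear_axis_expansion[OF has_derivative_linear[OF D], THEN trans])
       (simp add: grad_def inner_vec_def)
  then show ?thesis using D by simp
qed

lemma C2_on_grad_has_derivative:
  assumes "C2_on S u" "x \<in> S"
  shows "((\<lambda>y. grad u y \<bullet> e) has_derivative hess u x e) (at x)"
proof -
  have D: "((\<lambda>y. grad u y $ i) has_derivative frechet_derivative (\<lambda>y. grad u y $ i) (at x)) (at x)" for i
    using assms by (auto simp: C2_on_def simp flip: frechet_derivative_works)
  have "((\<lambda>y. \<Sum>i\<in>UNIV. grad u y $ i * e $ i) has_derivative
      (\<lambda>v. \<Sum>i\<in>UNIV. frechet_derivative (\<lambda>y. grad u y $ i) (at x) v * e $ i)) (at x)"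
    by (intro has_derivative_sum has_derivative_mult_left D)
  moreover have "(\<lambda>v. \<Sum>i\<in>UNIV. frechet_derivative (\<lambda>y. grad u y $ i) (at x) v * e $ i) = hess u x e"
  proof
    fix v
    have "frechet_derivative (\<lambda>y. grad u y $ i) (at x) v * e $ i =
        (\<Sum>j\<in>UNIV. frechet_derivative (\<lambda>y. grad u y $ i) (at x) (axis j 1) * e $ i * v $ j)" for i
    proof -
      have "frechet_derivative (\<lambda>y. grad u y $ i) (at x) v =
          (\<Sum>j\<in>UNIV. frechet_derivative (\<lambda>y. grad u y $ i) (at x) (axis j 1) * v $ j)"
        by (rule linear_axis_expansion[OF has_derivative_linear[OF D]])
      then show ?thesis by (simp only: sum_distrib_left mult_ac)
    qed
    then show "(\<Sum>i\<in>UNIV. frechet_derivative (\<lambda>y. grad u y $ i) (at x) v * e $ i) = hess u x e v"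
      by (simp only: hess_def)
  qed
  ultimately show ?thesis by (simp add: inner_vec_def)
qed

lemma C2_on_continuous:
  assumes "C2_on S u"
  shows "continuous_on S u" "continuous_on S (\<lambda>x. grad u x \<bullet> e)" "continuous_on S (\<lambda>x. hess u x e v)"
proof -
  show "continuous_on S u"
    by (intro continuous_at_imp_continuous_on ballI has_derivative_continuous[OF C2_on_has_derivative[OF assms]])
  show "continuous_on S (\<lambda>x. grad u x \<bullet> e)"
    by (intro continuous_at_imp_continuous_on ballI has_derivative_continuous[OF C2_on_grad_has_derivative[OF assms]])
  show "continuous_on S (\<lambda>x. hess u x e v)"
    using assms unfolding hess_def C2_on_def by (intro continuous_intros) auto
qed

text \<open>Contracting the second derivatives with the identity, written as the sum of the
  projections on \<open>w\<close> and \<open>t\<close>, leaves the trace. This carries the equation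
  over to the frame of the slices.\<close>

lemma hess_trace_orthonormal:
  assumes "norm w = 1" "norm t = 1" "w \<bullet> t = 0"
  shows "hess u x w w + hess u x t t = laplacian u x"
proof -
  have "hess u x w w + hess u x t t = (\<Sum>i\<in>UNIV. \<Sum>j\<in>UNIV.
      frechet_derivative (\<lambda>y. grad u y $ i) (at x) (axis j 1) * (w $ i * w $ j + t $ i * t $ j))"
    unfolding hess_def sum.distrib[symmetric] by (simp add: algebra_simps)
  also have "\<dots> = (\<Sum>i\<in>UNIV. \<Sum>j\<in>UNIV.
      if i = j then frechet_derivative (\<lambda>y. grad u y $ i) (at x) (axis j 1) else 0)"
    unfolding orthonormal_components[OF assms] by (intro sum.cong) auto
  also have "\<dots> = laplacian u x"
    unfolding laplacian_def by simp
  finally show ?thesis .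
qed

lemma has_real_derivative_uniform_limit:
  fixes f :: "nat \<Rightarrow> real \<Rightarrow> real"
  assumes der: "\<And>n s. s \<in> {a..b} \<Longrightarrow> (f n has_real_derivative f' n s) (at s)"
    and ul: "uniform_limit {a..b} f' g' sequentially"
    and lim: "\<And>s. s \<in> {a..b} \<Longrightarrow> (\<lambda>n. f n s) \<longlonglongrightarrow> g s"
    and s: "a < s" "s < b"
  shows "(g has_real_derivative g' s) (at s)"
proof -
  have "\<exists>h. \<forall>x\<in>{a..b}. (\<lambda>n. f n x) \<longlonglongrightarrow> h x \<and> (h has_derivative (*) (g' x)) (at x within {a..b})"
  proof (rule has_derivative_sequence)
    show "(f n has_derivative (*) (f' n x)) (at x within {a..b})" if "x \<in> {a..b}" for n x
      using der[OF that] by (auto simp: has_field_derivative_def intro: has_derivative_at_withinI)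
    show "\<forall>\<^sub>F n in sequentially. \<forall>x\<in>{a..b}. \<forall>h. norm (f' n x * h - g' x * h) \<le> e * norm h" if "e > 0" for e
      using uniform_limitD[OF ul that]
    proof eventually_elim
      case (elim n)
      have "norm (f' n x * h - g' x * h) = \<bar>f' n x - g' x\<bar> * \<bar>h\<bar>" for x h
        by (simp add: left_diff_distrib flip: abs_mult)
      moreover have "\<bar>f' n x - g' x\<bar> * \<bar>h\<bar> \<le> e * \<bar>h\<bar>" if "x \<in> {a..b}" for x h
        using elim that by (intro mult_right_mono) (auto simp: dist_real_def less_imp_le)
      ultimately show ?case by simp
    qed
    show "(\<lambda>n. f n s) \<longlonglongrightarrow> g s" using lim s by auto
  qed (use s in auto)
  then obtain h where h: "\<And>x. x \<in> {a..b} \<Longrightarrow> (\<lambda>n. f n x) \<longlonglongrightarrow> h x"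
      "\<And>x. x \<in> {a..b} \<Longrightarrow> (h has_derivative (*) (g' x)) (at x within {a..b})"
    by blast
  have "g x = h x" if "x \<in> {a..b}" for x
    using LIMSEQ_unique h(1) lim that by blast
  then have "(g has_derivative (*) (g' s)) (at s within {a..b})"
    using s by (intro has_derivative_transform[OF _ _ h(2)]) auto
  moreover have "at s within {a..b} = at s"
    using s by (intro at_within_interior) auto
  ultimately show ?thesis by (simp add: has_field_derivative_def)
qed

section \<open>Dilations about the centre and passage to the closure\<close>

context convex_slices
begin

lemma shrink_in:
  assumes "s \<in> shadow" "lower s \<le> y" "y \<le> upper s" "0 < k" "k < 1"
  shows "pt (k * s) (k * y) \<in> S"
proof -
  have "pt s y - (1 - k) *\<^sub>R (pt s y - z) \<in> interior S"
    using assms z_in interior_open[OF open_S]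
    by (intro mem_interior_closure_convex_shrink convex_S pt_closure) auto
  moreover have "pt s y - (1 - k) *\<^sub>R (pt s y - z) = pt (k * s) (k * y)"
    by (simp add: pt_def algebra_simps)
  ultimately show ?thesis using interior_open[OF open_S] by simp
qed

lemma open_shrunk: "open {(s, y). pt (k * s) (k * y) \<in> S}"
proof -
  have "open ((\<lambda>x. pt (k * fst x) (k * snd x)) -` S)"
    by (intro open_vimage open_S continuous_intros)
  then show ?thesis by (simp add: vimage_def case_prod_unfold)
qed

lemma shrink_derivatives:
  assumes "C2_on S u" "pt (k * s) (k * y) \<in> S"
  shows "((\<lambda>s. u (pt (k * s) (k * y))) has_real_derivative k * (grad u (pt (k * s) (k * y)) \<bullet> w)) (at s)"
    and "((\<lambda>y. u (pt (k * s) (k * y))) has_real_derivative k * (grad u (pt (k * s) (k * y)) \<bullet> t)) (at y)"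
    and "((\<lambda>s. grad u (pt (k * s) (k * y)) \<bullet> e) has_real_derivative k * hess u (pt (k * s) (k * y)) e w) (at s)"
    and "((\<lambda>y. grad u (pt (k * s) (k * y)) \<bullet> e) has_real_derivative k * hess u (pt (k * s) (k * y)) e t) (at y)"
proof -
  have ps: "((\<lambda>s. pt (k * s) (k * y)) has_derivative (\<lambda>h. h *\<^sub>R (k *\<^sub>R w))) (at s)"
    unfolding pt_def by (auto intro!: derivative_eq_intros simp: algebra_simps)
  have py: "((\<lambda>y. pt (k * s) (k * y)) has_derivative (\<lambda>h. h *\<^sub>R (k *\<^sub>R t))) (at y)"
    unfolding pt_def by (auto intro!: derivative_eq_intros simp: algebra_simps)
  note u1 = C2_on_has_derivative[OF assms] and u2 = C2_on_grad_has_derivative[OF assms]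
  note hl = linear_cmul[OF has_derivative_linear[OF u2]]
  show "((\<lambda>s. u (pt (k * s) (k * y))) has_real_derivative k * (grad u (pt (k * s) (k * y)) \<bullet> w)) (at s)"
    using has_derivative_compose[OF ps u1]
    by (rule has_derivative_imp_has_field_derivative) simp
  show "((\<lambda>y. u (pt (k * s) (k * y))) has_real_derivative k * (grad u (pt (k * s) (k * y)) \<bullet> t)) (at y)"
    using has_derivative_compose[OF py u1]
    by (rule has_derivative_imp_has_field_derivative) simp
  show "((\<lambda>s. grad u (pt (k * s) (k * y)) \<bullet> e) has_real_derivative k * hess u (pt (k * s) (k * y)) e w) (at s)"
    using has_derivative_compose[OF ps u2]
    by (rule has_derivative_imp_has_field_derivative) (simp add: hl)
  show "((\<lambda>y. grad u (pt (k * s) (k * y)) \<bullet> e) has_real_derivative k * hess u (pt (k * s) (k * y)) e t) (at y)"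
    using has_derivative_compose[OF py u2]
    by (rule has_derivative_imp_has_field_derivative) (simp add: hl)
qed

lemma shrink_leibniz:
  fixes f fs :: "real \<Rightarrow> real \<Rightarrow> real"
  assumes s: "s \<in> shadow" and k: "0 < k" "k < 1"
    and der: "\<And>s y. pt (k * s) (k * y) \<in> S \<Longrightarrow> ((\<lambda>s. f s y) has_real_derivative fs s y) (at s)"
    and cf: "continuous_on {(s, y). pt (k * s) (k * y) \<in> S} (\<lambda>(s, y). f s y)"
    and cfs: "continuous_on {(s, y). pt (k * s) (k * y) \<in> S} (\<lambda>(s, y). fs s y)"
  shows "((\<lambda>s. integral {lower s..upper s} (f s)) has_real_derivative
    integral {lower s..upper s} (fs s) + f s (upper s) * deriv upper s - f s (lower s) * deriv lower s) (at s)"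
proof (rule leibniz_rule_moving_limits[OF open_shrunk[of k]])
  show "{s} \<times> {lower s..upper s} \<subseteq> {(s, y). pt (k * s) (k * y) \<in> S}"
    using shrink_in[OF s _ _ k] by auto
  have "\<forall>\<^sub>F s in at s. s \<in> shadow"
    using s open_shadow by (simp add: eventually_at_topological) blast
  then show "\<forall>\<^sub>F s in at s. lower s \<le> upper s"
    by eventually_elim (use lower_less_upper in \<open>auto intro: less_imp_le\<close>)
qed (use assms lower_less_upper[OF s] upper_deriv lower_deriv in auto)

lemma shrink_continuous:
  fixes g :: "real^2 \<Rightarrow> real"
  assumes "continuous_on S g" "continuous_on UNIV \<phi>"
  shows "continuous_on {(s, y). pt (k * s) (k * y) \<in> S} (\<lambda>(s, y). g (pt (k * s) (k * y)) * \<phi> y)"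
  unfolding split_beta
  by (intro continuous_on_mult continuous_on_compose2[OF assms(1)] continuous_on_compose2[OF assms(2)] continuous_intros)
     auto

lemma slice_continuous:
  fixes g :: "real^2 \<Rightarrow> 'a::real_normed_algebra"
  assumes "continuous_on (closure S) g" "continuous_on UNIV \<phi>" "s \<in> shadow"
  shows "continuous_on {lower s..upper s} (\<lambda>y. g (pt s y) * \<phi> y)"
  using pt_closure[OF assms(3)]
  by (intro continuous_on_mult continuous_on_compose2[OF assms(1)] continuous_on_compose2[OF assms(2)] continuous_intros)
     auto

lemma slice_continuous_shrink:
  fixes g :: "real^2 \<Rightarrow> 'a::real_normed_algebra"
  assumes "continuous_on S g" "continuous_on UNIV \<phi>" "s \<in> shadow" "0 < k" "k < 1"
  shows "continuous_on {lower s..upper s} (\<lambda>y. g (pt (k * s) (k * y)) * \<phi> y)"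
  using shrink_in[OF assms(3) _ _ assms(4,5)]
  by (intro continuous_on_mult continuous_on_compose2[OF assms(1)] continuous_on_compose2[OF assms(2)] continuous_intros)
     auto

text \<open>Dilating \<open>S\<close> slightly about \<open>z\<close> lets all derivatives be taken in the interior; only first
  derivatives survive in the limit \<open>shrink n \<rightarrow> 1\<close>.\<close>
definition shrink :: "nat \<Rightarrow> real" where "shrink n = 1 - 1 / real (n + 2)"

lemma shrink_bounds: "0 < shrink n" "shrink n < 1"
  by (auto simp: shrink_def field_simps)

lemma shrink_lim: "shrink \<longlonglongrightarrow> 1"
proof -
  have "(\<lambda>n. 1 - 1 / real (n + 2)) \<longlonglongrightarrow> 1 - 0"
    by (intro tendsto_intros LIMSEQ_ignore_initial_segment[OF lim_1_over_n])
  then show ?thesis by (simp add: shrink_def[abs_def])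
qed

lemma shrink_uniform:
  fixes g :: "real^2 \<Rightarrow> real"
  assumes "continuous_on (closure S) g"
  shows "uniform_limit {(s, y). s \<in> shadow \<and> lower s \<le> y \<and> y \<le> upper s}
    (\<lambda>n (s, y). g (pt (shrink n * s) (shrink n * y))) (\<lambda>(s, y). g (pt s y)) sequentially"
proof (rule uniform_limitI)
  fix e :: real assume "0 < e"
  have "uniformly_continuous_on (closure S) g"
    using assms bounded_S by (intro compact_uniformly_continuous) (auto simp: compact_closure)
  then obtain d where "0 < d" and d: "\<And>x x'. x \<in> closure S \<Longrightarrow> x' \<in> closure S \<Longrightarrow> dist x' x < d \<Longrightarrow> dist (g x') (g x) < e"
    using \<open>0 < e\<close> unfolding uniformly_continuous_on_def by blast
  obtain B where B: "\<And>s y. pt s y \<in> closure S \<Longrightarrow> \<bar>s\<bar> \<le> B \<and> \<bar>y\<bar> \<le> B"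
    using bounded_slice by blast
  have "0 \<le> B" using B[of 0 0] z_in closure_subset by (force simp: pt_def)
  have "\<forall>\<^sub>F n in sequentially. dist (shrink n) 1 < d / (2 * B + 1)"
    using shrink_lim \<open>0 < d\<close> \<open>0 \<le> B\<close> by (intro tendstoD) auto
  then show "\<forall>\<^sub>F n in sequentially. \<forall>x\<in>{(s, y). s \<in> shadow \<and> lower s \<le> y \<and> y \<le> upper s}.
      dist (case x of (s, y) \<Rightarrow> g (pt (shrink n * s) (shrink n * y))) (case x of (s, y) \<Rightarrow> g (pt s y)) < e"
  proof eventually_elim
    case (elim n)
    show ?case
    proof safe
      fix s y assume sy: "s \<in> shadow" "lower s \<le> y" "y \<le> upper s"
      have "dist (pt (shrink n * s) (shrink n * y)) (pt s y) = norm ((shrink n - 1) *\<^sub>R (s *\<^sub>R w + y *\<^sub>R t))"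
        unfolding dist_norm pt_diff by (simp add: algebra_simps)
      also have "\<dots> \<le> \<bar>shrink n - 1\<bar> * (\<bar>s\<bar> + \<bar>y\<bar>)"
        using norm_triangle_ineq[of "s *\<^sub>R w" "y *\<^sub>R t"] by (auto simp: norm_w norm_t intro: mult_left_mono)
      also have "\<dots> \<le> \<bar>shrink n - 1\<bar> * (2 * B + 1)"
        using B[OF pt_closure[OF sy]] by (intro mult_left_mono) auto
      also have "\<dots> < d"
        using elim \<open>0 \<le> B\<close> by (simp add: dist_real_def field_simps)
      finally show "dist (g (pt (shrink n * s) (shrink n * y))) (g (pt s y)) < e"
        using d[of "pt s y" "pt (shrink n * s) (shrink n * y)"] pt_closure[OF sy]
          shrink_in[OF sy shrink_bounds[of n]] closure_subset by blast
    qed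
  qed
qed

lemma shrink_uniform_integral:
  fixes g :: "real^2 \<Rightarrow> real"
  assumes g: "continuous_on (closure S) g" and \<phi>: "continuous_on UNIV \<phi>"
  shows "uniform_limit shadow
    (\<lambda>n s. integral {lower s..upper s} (\<lambda>y. g (pt (shrink n * s) (shrink n * y)) * \<phi> y))
    (\<lambda>s. integral {lower s..upper s} (\<lambda>y. g (pt s y) * \<phi> y)) sequentially"
proof (rule uniform_limitI)
  fix e :: real assume "0 < e"
  obtain B where B: "\<And>s y. pt s y \<in> closure S \<Longrightarrow> \<bar>s\<bar> \<le> B \<and> \<bar>y\<bar> \<le> B"
    using bounded_slice by blast
  have "0 \<le> B" using B[of 0 0] z_in closure_subset by (force simp: pt_def)
  have "bounded (\<phi> ` {-B..B})"
    by (intro compact_imp_bounded compact_continuous_image continuous_on_subset[OF \<phi>]) auto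
  then obtain K where "0 < K" and K: "\<And>y. y \<in> {-B..B} \<Longrightarrow> \<bar>\<phi> y\<bar> \<le> K"
    unfolding bounded_pos by auto
  define \<delta> where "\<delta> = e / (K * (2 * B + 1))"
  have "0 < \<delta>" using \<open>0 < e\<close> \<open>0 < K\<close> \<open>0 \<le> B\<close> by (simp add: \<delta>_def)
  have gS: "continuous_on S g" using g closure_subset continuous_on_subset by blast
  show "\<forall>\<^sub>F n in sequentially. \<forall>s\<in>shadow.
     dist (integral {lower s..upper s} (\<lambda>y. g (pt (shrink n * s) (shrink n * y)) * \<phi> y))
       (integral {lower s..upper s} (\<lambda>y. g (pt s y) * \<phi> y)) < e"
    using uniform_limitD[OF shrink_uniform[OF g] \<open>0 < \<delta>\<close>]
  proof eventually_elim
    case (elim n)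
    show ?case
    proof
      fix s assume s: "s \<in> shadow"
      have le: "lower s \<le> upper s" using lower_less_upper[OF s] by simp
      have B': "\<bar>y\<bar> \<le> B" if "lower s \<le> y" "y \<le> upper s" for y
        using B[OF pt_closure[OF s that]] by simp
      let ?f = "\<lambda>y. g (pt (shrink n * s) (shrink n * y)) * \<phi> y" and ?g = "\<lambda>y. g (pt s y) * \<phi> y"
      have c: "continuous_on {lower s..upper s} ?f" "continuous_on {lower s..upper s} ?g"
        using slice_continuous_shrink[OF gS \<phi> s shrink_bounds[of n]] slice_continuous[OF g \<phi> s] by auto
      have "dist (integral {lower s..upper s} ?f) (integral {lower s..upper s} ?g)
          = norm (integral {lower s..upper s} (\<lambda>y. ?f y - ?g y))"
        using c by (simp add: dist_norm Henstock_Kurzweil_Integration.integral_diff integrable_continuous_real)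
      also have "\<dots> \<le> \<delta> * K * (upper s - lower s)"
      proof (rule integral_bound[OF le])
        show "continuous_on {lower s..upper s} (\<lambda>y. ?f y - ?g y)"
          by (rule continuous_on_diff[OF c])
        fix y assume y: "y \<in> {lower s..upper s}"
        have "norm (?f y - ?g y) = \<bar>g (pt (shrink n * s) (shrink n * y)) - g (pt s y)\<bar> * \<bar>\<phi> y\<bar>"
          by (simp add: left_diff_distrib flip: abs_mult)
        also have "\<dots> \<le> \<delta> * K"
        proof (rule mult_mono)
          show "\<bar>g (pt (shrink n * s) (shrink n * y)) - g (pt s y)\<bar> \<le> \<delta>"
            using elim s y by (fastforce simp: dist_real_def)
          show "\<bar>\<phi> y\<bar> \<le> K"
            using K[of y] B'[of y] y by (simp add: abs_le_iff)
        qed (use \<open>0 < \<delta>\<close> in auto)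
        finally show "norm (?f y - ?g y) \<le> \<delta> * K" .
      qed
      also have "\<dots> \<le> \<delta> * K * (2 * B)"
        using B'[of "upper s"] B'[of "lower s"] le \<open>0 < \<delta>\<close> \<open>0 < K\<close>
        by (intro mult_left_mono) auto
      also have "\<dots> < \<delta> * K * (2 * B + 1)"
        using \<open>0 < \<delta>\<close> \<open>0 < K\<close> by simp
      also have "\<dots> = e"
        using \<open>0 < K\<close> \<open>0 \<le> B\<close> by (simp add: \<delta>_def)
      finally show "dist (integral {lower s..upper s} ?f) (integral {lower s..upper s} ?g) < e" .
    qed
  qed
qed

end

section \<open>The equation integrated over slices\<close>

text \<open>Boundedness of the limit is bundled in because products of uniform limits need it; the
  notion is then closed under sums, differences and products, and long boundary expressions pass to
  the limit by rule application.\<close>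

definition bdd_uniform_limit :: "real set \<Rightarrow> (nat \<Rightarrow> real \<Rightarrow> real) \<Rightarrow> (real \<Rightarrow> real) \<Rightarrow> bool" where
  "bdd_uniform_limit X f l \<longleftrightarrow> uniform_limit X f l sequentially \<and> bounded (l ` X)"

lemma bdd_uniform_limit_add:
  "bdd_uniform_limit X f l \<Longrightarrow> bdd_uniform_limit X g m \<Longrightarrow> bdd_uniform_limit X (\<lambda>n s. f n s + g n s) (\<lambda>s. l s + m s)"
  unfolding bdd_uniform_limit_def by (auto intro!: uniform_limit_add bounded_plus_comp)

lemma bdd_uniform_limit_diff:
  "bdd_uniform_limit X f l \<Longrightarrow> bdd_uniform_limit X g m \<Longrightarrow> bdd_uniform_limit X (\<lambda>n s. f n s - g n s) (\<lambda>s. l s - m s)"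
  unfolding bdd_uniform_limit_def by (auto intro!: uniform_limit_minus bounded_minus_comp)

lemma bdd_uniform_limit_mult:
  assumes "bdd_uniform_limit X f l" "bdd_uniform_limit X g m"
  shows "bdd_uniform_limit X (\<lambda>n s. f n s * g n s) (\<lambda>s. l s * m s)"
proof -
  obtain B C where B: "\<forall>s\<in>X. \<bar>l s\<bar> \<le> B" and C: "\<forall>s\<in>X. \<bar>m s\<bar> \<le> C"
    using assms unfolding bdd_uniform_limit_def bounded_iff by auto
  have "\<bar>l s * m s\<bar> \<le> B * C" if "s \<in> X" for s
  proof -
    have "\<bar>l s\<bar> \<le> B" "\<bar>m s\<bar> \<le> C" using B C that by auto
    then show ?thesis unfolding abs_mult by (intro mult_mono) auto
  qed
  then have "bounded ((\<lambda>s. l s * m s) ` X)"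
    unfolding bounded_iff by auto
  then show ?thesis using assms unfolding bdd_uniform_limit_def by (auto intro: uniform_lim_mult)
qed

lemma bdd_uniform_limit_fixed: "bounded (l ` X) \<Longrightarrow> bdd_uniform_limit X (\<lambda>n. l) l"
  unfolding bdd_uniform_limit_def by (auto intro: uniform_limit_const)

lemma bdd_uniform_limit_seq: "k \<longlonglongrightarrow> k0 \<Longrightarrow> bdd_uniform_limit X (\<lambda>n s. k n) (\<lambda>s. k0)"
  unfolding bdd_uniform_limit_def bounded_iff
  by (auto simp: uniform_limit_iff tendsto_iff elim!: eventually_mono)

lemmas bdd_uniform_limit_intros =
  bdd_uniform_limit_add bdd_uniform_limit_diff bdd_uniform_limit_mult bdd_uniform_limit_seq

lemma bdd_uniform_limit_cong:
  assumes "bdd_uniform_limit X f l" "\<And>s. s \<in> X \<Longrightarrow> l s = m s"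
  shows "bdd_uniform_limit X f m"
proof -
  have "uniform_limit X f m sequentially \<longleftrightarrow> uniform_limit X f l sequentially"
    using assms(2) by (intro uniform_limit_cong') auto
  moreover have "m ` X = l ` X" using assms(2) by auto
  ultimately show ?thesis using assms(1) unfolding bdd_uniform_limit_def by simp
qed

lemma bdd_uniform_limit_derivative:
  assumes "\<And>n s. s \<in> {a..b} \<Longrightarrow> (f n has_real_derivative f' n s) (at s)"
    and "bdd_uniform_limit {a..b} f' g'" "bdd_uniform_limit {a..b} f g" "a < s" "s < b"
  shows "(g has_real_derivative g' s) (at s)"
  using assms unfolding bdd_uniform_limit_def
  by (intro has_real_derivative_uniform_limit[of a b f f' g' g s] tendsto_uniform_limitI[where x = s for s]) auto

context convex_slices
begin

lemma lower_le_upper: "s \<in> shadow \<Longrightarrow> lower s \<le> upper s"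
  using lower_less_upper by (simp add: less_imp_le)

definition mass :: "(real^2 \<Rightarrow> real) \<Rightarrow> (real \<Rightarrow> real) \<Rightarrow> real \<Rightarrow> real" where
  "mass g \<phi> s = integral {lower s..upper s} (\<lambda>y. g (pt s y) * \<phi> y)"

text \<open>Arc length of both boundary arcs per unit of \<open>s\<close>, weighted by
  \<open>\<phi>\<close> at the coordinate along the slice; for the weight 1 it is the density m of
  the overview.\<close>

definition arc :: "(real \<Rightarrow> real) \<Rightarrow> real \<Rightarrow> real" where
  "arc \<phi> s = sqrt (1 + (deriv upper s)\<^sup>2) * \<phi> (upper s) + sqrt (1 + (deriv lower s)\<^sup>2) * \<phi> (lower s)"

lemma shadow_neighbourhood:
  assumes "s \<in> shadow"
  obtains a b where "a < s" "s < b" "{a..b} \<subseteq> shadow"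
proof -
  obtain e where "0 < e" "cball s e \<subseteq> shadow"
    using open_shadow assms open_contains_cball by blast
  then show ?thesis
    by (intro that[of "s - e" "s + e"]) (auto simp: cball_eq_atLeastAtMost)
qed

lemma shrink_boundary_limit:
  fixes g :: "real^2 \<Rightarrow> real"
  assumes "continuous_on (closure S) g" "\<And>s. s \<in> {a..b} \<Longrightarrow> lower s \<le> y s \<and> y s \<le> upper s"
    and sub: "{a..b} \<subseteq> shadow"
  shows "bdd_uniform_limit {a..b} (\<lambda>n s. g (pt (shrink n * s) (shrink n * y s))) (\<lambda>s. g (pt s (y s)))"
  unfolding bdd_uniform_limit_def
proof
  show "uniform_limit {a..b} (\<lambda>n s. g (pt (shrink n * s) (shrink n * y s))) (\<lambda>s. g (pt s (y s))) sequentially"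
  proof -
    have "(\<lambda>s. (s, y s)) \<in> {a..b} \<rightarrow> {(s, y). s \<in> shadow \<and> lower s \<le> y \<and> y \<le> upper s}"
      using assms(2) sub by auto
    from uniform_limit_compose'[OF shrink_uniform[OF assms(1)] this] show ?thesis by simp
  qed
  have "compact (g ` closure S)"
    using assms(1) bounded_S by (intro compact_continuous_image) (auto simp: compact_closure)
  then show "bounded ((\<lambda>s. g (pt s (y s))) ` {a..b})"
    using pt_closure assms(2) sub by (elim compact_imp_bounded[THEN bounded_subset]) blast
qed

text \<open>The factor \<open>upper s - lower s\<close> is the point: it forces the slice integrals
  to vanish where the slices become short.\<close>

lemma mass_bound:
  fixes g :: "real^2 \<Rightarrow> real"
  assumes g: "continuous_on (closure S) g" and \<phi>: "continuous_on UNIV \<phi>"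
  shows "\<exists>K>0. \<forall>s\<in>shadow. \<bar>mass g \<phi> s\<bar> \<le> K * (upper s - lower s)"
proof -
  obtain B where B: "\<And>s y. pt s y \<in> closure S \<Longrightarrow> \<bar>s\<bar> \<le> B \<and> \<bar>y\<bar> \<le> B"
    using bounded_slice by blast
  have "compact (g ` closure S)" "compact (\<phi> ` {-B..B})"
    using g bounded_S continuous_on_subset[OF \<phi>] by (auto intro!: compact_continuous_image simp: compact_closure)
  then have "bounded (g ` closure S)" "bounded (\<phi> ` {-B..B})"
    by (auto intro: compact_imp_bounded)
  then obtain K L where K: "0 < K" "\<And>x. x \<in> closure S \<Longrightarrow> \<bar>g x\<bar> \<le> K"
    and L: "0 < L" "\<And>y. y \<in> {-B..B} \<Longrightarrow> \<bar>\<phi> y\<bar> \<le> L"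
    unfolding bounded_pos by auto
  have "norm (mass g \<phi> s) \<le> K * L * (upper s - lower s)" if s: "s \<in> shadow" for s
    unfolding mass_def
  proof (rule integral_bound[OF lower_le_upper[OF s] slice_continuous[OF g \<phi> s]])
    fix y assume y: "y \<in> {lower s..upper s}"
    then have cl: "pt s y \<in> closure S" using pt_closure[OF s] by simp
    show "norm (g (pt s y) * \<phi> y) \<le> K * L"
      unfolding real_norm_def abs_mult
    proof (rule mult_mono)
      show "\<bar>\<phi> y\<bar> \<le> L" using B[OF cl] by (intro L) (auto simp: abs_le_iff)
    qed (use K cl in auto)
  qed
  then show ?thesis
    using K(1) L(1) by (intro exI[of _ "K * L"]) simp
qed

lemma shrink_integral_limit:
  fixes g :: "real^2 \<Rightarrow> real"
  assumes g: "continuous_on (closure S) g" and \<phi>: "continuous_on UNIV \<phi>"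
    and sub: "{a..b} \<subseteq> shadow"
  shows "bdd_uniform_limit {a..b} (\<lambda>n s. integral {lower s..upper s} (\<lambda>y. g (pt (shrink n * s) (shrink n * y)) * \<phi> y)) (mass g \<phi>)"
  unfolding bdd_uniform_limit_def
proof
  show "uniform_limit {a..b} (\<lambda>n s. integral {lower s..upper s} (\<lambda>y. g (pt (shrink n * s) (shrink n * y)) * \<phi> y))
      (mass g \<phi>) sequentially"
    using uniform_limit_on_subset[OF shrink_uniform_integral[OF g \<phi>] sub] by (simp add: mass_def[abs_def])
  obtain K where "0 < K" and K: "\<And>s. s \<in> shadow \<Longrightarrow> \<bar>mass g \<phi> s\<bar> \<le> K * (upper s - lower s)"
    using mass_bound[OF g \<phi>] by blast
  obtain B where B: "\<And>s y. pt s y \<in> closure S \<Longrightarrow> \<bar>s\<bar> \<le> B \<and> \<bar>y\<bar> \<le> B"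
    using bounded_slice by blast
  have "\<bar>mass g \<phi> s\<bar> \<le> K * (2 * B)" if "s \<in> {a..b}" for s
  proof -
    have s: "s \<in> shadow" using that sub by auto
    have "upper s - lower s \<le> 2 * B"
      using B[OF pt_closure[OF s _ order_refl]] B[OF pt_closure[OF s order_refl]] lower_le_upper[OF s] by auto
    then show ?thesis
      using K[OF s] mult_left_mono[of "upper s - lower s" "2 * B" K] \<open>0 < K\<close> by linarith
  qed
  then show "bounded (mass g \<phi> ` {a..b})" unfolding bounded_iff real_norm_def by blast
qed

lemma bounded_multipliers:
  assumes "continuous_on UNIV \<phi>" and sub: "{a..b} \<subseteq> shadow"
  shows "bounded ((\<lambda>s. \<phi> (upper s)) ` {a..b})" "bounded ((\<lambda>s. \<phi> (lower s)) ` {a..b})"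
    "bounded (deriv upper ` {a..b})" "bounded (deriv lower ` {a..b})"
proof -
  have "continuous_on {a..b} upper" "continuous_on {a..b} lower"
    using upper_deriv lower_deriv(1) sub by (blast intro: continuous_at_imp_continuous_on DERIV_isCont)+
  then show "bounded ((\<lambda>s. \<phi> (upper s)) ` {a..b})" "bounded ((\<lambda>s. \<phi> (lower s)) ` {a..b})"
    by (auto intro!: compact_imp_bounded compact_continuous_image continuous_on_compose2[OF assms(1)])
  have "\<bar>deriv upper s\<bar> \<le> \<bar>deriv upper a\<bar> + \<bar>deriv upper b\<bar>" if "s \<in> {a..b}" for s
    using deriv_upper_antimono[of a s] deriv_upper_antimono[of s b] that sub by (auto simp: subset_iff)
  then show "bounded (deriv upper ` {a..b})"
    unfolding bounded_iff by (intro exI[of _ "\<bar>deriv upper a\<bar> + \<bar>deriv upper b\<bar>"]) auto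
  have "\<bar>deriv lower s\<bar> \<le> \<bar>deriv lower a\<bar> + \<bar>deriv lower b\<bar>" if "s \<in> {a..b}" for s
    using deriv_lower_mono[of a s] deriv_lower_mono[of s b] that sub by (auto simp: subset_iff)
  then show "bounded (deriv lower ` {a..b})"
    unfolding bounded_iff by (intro exI[of _ "\<bar>deriv lower a\<bar> + \<bar>deriv lower b\<bar>"]) auto
qed

context
  fixes u :: "real^2 \<Rightarrow> real" and G :: "real^2 \<Rightarrow> real^2" and \<alpha> c :: real
    and \<phi> \<phi>1 \<phi>2 :: "real \<Rightarrow> real"
  assumes C2: "C2_on S u" and cu: "continuous_on (closure S) u"
    and cG: "continuous_on (closure S) G" and G: "\<And>x. x \<in> S \<Longrightarrow> G x = grad u x"
    and Gn: "\<And>p \<nu>. p \<in> frontier S \<Longrightarrow> outer_normal S p \<nu> \<Longrightarrow> G p \<bullet> \<nu> = c"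
    and eq: "\<And>x. x \<in> S \<Longrightarrow> laplacian u x + \<alpha> * u x = 0"
    and bd: "\<And>p. p \<in> frontier S \<Longrightarrow> u p = 0"
    and \<phi>1: "\<And>y. (\<phi> has_real_derivative \<phi>1 y) (at y)"
    and \<phi>2: "\<And>y. (\<phi>1 has_real_derivative \<phi>2 y) (at y)"
    and cont2: "continuous_on UNIV \<phi>2"
begin

lemma cont_phi: "continuous_on UNIV \<phi>" "continuous_on UNIV \<phi>1"
  using \<phi>1 \<phi>2 by (auto intro!: continuous_at_imp_continuous_on DERIV_isCont)

text \<open>Leibniz' rule on the dilated slices; in the limit the terms from the moving end points
  disappear because \<open>u\<close> vanishes on the frontier.\<close>

lemma mass_has_derivative:
  assumes s: "s \<in> shadow"
  shows "(mass u \<phi> has_real_derivative mass (\<lambda>x. G x \<bullet> w) \<phi> s) (at s)"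
proof -
  obtain a b where ab: "a < s" "s < b" "{a..b} \<subseteq> shadow" using shadow_neighbourhood[OF s] .
  define F where "F = (\<lambda>n s. integral {lower s..upper s} (\<lambda>y. u (pt (shrink n * s) (shrink n * y)) * \<phi> y))"
  define F' where "F' = (\<lambda>n s. shrink n * integral {lower s..upper s} (\<lambda>y. G (pt (shrink n * s) (shrink n * y)) \<bullet> w * \<phi> y)
     + u (pt (shrink n * s) (shrink n * upper s)) * \<phi> (upper s) * deriv upper s
     - u (pt (shrink n * s) (shrink n * lower s)) * \<phi> (lower s) * deriv lower s)"
  have le: "lower s \<le> upper s" if "s \<in> {a..b}" for s
    using that ab(3) lower_le_upper by auto
  show ?thesis
  proof (rule bdd_uniform_limit_derivative[OF _ _ _ ab(1,2)])
    show "(F n has_real_derivative F' n x) (at x)" if "x \<in> {a..b}" for n x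
    proof -
      have x: "x \<in> shadow" using that ab by auto
      have "(F n has_real_derivative
          integral {lower x..upper x} (\<lambda>y. shrink n * (grad u (pt (shrink n * x) (shrink n * y)) \<bullet> w) * \<phi> y)
          + u (pt (shrink n * x) (shrink n * upper x)) * \<phi> (upper x) * deriv upper x
          - u (pt (shrink n * x) (shrink n * lower x)) * \<phi> (lower x) * deriv lower x) (at x)"
        unfolding F_def
      proof (rule shrink_leibniz[OF x shrink_bounds[of n]])
        show "((\<lambda>s. u (pt (shrink n * s) (shrink n * y)) * \<phi> y) has_real_derivative
            shrink n * (grad u (pt (shrink n * s) (shrink n * y)) \<bullet> w) * \<phi> y) (at s)"
          if "pt (shrink n * s) (shrink n * y) \<in> S" for s y
          by (intro DERIV_cmult_right shrink_derivatives C2 that)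
        show "continuous_on {(s, y). pt (shrink n * s) (shrink n * y) \<in> S}
            (\<lambda>(s, y). u (pt (shrink n * s) (shrink n * y)) * \<phi> y)"
          by (intro shrink_continuous C2_on_continuous[OF C2] cont_phi)
        show "continuous_on {(s, y). pt (shrink n * s) (shrink n * y) \<in> S}
            (\<lambda>(s, y). shrink n * (grad u (pt (shrink n * s) (shrink n * y)) \<bullet> w) * \<phi> y)"
          by (rule shrink_continuous) (intro continuous_intros C2_on_continuous[OF C2] cont_phi)+
      qed
      moreover have "integral {lower x..upper x} (\<lambda>y. shrink n * (grad u (pt (shrink n * x) (shrink n * y)) \<bullet> w) * \<phi> y)
          = shrink n * integral {lower x..upper x} (\<lambda>y. G (pt (shrink n * x) (shrink n * y)) \<bullet> w * \<phi> y)"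
      proof -
        have "integral {lower x..upper x} (\<lambda>y. shrink n * (grad u (pt (shrink n * x) (shrink n * y)) \<bullet> w) * \<phi> y)
            = integral {lower x..upper x} (\<lambda>y. shrink n * (G (pt (shrink n * x) (shrink n * y)) \<bullet> w * \<phi> y))"
          using shrink_in[OF x _ _ shrink_bounds[of n]] G
          by (intro Henstock_Kurzweil_Integration.integral_cong) (simp add: mult.assoc)
        then show ?thesis by simp
      qed
      ultimately show ?thesis by (simp add: F'_def)
    qed
    have "bdd_uniform_limit {a..b} F' (\<lambda>s. 1 * mass (\<lambda>x. G x \<bullet> w) \<phi> s + u (pt s (upper s)) * \<phi> (upper s) * deriv upper s
        - u (pt s (lower s)) * \<phi> (lower s) * deriv lower s)"
      unfolding F'_def
      by (intro bdd_uniform_limit_intros shrink_lim shrink_integral_limit shrink_boundary_limit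
          bdd_uniform_limit_fixed bounded_multipliers cont_phi continuous_intros cu cG ab(3))
        (use le in auto)
    moreover have "1 * mass (\<lambda>x. G x \<bullet> w) \<phi> s + u (pt s (upper s)) * \<phi> (upper s) * deriv upper s
        - u (pt s (lower s)) * \<phi> (lower s) * deriv lower s = mass (\<lambda>x. G x \<bullet> w) \<phi> s" if "s \<in> {a..b}" for s
      using that ab(3) by (simp add: bd upper_frontier lower_frontier subset_iff)
    ultimately show "bdd_uniform_limit {a..b} F' (mass (\<lambda>x. G x \<bullet> w) \<phi>)"
      by (rule bdd_uniform_limit_cong)
    show "bdd_uniform_limit {a..b} F (mass u \<phi>)"
      unfolding F_def by (rule shrink_integral_limit[OF cu cont_phi(1) ab(3)])
  qed
qed

text \<open>The second derivative across the slices is traded for the one along them by the equation, and the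
  latter integrates to boundary terms.\<close>
lemma slice_integral_hess:
  assumes s: "s \<in> shadow" and k: "0 < k" "k < 1"
  shows "integral {lower s..upper s} (\<lambda>y. k * (k * hess u (pt (k * s) (k * y)) w w) * \<phi> y)
    = - (k * k * \<alpha>) * integral {lower s..upper s} (\<lambda>y. u (pt (k * s) (k * y)) * \<phi> y)
      - integral {lower s..upper s} (\<lambda>y. u (pt (k * s) (k * y)) * \<phi>2 y)
      - (k * (G (pt (k * s) (k * upper s)) \<bullet> t) * \<phi> (upper s) - u (pt (k * s) (k * upper s)) * \<phi>1 (upper s))
      + (k * (G (pt (k * s) (k * lower s)) \<bullet> t) * \<phi> (lower s) - u (pt (k * s) (k * lower s)) * \<phi>1 (lower s))"
    (is "?I = _")
proof -
  note mem = shrink_in[OF s _ _ k]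
  \<comment> \<open>The boundary form of integrating by parts twice: its derivative contains
    \<open>hess\<close> along \<open>t\<close> times \<open>\<phi>\<close> and \<open>u\<close>
    times \<open>\<phi>2\<close>, while the terms with \<open>\<phi>1\<close> cancel.\<close>
  define P where "P = (\<lambda>y. k * (grad u (pt (k * s) (k * y)) \<bullet> t) * \<phi> y - u (pt (k * s) (k * y)) * \<phi>1 y)"
  define P' where "P' = (\<lambda>y. k * (k * hess u (pt (k * s) (k * y)) t t) * \<phi> y - u (pt (k * s) (k * y)) * \<phi>2 y)"
  have "(P has_real_derivative P' y) (at y)" if "lower s \<le> y" "y \<le> upper s" for y
    unfolding P_def P'_def
    by (rule DERIV_cong[OF DERIV_diff[OF
          DERIV_mult[OF DERIV_cmult[OF shrink_derivatives(4)[OF C2 mem[OF that]]] \<phi>1]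
          DERIV_mult[OF shrink_derivatives(2)[OF C2 mem[OF that]] \<phi>2]]])
       (simp add: algebra_simps)
  then have P: "(P' has_integral P (upper s) - P (lower s)) {lower s..upper s}"
    using lower_le_upper[OF s]
    by (intro fundamental_theorem_of_calculus)
       (auto simp flip: has_real_derivative_iff_has_vector_derivative intro: has_field_derivative_at_within)
  have int: "(\<lambda>y. u (pt (k * s) (k * y)) * \<psi> y) integrable_on {lower s..upper s}" if "continuous_on UNIV \<psi>" for \<psi>
    by (intro integrable_continuous_real slice_continuous_shrink C2_on_continuous[OF C2] that s k)
  have "((\<lambda>y. - (k * k * \<alpha>) * (u (pt (k * s) (k * y)) * \<phi> y) - P' y - u (pt (k * s) (k * y)) * \<phi>2 y) has_integral
     - (k * k * \<alpha>) * integral {lower s..upper s} (\<lambda>y. u (pt (k * s) (k * y)) * \<phi> y) - (P (upper s) - P (lower s))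
     - integral {lower s..upper s} (\<lambda>y. u (pt (k * s) (k * y)) * \<phi>2 y)) {lower s..upper s}"
    by (intro has_integral_diff has_integral_mult_right P integrable_integral int cont2 cont_phi)
  moreover have "- (k * k * \<alpha>) * (u (pt (k * s) (k * y)) * \<phi> y) - P' y - u (pt (k * s) (k * y)) * \<phi>2 y
      = k * (k * hess u (pt (k * s) (k * y)) w w) * \<phi> y" if "y \<in> {lower s..upper s}" for y
  proof -
    have m: "pt (k * s) (k * y) \<in> S" using mem that by auto
    have h: "hess u (pt (k * s) (k * y)) w w = - (\<alpha> * u (pt (k * s) (k * y))) - hess u (pt (k * s) (k * y)) t t"
      using hess_trace_orthonormal[OF norm_w norm_t orth, of u "pt (k * s) (k * y)"] eq[OF m] by linarith
    show ?thesis unfolding P'_def h by (simp add: algebra_simps)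
  qed
  ultimately have "((\<lambda>y. k * (k * hess u (pt (k * s) (k * y)) w w) * \<phi> y) has_integral
     - (k * k * \<alpha>) * integral {lower s..upper s} (\<lambda>y. u (pt (k * s) (k * y)) * \<phi> y) - (P (upper s) - P (lower s))
     - integral {lower s..upper s} (\<lambda>y. u (pt (k * s) (k * y)) * \<phi>2 y)) {lower s..upper s}"
    by (rule has_integral_eq[rotated])
  from integral_unique[OF this] show ?thesis
    using G[OF mem] lower_le_upper[OF s] by (simp add: P_def)
qed

text \<open>The boundary terms of the integration along the slice and those of the moving limits
  combine into the component of \<open>G\<close> along \<open>t - deriv upper s *\<^sub>R w\<close>,
  and likewise below; by \<open>upper_normal_eq\<close> this is \<open>c\<close> times the arc
  length factor. Together with \<open>mass_has_derivative\<close> it is a forced oscillator equation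
  for \<open>mass u \<phi>\<close>.\<close>

lemma flux_has_derivative:
  assumes s: "s \<in> shadow"
  shows "(mass (\<lambda>x. G x \<bullet> w) \<phi> has_real_derivative - \<alpha> * mass u \<phi> s - mass u \<phi>2 s - c * arc \<phi> s) (at s)"
proof -
  obtain a b where ab: "a < s" "s < b" "{a..b} \<subseteq> shadow" using shadow_neighbourhood[OF s] .
  define F where "F = (\<lambda>n s. shrink n * integral {lower s..upper s} (\<lambda>y. G (pt (shrink n * s) (shrink n * y)) \<bullet> w * \<phi> y))"
  define F' where "F' = (\<lambda>n s. 
      (0 - shrink n * shrink n * \<alpha>) * integral {lower s..upper s} (\<lambda>y. u (pt (shrink n * s) (shrink n * y)) * \<phi> y)
      - integral {lower s..upper s} (\<lambda>y. u (pt (shrink n * s) (shrink n * y)) * \<phi>2 y)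
      - (shrink n * (G (pt (shrink n * s) (shrink n * upper s)) \<bullet> t) * \<phi> (upper s)
          - u (pt (shrink n * s) (shrink n * upper s)) * \<phi>1 (upper s))
      + (shrink n * (G (pt (shrink n * s) (shrink n * lower s)) \<bullet> t) * \<phi> (lower s)
          - u (pt (shrink n * s) (shrink n * lower s)) * \<phi>1 (lower s))
      + shrink n * (G (pt (shrink n * s) (shrink n * upper s)) \<bullet> w) * \<phi> (upper s) * deriv upper s
      - shrink n * (G (pt (shrink n * s) (shrink n * lower s)) \<bullet> w) * \<phi> (lower s) * deriv lower s)"
  have le: "lower s \<le> upper s" if "s \<in> {a..b}" for s
    using that ab(3) lower_le_upper by auto
  show ?thesis
  proof (rule bdd_uniform_limit_derivative[OF _ _ _ ab(1,2)])
    show "(F n has_real_derivative F' n x) (at x)" if "x \<in> {a..b}" for n x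
    proof -
      have x: "x \<in> shadow" using that ab by auto
      define f where "f = (\<lambda>s y. shrink n * (grad u (pt (shrink n * s) (shrink n * y)) \<bullet> w) * \<phi> y)"
      have d: "((\<lambda>s. integral {lower s..upper s} (f s)) has_real_derivative
          integral {lower x..upper x} (\<lambda>y. shrink n * (shrink n * hess u (pt (shrink n * x) (shrink n * y)) w w) * \<phi> y)
          + f x (upper x) * deriv upper x - f x (lower x) * deriv lower x) (at x)"
      proof (rule shrink_leibniz[OF x shrink_bounds[of n]])
        show "((\<lambda>s. f s y) has_real_derivative
            shrink n * (shrink n * hess u (pt (shrink n * s) (shrink n * y)) w w) * \<phi> y) (at s)"
          if "pt (shrink n * s) (shrink n * y) \<in> S" for s y
          unfolding f_def by (intro DERIV_cmult_right DERIV_cmult shrink_derivatives C2 that)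
        show "continuous_on {(s, y). pt (shrink n * s) (shrink n * y) \<in> S} (\<lambda>(s, y). f s y)"
          unfolding f_def by (rule shrink_continuous) (intro continuous_intros C2_on_continuous[OF C2] cont_phi)+
        show "continuous_on {(s, y). pt (shrink n * s) (shrink n * y) \<in> S}
            (\<lambda>(s, y). shrink n * (shrink n * hess u (pt (shrink n * s) (shrink n * y)) w w) * \<phi> y)"
          by (rule shrink_continuous) (intro continuous_intros C2_on_continuous[OF C2] cont_phi)+
      qed
      have fG: "f s y = shrink n * (G (pt (shrink n * s) (shrink n * y)) \<bullet> w * \<phi> y)"
        if "s \<in> shadow" "lower s \<le> y" "y \<le> upper s" for s y
        using G[OF shrink_in[OF that shrink_bounds[of n]]] by (simp add: f_def)
      have F_eq: "integral {lower s..upper s} (f s) = F n s" if "s \<in> shadow" for s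
      proof -
        have "integral {lower s..upper s} (f s)
            = integral {lower s..upper s} (\<lambda>y. shrink n * (G (pt (shrink n * s) (shrink n * y)) \<bullet> w * \<phi> y))"
          using fG[OF that] by (intro Henstock_Kurzweil_Integration.integral_cong) auto
        then show ?thesis by (simp add: F_def)
      qed
      have "\<forall>\<^sub>F s in nhds x. s \<in> shadow"
        using x open_shadow by (rule eventually_nhds_in_open[rotated])
      then have "\<forall>\<^sub>F s in nhds x. integral {lower s..upper s} (f s) = F n s"
        by eventually_elim (rule F_eq)
      from DERIV_cong_ev[OF refl this refl] d
      have "(F n has_real_derivative
          integral {lower x..upper x} (\<lambda>y. shrink n * (shrink n * hess u (pt (shrink n * x) (shrink n * y)) w w) * \<phi> y)
          + f x (upper x) * deriv upper x - f x (lower x) * deriv lower x) (at x)"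
        by blast
      then show ?thesis
        unfolding slice_integral_hess[OF x shrink_bounds[of n]]
        by (rule DERIV_cong) (simp add: F'_def fG x lower_le_upper)
    qed
    have "bdd_uniform_limit {a..b} F' (\<lambda>s. (0 - 1 * 1 * \<alpha>) * mass u \<phi> s - mass u \<phi>2 s
      - (1 * (G (pt s (upper s)) \<bullet> t) * \<phi> (upper s) - u (pt s (upper s)) * \<phi>1 (upper s))
      + (1 * (G (pt s (lower s)) \<bullet> t) * \<phi> (lower s) - u (pt s (lower s)) * \<phi>1 (lower s))
      + 1 * (G (pt s (upper s)) \<bullet> w) * \<phi> (upper s) * deriv upper s
      - 1 * (G (pt s (lower s)) \<bullet> w) * \<phi> (lower s) * deriv lower s)"
      unfolding F'_def
      by (intro bdd_uniform_limit_intros shrink_lim tendsto_const shrink_integral_limit shrink_boundary_limit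
          bdd_uniform_limit_fixed bounded_multipliers cont_phi cont2 continuous_intros cu cG ab(3))
        (use le in auto)
    moreover have "(0 - 1 * 1 * \<alpha>) * mass u \<phi> s - mass u \<phi>2 s
      - (1 * (G (pt s (upper s)) \<bullet> t) * \<phi> (upper s) - u (pt s (upper s)) * \<phi>1 (upper s))
      + (1 * (G (pt s (lower s)) \<bullet> t) * \<phi> (lower s) - u (pt s (lower s)) * \<phi>1 (lower s))
      + 1 * (G (pt s (upper s)) \<bullet> w) * \<phi> (upper s) * deriv upper s
      - 1 * (G (pt s (lower s)) \<bullet> w) * \<phi> (lower s) * deriv lower s
      = - \<alpha> * mass u \<phi> s - mass u \<phi>2 s - c * arc \<phi> s" if "s \<in> {a..b}" for s
    proof -
      have sh: "s \<in> shadow" using that ab(3) by auto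
      obtain \<nu> \<nu>' where \<nu>: "outer_normal S (pt s (upper s)) \<nu>" and \<nu>': "outer_normal S (pt s (lower s)) \<nu>'"
        using normals upper_frontier[OF sh] lower_frontier[OF sh] by meson
      have "G (pt s (upper s)) \<bullet> (t - deriv upper s *\<^sub>R w) = sqrt (1 + (deriv upper s)\<^sup>2) * c"
        unfolding upper_normal_eq[OF sh \<nu>] using Gn[OF upper_frontier[OF sh] \<nu>] by simp
      then have 1: "G (pt s (upper s)) \<bullet> t = deriv upper s * (G (pt s (upper s)) \<bullet> w) + sqrt (1 + (deriv upper s)\<^sup>2) * c"
        by (simp add: inner_diff_right)
      have "G (pt s (lower s)) \<bullet> (deriv lower s *\<^sub>R w - t) = sqrt (1 + (deriv lower s)\<^sup>2) * c"
        unfolding lower_normal_eq[OF sh \<nu>'] using Gn[OF lower_frontier[OF sh] \<nu>'] by simp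
      then have 2: "G (pt s (lower s)) \<bullet> t = deriv lower s * (G (pt s (lower s)) \<bullet> w) - sqrt (1 + (deriv lower s)\<^sup>2) * c"
        by (simp add: inner_diff_right)
      have z: "u (pt s (upper s)) = 0" "u (pt s (lower s)) = 0"
        using bd upper_frontier[OF sh] lower_frontier[OF sh] by auto
      show ?thesis
        unfolding 1 2 z arc_def by (simp add: algebra_simps)
    qed
    ultimately show "bdd_uniform_limit {a..b} F' (\<lambda>s. - \<alpha> * mass u \<phi> s - mass u \<phi>2 s - c * arc \<phi> s)"
      by (rule bdd_uniform_limit_cong)
    have "bdd_uniform_limit {a..b} F (\<lambda>s. 1 * mass (\<lambda>x. G x \<bullet> w) \<phi> s)"
      unfolding F_def
      by (intro bdd_uniform_limit_intros shrink_lim shrink_integral_limit cont_phi continuous_intros cG ab(3))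
    then show "bdd_uniform_limit {a..b} F (mass (\<lambda>x. G x \<bullet> w) \<phi>)"
      by simp
  qed
qed

end

end

section \<open>Overdetermined solutions on symmetric domains\<close>

text \<open>By Weierstrass' theorem \<open>f\<close> is a uniform limit of polynomials, to all of
  which it is orthogonal, so the integral of its square vanishes.\<close>

lemma zero_moments_imp_zero:
  fixes f :: "real \<Rightarrow> real"
  assumes "a < b" and cf: "continuous_on {a..b} f"
    and mom: "\<And>k. integral {a..b} (\<lambda>y. f y * y ^ k) = 0" and y: "y \<in> {a..b}"
  shows "f y = 0"
proof -
  obtain K where K: "0 < K" "\<And>y. y \<in> {a..b} \<Longrightarrow> \<bar>f y\<bar> \<le> K"
    using compact_imp_bounded[OF compact_continuous_image[OF cf]] unfolding bounded_pos by auto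
  have int: "(\<lambda>y. f y * g y) integrable_on {a..b}" if "continuous_on {a..b} g" for g :: "real \<Rightarrow> real"
    using cf that by (intro integrable_continuous_real continuous_intros)
  have "\<bar>integral {a..b} (\<lambda>y. f y * f y)\<bar> \<le> e" if "0 < e" for e
  proof -
    define d where "d = e / (K * (b - a))"
    have "0 < d" using that K \<open>a < b\<close> by (simp add: d_def)
    obtain g where "real_polynomial_function g" and g: "\<And>x. x \<in> {a..b} \<Longrightarrow> \<bar>f x - g x\<bar> < d"
      using Stone_Weierstrass_real_polynomial_function[OF compact_Icc cf \<open>0 < d\<close>] by metis
    then obtain c n where gc: "g = (\<lambda>x. \<Sum>i\<le>n. c i * x ^ i)"
      using real_polynomial_function_iff_sum by blast
    have cg: "continuous_on {a..b} g" unfolding gc by (intro continuous_intros)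
    have "integral {a..b} (\<lambda>y. f y * g y) = integral {a..b} (\<lambda>y. \<Sum>i\<le>n. c i * (f y * y ^ i))"
      unfolding gc sum_distrib_left by (simp only: mult.left_commute)
    also have "\<dots> = (\<Sum>i\<le>n. integral {a..b} (\<lambda>y. c i * (f y * y ^ i)))"
      by (intro integral_sum integrable_continuous_real continuous_intros cf) auto
    also have "\<dots> = 0" using mom by simp
    finally have "integral {a..b} (\<lambda>y. f y * f y - f y * g y) = integral {a..b} (\<lambda>y. f y * f y)"
      by (subst Henstock_Kurzweil_Integration.integral_diff) (auto intro: int cf cg)
    moreover have "norm (integral {a..b} (\<lambda>y. f y * f y - f y * g y)) \<le> K * d * (b - a)"
    proof (rule integral_bound)
      show "continuous_on {a..b} (\<lambda>y. f y * f y - f y * g y)"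
        by (intro continuous_intros cf cg)
      fix t assume t: "t \<in> {a..b}"
      have "norm (f t * f t - f t * g t) = \<bar>f t\<bar> * \<bar>f t - g t\<bar>"
        by (simp add: right_diff_distrib flip: abs_mult)
      also have "\<dots> \<le> K * d"
        using K t g by (intro mult_mono) (auto intro: less_imp_le)
      finally show "norm (f t * f t - f t * g t) \<le> K * d" .
    qed (use \<open>a < b\<close> in auto)
    moreover have "K * d * (b - a) = e" using K \<open>a < b\<close> by (simp add: d_def)
    ultimately show ?thesis by simp
  qed
  then have "\<bar>integral {a..b} (\<lambda>y. f y * f y)\<bar> \<le> 0"
    using field_le_epsilon[of "\<bar>integral {a..b} (\<lambda>y. f y * f y)\<bar>" 0] by simp
  then have "integral {a..b} (\<lambda>y. f y * f y) = 0" by simp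
  moreover have "continuous_on {a..b} (\<lambda>y. f y * f y)"
    by (intro continuous_intros cf)
  ultimately have "\<forall>x\<in>{a..b}. f x * f x = 0"
    using integral_eq_0_iff[of a b "\<lambda>y. f y * f y"] \<open>a < b\<close> by simp
  then show ?thesis using y by simp
qed

text \<open>\<open>thin\<close> says that the slices shrink to nothing at the end \<open>a\<close>
  of the shadow, so the boundary has no flat piece there; the symmetry carries this over to
  \<open>- a\<close>.\<close>

locale symmetric_slices = convex_slices +
  fixes a :: real
  assumes a_pos: "0 < a" and shadow_eq: "shadow = {-a<..<a}"
    and symm: "\<And>x. x \<in> S \<Longrightarrow> 2 *\<^sub>R z - x \<in> S"
    and thin: "((\<lambda>s. upper s - lower s) \<longlongrightarrow> 0) (at_left a)"
begin

lemma pt_symm: "pt (- s) (- y) \<in> S \<longleftrightarrow> pt s y \<in> S"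
proof -
  have "2 *\<^sub>R z - pt s y = pt (- s) (- y)" "2 *\<^sub>R z - pt (- s) (- y) = pt s y" for s y
    by (simp_all add: pt_def scaleR_2 algebra_simps)
  then show ?thesis using symm by metis
qed

lemma upper_symm: "upper (- s) = - lower s"
proof -
  have "{y. pt s (- y) \<in> S} = uminus ` {y. pt s y \<in> S}"
    by (auto intro: image_eqI[where x = "- y" for y])
  moreover have "pt (- s) y \<in> S \<longleftrightarrow> pt s (- y) \<in> S" for y
    using pt_symm[of s "- y"] by simp
  ultimately have "{y. pt (- s) y \<in> S} = uminus ` {y. pt s y \<in> S}"
    by (simp only:)
  then show ?thesis unfolding upper_def lower_def Inf_real_def by simp
qed

lemma lower_symm: "lower (- s) = - upper s"
  using upper_symm[of "- s"] by simp

lemma deriv_symm: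
  assumes "s \<in> shadow"
  shows "deriv upper (- s) = deriv lower s" "deriv lower (- s) = deriv upper s"
proof -
  have *: "deriv upper (- s) = deriv lower s" if "s \<in> shadow" for s
  proof -
    have "- s \<in> shadow" using that by (auto simp: shadow_eq)
    then have "((\<lambda>s. upper (- s)) has_real_derivative - deriv upper (- s)) (at s)"
      using upper_deriv[of "- s"] by (simp add: DERIV_mirror)
    then have "((\<lambda>s. - lower s) has_real_derivative - deriv upper (- s)) (at s)"
      by (simp add: upper_symm)
    from DERIV_minus[OF this] have "(lower has_real_derivative deriv upper (- s)) (at s)" by simp
    then show ?thesis by (simp add: DERIV_imp_deriv)
  qed
  show "deriv upper (- s) = deriv lower s" using * assms .
  show "deriv lower (- s) = deriv upper s" using *[of "- s"] assms by (simp add: shadow_eq)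
qed

text \<open>Applied to \<open>u\<close> and to the component of \<open>G\<close> along
  \<open>w\<close>, this is the vanishing of the Cauchy data at both ends.\<close>

lemma mass_tendsto_0:
  fixes g :: "real^2 \<Rightarrow> real"
  assumes g: "continuous_on (closure S) g" and \<phi>: "continuous_on UNIV \<phi>"
  shows "(mass g \<phi> \<longlongrightarrow> 0) (at_left a)" "((\<lambda>s. mass g \<phi> (- s)) \<longlongrightarrow> 0) (at_left a)"
proof -
  obtain K where K: "\<And>s. s \<in> shadow \<Longrightarrow> norm (mass g \<phi> s) \<le> K * (upper s - lower s)"
    using mass_bound[OF g \<phi>] by auto
  have ev: "\<forall>\<^sub>F s in at_left a. s \<in> shadow"
    using a_pos unfolding shadow_eq eventually_at_left_field by (intro exI[of _ 0]) auto
  have lim: "((\<lambda>s. K * (upper s - lower s)) \<longlongrightarrow> 0) (at_left a)"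
    using tendsto_mult_left[OF thin, of K] by simp
  show "(mass g \<phi> \<longlongrightarrow> 0) (at_left a)"
    by (rule Lim_null_comparison[OF eventually_mono[OF ev K] lim])
  have "norm (mass g \<phi> (- s)) \<le> K * (upper s - lower s)" if "s \<in> shadow" for s
    using K[of "- s"] that by (simp add: upper_symm lower_symm shadow_eq)
  then show "((\<lambda>s. mass g \<phi> (- s)) \<longlongrightarrow> 0) (at_left a)"
    by (rule Lim_null_comparison[OF eventually_mono[OF ev] lim])
qed

definition hyp :: "real \<Rightarrow> real" where "hyp v = sqrt (1 + v\<^sup>2)"

lemma hyp_pos: "0 < hyp v"
  unfolding hyp_def by (simp add: add_pos_nonneg)

text \<open>One of the two truncated arguments is always 0 and contributes \<open>hyp 0 = 1\<close>,
  which is subtracted. The summands are monotone in \<open>v\<close>, one decreasing and one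
  increasing.\<close>

lemma hyp_split: "hyp v = hyp (min v 0) + hyp (max v 0) - 1"
  by (cases "v \<le> 0") (auto simp: hyp_def min_def max_def)

lemma hyp_mono: "\<bar>v\<bar> \<le> \<bar>v'\<bar> \<Longrightarrow> hyp v \<le> hyp v'"
  by (simp add: hyp_def abs_le_square_iff)

text \<open>The increasing part of the arc length density: the arc length over \<open>s\<close> is
  \<open>profile s + profile (- s) - 2\<close>.\<close>
definition profile :: "real \<Rightarrow> real" where
  "profile s = hyp (min (deriv upper s) 0) + hyp (max (deriv lower s) 0)"

text \<open>By concavity of \<open>upper\<close> and convexity of \<open>lower\<close>, both
  truncated slopes move away from 0 as \<open>s\<close> grows.\<close>

lemma profile_mono: "mono_on {-a<..<a} profile"
proof (rule mono_onI)
  fix r s assume rs: "r \<in> {-a<..<a}" "s \<in> {-a<..<a}" "r \<le> s"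
  then have "deriv upper s \<le> deriv upper r" "deriv lower r \<le> deriv lower s"
    using deriv_upper_antimono deriv_lower_mono by (auto simp: shadow_eq)
  then show "profile r \<le> profile s"
    unfolding profile_def by (intro add_mono hyp_mono) (auto simp: min_def max_def)
qed

lemma profile_pos: "0 < profile s"
  unfolding profile_def using hyp_pos by (simp add: add_pos_pos)

text \<open>The decreasing parts of the density at \<open>s\<close> are the increasing parts at
  \<open>- s\<close>, since the central symmetry exchanges the slopes of the two arcs.\<close>

lemma arc_eq_profile:
  assumes "s \<in> shadow"
  shows "arc (\<lambda>y. 1) s = profile s + profile (- s) - 2"
  using hyp_split[of "deriv upper s"] hyp_split[of "deriv lower s"] deriv_symm[OF assms]
  by (simp add: arc_def profile_def flip: hyp_def)

text \<open>For \<open>c = 0\<close> the moment of order k along the slices satisfies an oscillator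
  equation forced only by the moment of order k - 2, which is zero by induction. Its energy is then
  constant and tends to 0 at the tip; since \<alpha> is positive the moment itself vanishes. All
  moments being zero, so is \<open>u\<close> on every slice.\<close>

lemma overdetermined_trivial:
  assumes sol: "overdetermined_solution S \<alpha> 0 u" and "0 < \<alpha>" and x: "x \<in> S"
  shows "u x = 0"
proof -
  from sol obtain G where C2: "C2_on S u" and cu: "continuous_on (closure S) u"
    and cG: "continuous_on (closure S) G" and G: "\<And>x. x \<in> S \<Longrightarrow> G x = grad u x"
    and Gn: "\<And>p \<nu>. p \<in> frontier S \<Longrightarrow> outer_normal S p \<nu> \<Longrightarrow> G p \<bullet> \<nu> = 0"
    and eq: "\<And>x. x \<in> S \<Longrightarrow> laplacian u x + \<alpha> * u x = 0"
    and bd: "\<And>p. p \<in> frontier S \<Longrightarrow> u p = 0"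
    unfolding overdetermined_solution_def by blast
  have zero: "mass u (\<lambda>y. y ^ k) s = 0" if "s \<in> shadow" for k s
    using that
  proof (induction k arbitrary: s rule: less_induct)
    case (less k)
    \<comment> \<open>Truncated subtraction in the exponents does no harm: whenever it takes effect,
      one of the factors \<open>real k\<close> and \<open>real (k - 1)\<close> is 0.\<close>
    define \<phi> \<phi>1 \<phi>2 :: "real \<Rightarrow> real" where "\<phi> = (\<lambda>y. y ^ k)"
      and "\<phi>1 = (\<lambda>y. real k * y ^ (k - 1))" and "\<phi>2 = (\<lambda>y. real k * (real (k - 1) * y ^ (k - 1 - 1)))"
    have d1: "(\<phi> has_real_derivative \<phi>1 y) (at y)" for y
      unfolding \<phi>_def \<phi>1_def by (auto intro!: derivative_eq_intros)
    have d2: "(\<phi>1 has_real_derivative \<phi>2 y) (at y)" for y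
      unfolding \<phi>1_def \<phi>2_def by (auto intro!: derivative_eq_intros)
    have c2: "continuous_on UNIV \<phi>2" unfolding \<phi>2_def by (intro continuous_intros)
    note hyps = C2 cu cG G Gn eq bd d1 d2 c2
    define q where "q = mass (\<lambda>x. G x \<bullet> w) \<phi>"
    have m2: "mass u \<phi>2 s = 0" if "s \<in> shadow" for s
    proof (cases "k \<le> 1")
      case True
      then have "\<phi>2 = (\<lambda>y. 0)" by (cases k) (auto simp: \<phi>2_def)
      then show ?thesis by (simp add: mass_def)
    next
      case False
      have "mass u \<phi>2 s = real k * (real (k - 1) * mass u (\<lambda>y. y ^ (k - 1 - 1)) s)"
        unfolding mass_def \<phi>2_def by (simp add: mult.left_commute)
      then show ?thesis using less.IH[of "k - 1 - 1" s] False that by simp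
    qed
    have dm: "(mass u \<phi> has_real_derivative q s) (at s)" if "s \<in> shadow" for s
      unfolding q_def by (rule mass_has_derivative[OF hyps that])
    have dq: "(q has_real_derivative - \<alpha> * mass u \<phi> s) (at s)" if "s \<in> shadow" for s
      using flux_has_derivative[OF hyps that] m2[OF that] by (simp add: q_def)
    \<comment> \<open>The energy of the oscillator; its derivative vanishes because the forcing
      does.\<close>
    define E where "E = (\<lambda>s. q s * q s + \<alpha> * (mass u \<phi> s * mass u \<phi> s))"
    have "(E has_real_derivative 0) (at s)" if "s \<in> shadow" for s
      unfolding E_def
      by (rule DERIV_cong[OF DERIV_add[OF DERIV_mult[OF dq dq] DERIV_cmult[OF DERIV_mult[OF dm dm]]]])
         (use that in \<open>auto simp: algebra_simps\<close>)
    then have "(E has_real_derivative 0) (at s within shadow)" if "s \<in> shadow" for s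
      using that has_field_derivative_at_within by blast
    then obtain e where e: "\<And>s. s \<in> shadow \<Longrightarrow> E s = e"
      using has_field_derivative_zero_constant[OF convex_shadow, of E] by auto
    have cont: "continuous_on UNIV \<phi>" "continuous_on (closure S) (\<lambda>x. G x \<bullet> w)"
      unfolding \<phi>_def by (intro continuous_intros cG)+
    have "(E \<longlongrightarrow> 0 * 0 + \<alpha> * (0 * 0)) (at_left a)"
      unfolding E_def q_def by (intro tendsto_intros mass_tendsto_0 cu cont)
    moreover have "\<forall>\<^sub>F s in at_left a. E s = e"
      using a_pos e unfolding shadow_eq eventually_at_left_field by (intro exI[of _ 0]) auto
    then have "(E \<longlongrightarrow> e) (at_left a)"
      by (rule tendsto_eventually)
    ultimately have "e = 0"
      using tendsto_unique[of "at_left a" E e 0] by simp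
    then have "E s = 0" using e less.prems by simp
    then have "\<alpha> * (mass u \<phi> s * mass u \<phi> s) \<le> 0"
      unfolding E_def by (smt (verit) zero_le_square)
    then have "mass u \<phi> s * mass u \<phi> s \<le> 0" using \<open>0 < \<alpha>\<close> by (simp add: mult_le_0_iff)
    then show ?case
      unfolding \<phi>_def by (auto simp: mult_le_0_iff)
  qed
  define s y where "s = (x - z) \<bullet> w" and "y = (x - z) \<bullet> t"
  have x_eq: "x = pt s y" unfolding s_def y_def by (rule pt_coords)
  then have s: "s \<in> shadow" using x by (auto simp: shadow_def)
  have "u (pt s y) = 0"
  proof (rule zero_moments_imp_zero[OF lower_less_upper[OF s], of "\<lambda>y. u (pt s y)"])
    show "continuous_on {lower s..upper s} (\<lambda>y. u (pt s y))"
      using slice_continuous[OF cu _ s, of "\<lambda>y. 1"] by simp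
    show "integral {lower s..upper s} (\<lambda>y. u (pt s y) * y ^ k) = 0" for k
      using zero[OF s, of k] by (simp add: mass_def)
    show "y \<in> {lower s..upper s}"
      using x x_eq slice_iff[OF s, of y] by simp
  qed
  then show ?thesis using x_eq by simp
qed

text \<open>The vanishing cosine transform of m, as an improper integral since
  \<open>profile\<close> need not stay bounded at \<open>a\<close>. By \<open>arc_eq_profile\<close>
  and reflection, the integral of m times the cosine is twice that of \<open>profile\<close> minus
  the constant 1, and this 1 accounts for
  \<open>2 * sin (sqrt \<alpha> * b) / sqrt \<alpha>\<close>.\<close>

lemma overdetermined_profile_limit:
  assumes sol: "overdetermined_solution S \<alpha> c u" and "0 < \<alpha>" and nz: "\<exists>x\<in>S. u x \<noteq> 0"
  shows "((\<lambda>b. integral {-b..b} (\<lambda>s. profile s * cos (sqrt \<alpha> * s)) - 2 * sin (sqrt \<alpha> * b) / sqrt \<alpha>) \<longlongrightarrow> 0) (at_left a)"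
proof -
  define l where "l = sqrt \<alpha>"
  have l: "0 < l" "l * l = \<alpha>" using \<open>0 < \<alpha>\<close> by (auto simp: l_def)
  have "c \<noteq> 0"
  proof
    assume "c = 0"
    with sol have "overdetermined_solution S \<alpha> 0 u" by simp
    from overdetermined_trivial[OF this \<open>0 < \<alpha>\<close>] nz show False by auto
  qed
  from sol obtain G where C2: "C2_on S u" and cu: "continuous_on (closure S) u"
    and cG: "continuous_on (closure S) G" and G: "\<And>x. x \<in> S \<Longrightarrow> G x = grad u x"
    and Gn: "\<And>p \<nu>. p \<in> frontier S \<Longrightarrow> outer_normal S p \<nu> \<Longrightarrow> G p \<bullet> \<nu> = c"
    and eq: "\<And>x. x \<in> S \<Longrightarrow> laplacian u x + \<alpha> * u x = 0"
    and bd: "\<And>p. p \<in> frontier S \<Longrightarrow> u p = 0"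
    unfolding overdetermined_solution_def by blast
  have d1: "((\<lambda>y. 1) has_real_derivative 0) (at y)" "((\<lambda>y. 0) has_real_derivative 0) (at y)" for y :: real
    by auto
  note hyps = C2 cu cG G Gn eq bd d1(1) d1(2) continuous_on_const
  define W where "W = mass u (\<lambda>y. 1)"
  define Z where "Z = mass (\<lambda>x. G x \<bullet> w) (\<lambda>y. 1)"
  have dW: "(W has_real_derivative Z s) (at s)" if "s \<in> shadow" for s
    unfolding W_def Z_def by (rule mass_has_derivative[OF hyps that])
  have dZ: "(Z has_real_derivative - \<alpha> * W s - c * arc (\<lambda>y. 1) s) (at s)" if "s \<in> shadow" for s
    using flux_has_derivative[OF hyps that] by (simp add: W_def Z_def mass_def)
  \<comment> \<open>The Wronskian of \<open>W\<close> with cos (l s): the terms with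
    \<open>W\<close> cancel in its derivative, leaving only the forcing, and it tends to 0 at both
    ends.\<close>
  define D where "D = (\<lambda>s. Z s * cos (l * s) + l * (W s * sin (l * s)))"
  have dcos: "((\<lambda>s. cos (l * s)) has_real_derivative - l * sin (l * s)) (at s)"
    and dsin: "((\<lambda>s. sin (l * s)) has_real_derivative l * cos (l * s)) (at s)" for s
    by (auto intro!: derivative_eq_intros)
  have dD: "(D has_real_derivative - c * (arc (\<lambda>y. 1) s * cos (l * s))) (at s)" if "s \<in> shadow" for s
    unfolding D_def
    by (rule DERIV_cong[OF DERIV_add[OF DERIV_mult[OF dZ[OF that] dcos] DERIV_cmult[OF DERIV_mult[OF dW[OF that] dsin]]]])
       (simp add: l(2)[symmetric] algebra_simps)
  have key: "integral {-b..b} (\<lambda>s. profile s * cos (l * s)) - 2 * sin (l * b) / l = 1 / 2 * (- 1 / c * (D b - D (- b)))"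
    if b: "0 < b" "b < a" for b
  proof -
    have sub: "{-b..b} \<subseteq> shadow" using b by (auto simp: shadow_eq)
    have "((\<lambda>s. - c * (arc (\<lambda>y. 1) s * cos (l * s))) has_integral D b - D (- b)) {-b..b}"
    proof (rule fundamental_theorem_of_calculus)
      show "(D has_vector_derivative - c * (arc (\<lambda>y. 1) s * cos (l * s))) (at s within {-b..b})"
        if "s \<in> {-b..b}" for s
        unfolding has_real_derivative_iff_has_vector_derivative[symmetric]
        using dD sub that by (blast intro: has_field_derivative_at_within)
    qed (use b in simp)
    from has_integral_mult_right[OF this, of "- 1 / c"]
    have "((\<lambda>s. - 1 / c * (- c * (arc (\<lambda>y. 1) s * cos (l * s)))) has_integral - 1 / c * (D b - D (- b))) {-b..b}" .
    moreover have "- 1 / c * (- c * x) = x" for x using \<open>c \<noteq> 0\<close> by simp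
    ultimately have arc: "((\<lambda>s. arc (\<lambda>y. 1) s * cos (l * s)) has_integral - 1 / c * (D b - D (- b))) {-b..b}"
      by (simp only:)
    define I where "I = integral {-b..b} (\<lambda>s. profile s * cos (l * s))"
    have p: "((\<lambda>s. profile s * cos (l * s)) has_integral I) {-b..b}"
      unfolding I_def using b l profile_pos profile_mono
      by (intro integrable_integral integral_mono_cos_bound(1)) (auto simp: mono_on_def less_imp_le)
    have "((\<lambda>s. profile (- s) * cos (l * s)) has_integral I) {-b..b}"
      using has_integral_reflect_real[where f = "\<lambda>s. profile s * cos (l * s)" and a = "- b" and b = b and i = I] p by simp
    moreover have "((\<lambda>s. cos (l * s)) has_integral sin (l * b) / l - sin (l * - b) / l) {-b..b}"
      using b l by (intro fundamental_theorem_of_calculus)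
        (auto intro!: derivative_eq_intros simp flip: has_real_derivative_iff_has_vector_derivative)
    then have "((\<lambda>s. cos (l * s)) has_integral 2 * sin (l * b) / l) {-b..b}" by simp
    ultimately have "((\<lambda>s. profile s * cos (l * s) + profile (- s) * cos (l * s) - 2 * cos (l * s)) has_integral
        I + I - 2 * (2 * sin (l * b) / l)) {-b..b}"
      by (intro has_integral_diff has_integral_add has_integral_mult_right p)
    then have "((\<lambda>s. arc (\<lambda>y. 1) s * cos (l * s)) has_integral I + I - 2 * (2 * sin (l * b) / l)) {-b..b}"
      using sub by (elim has_integral_eq[rotated]) (auto simp: arc_eq_profile algebra_simps subset_iff)
    from has_integral_unique[OF this arc]
    have "2 * (I - 2 * sin (l * b) / l) = - 1 / c * (D b - D (- b))" by simp
    moreover have "2 * x = y \<Longrightarrow> x = 1 / 2 * y" for x y :: real by simp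
    ultimately show ?thesis unfolding I_def by (simp only:)
  qed
  have c1: "continuous_on UNIV (\<lambda>y::real. 1::real)" "continuous_on (closure S) (\<lambda>x. G x \<bullet> w)"
    by (intro continuous_intros cG)+
  have Z0: "(Z \<longlongrightarrow> 0) (at_left a)" "((\<lambda>b. Z (- b)) \<longlongrightarrow> 0) (at_left a)"
    and W0: "(W \<longlongrightarrow> 0) (at_left a)" "((\<lambda>b. W (- b)) \<longlongrightarrow> 0) (at_left a)"
    unfolding Z_def W_def using mass_tendsto_0[OF c1(2) c1(1)] mass_tendsto_0[OF cu c1(1)] by auto
  have "((\<lambda>b. Z b * cos (l * b) + l * (W b * sin (l * b))) \<longlongrightarrow> 0 * cos (l * a) + l * (0 * sin (l * a))) (at_left a)"
    by (intro tendsto_intros Z0 W0)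
  moreover have "((\<lambda>b. Z (- b) * cos (l * - b) + l * (W (- b) * sin (l * - b))) \<longlongrightarrow>
      0 * cos (l * - a) + l * (0 * sin (l * - a))) (at_left a)"
    by (intro tendsto_intros Z0 W0)
  ultimately have "((\<lambda>b. D b - D (- b)) \<longlongrightarrow> 0 - 0) (at_left a)"
    unfolding D_def by (intro tendsto_diff) simp_all
  from tendsto_mult_left[OF this, of "1 / 2 * (- 1 / c)"]
  have lim: "((\<lambda>b. 1 / 2 * (- 1 / c * (D b - D (- b)))) \<longlongrightarrow> 0) (at_left a)"
    by (simp only: mult.assoc) simp
  have "\<forall>\<^sub>F b in at_left a. 1 / 2 * (- 1 / c * (D b - D (- b))) =
      integral {-b..b} (\<lambda>s. profile s * cos (l * s)) - 2 * sin (l * b) / l"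
    using a_pos key unfolding eventually_at_left_field by (intro exI[of _ 0]) auto
  from Lim_transform_eventually[OF lim this] show ?thesis
    unfolding l_def by simp
qed

end

section \<open>Boundary charts\<close>

locale boundary_chart =
  fixes S :: "(real^2) set" and p e1 e2 :: "real^2" and r :: real and g :: "real \<Rightarrow> real"
  assumes open_S: "open S" and p: "p \<in> frontier S"
    and norm_e1: "norm e1 = 1" and norm_e2: "norm e2 = 1" and orth: "e1 \<bullet> e2 = 0" and r: "0 < r"
    and dg: "\<And>s. s \<in> {-r<..<r} \<Longrightarrow> g differentiable (at s)"
    and ddg: "\<And>s. s \<in> {-r<..<r} \<Longrightarrow> deriv g differentiable (at s)"
    and cddg: "continuous_on {-r<..<r} (deriv (deriv g))"
    and graph: "\<And>y. y \<in> ball p r \<Longrightarrow> y \<in> S \<longleftrightarrow> (y - p) \<bullet> e2 < g ((y - p) \<bullet> e1)"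
begin

abbreviation g1 :: "real \<Rightarrow> real" where "g1 \<equiv> deriv g"
abbreviation g2 :: "real \<Rightarrow> real" where "g2 \<equiv> deriv (deriv g)"

definition crv :: "real \<Rightarrow> real^2" where "crv \<sigma> = p + \<sigma> *\<^sub>R e1 + g \<sigma> *\<^sub>R e2"
definition nrm :: "real \<Rightarrow> real^2" where "nrm \<sigma> = e2 - g1 \<sigma> *\<^sub>R e1"

lemma inner_e [simp]: "e1 \<bullet> e1 = 1" "e2 \<bullet> e2 = 1" "e1 \<bullet> e2 = 0" "e2 \<bullet> e1 = 0"
  using norm_e1 norm_e2 orth by (auto simp: norm_eq_1 inner_commute)

lemma g_deriv: "\<sigma> \<in> {-r<..<r} \<Longrightarrow> (g has_real_derivative g1 \<sigma>) (at \<sigma>)"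
  using dg real_differentiable_def field_differentiable_derivI field_differentiable_def by blast

lemma g1_deriv: "\<sigma> \<in> {-r<..<r} \<Longrightarrow> (g1 has_real_derivative g2 \<sigma>) (at \<sigma>)"
  using ddg real_differentiable_def field_differentiable_derivI field_differentiable_def by blast

lemma coord_range:
  assumes "y \<in> ball p r"
  shows "(y - p) \<bullet> e1 \<in> {-r<..<r}"
proof -
  have "\<bar>(y - p) \<bullet> e1\<bar> \<le> norm (y - p) * norm e1" by (rule Cauchy_Schwarz_ineq2)
  also have "\<dots> < r" using assms norm_e1 by (simp add: dist_norm norm_minus_commute)
  finally show ?thesis by (simp add: abs_less_iff)
qed

lemma crv_coords: "(crv \<sigma> - p) \<bullet> e1 = \<sigma>" "(crv \<sigma> - p) \<bullet> e2 = g \<sigma>"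
  by (simp_all add: crv_def inner_add_left)

lemma crv_eqI: "(y - p) \<bullet> e2 = g ((y - p) \<bullet> e1) \<Longrightarrow> y = crv ((y - p) \<bullet> e1)"
  using orthonormal_expansion[OF norm_e1 norm_e2 orth, of "y - p"]
  by (simp add: crv_def) (metis add.assoc add.commute diff_add_cancel)

text \<open>The chart describes membership in \<open>S\<close> only. Lying strictly above the graph
  is an open condition, so such points have a neighbourhood that misses \<open>S\<close>; hence near
  \<open>p\<close> the frontier lies on the graph.\<close>

lemma above_not_closure:
  assumes "y \<in> ball p r" "g ((y - p) \<bullet> e1) < (y - p) \<bullet> e2"
  shows "y \<notin> closure S"
proof
  assume cl: "y \<in> closure S"
  define f where "f = (\<lambda>y. (y - p) \<bullet> e2 - g ((y - p) \<bullet> e1))"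
  have cg: "continuous_on {-r<..<r} g"
    by (intro continuous_at_imp_continuous_on ballI) (rule DERIV_isCont[OF g_deriv])
  have "continuous_on (ball p r) (\<lambda>y. g ((y - p) \<bullet> e1))"
  proof (rule continuous_on_compose2[OF cg])
    show "(\<lambda>y. (y - p) \<bullet> e1) ` ball p r \<subseteq> {-r<..<r}" using coord_range by blast
  qed (intro continuous_intros)
  then have "continuous_on (ball p r) f"
    unfolding f_def by (intro continuous_on_diff continuous_on_inner continuous_on_const continuous_on_id)
  then have "open (ball p r \<inter> f -` {0<..})"
    by (rule continuous_open_preimage) auto
  moreover have "y \<in> ball p r \<inter> f -` {0<..}" using assms by (simp add: f_def)
  ultimately obtain x where "x \<in> S" "x \<in> ball p r \<inter> f -` {0<..}"
    using cl unfolding closure_iff_nhds_not_empty by blast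
  then show False using graph[of x] by (simp add: f_def)
qed

lemma frontier_on_graph:
  assumes "y \<in> ball p r" "y \<in> frontier S"
  shows "(y - p) \<bullet> e2 = g ((y - p) \<bullet> e1)"
proof -
  have "y \<in> closure S" "y \<notin> S"
    using assms(2) by (auto simp: frontier_def interior_open[OF open_S])
  then show ?thesis
    using above_not_closure[OF assms(1)] graph[OF assms(1)] by force
qed

lemma closure_below_graph:
  assumes "y \<in> ball p r" "y \<in> closure S"
  shows "(y - p) \<bullet> e2 \<le> g ((y - p) \<bullet> e1)"
  using above_not_closure[OF assms(1)] assms(2) by (auto simp: not_less[symmetric])

lemma g_0: "g 0 = 0"
  using frontier_on_graph[of p] r p by simp

lemma nrm_nz: "0 < norm (nrm \<sigma>)"
proof -
  have "nrm \<sigma> \<bullet> e2 = 1" by (simp add: nrm_def inner_diff_left)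
  then show ?thesis by auto
qed

lemma norm_nrm: "(norm (nrm \<sigma>))\<^sup>2 = 1 + (g1 \<sigma>)\<^sup>2"
  unfolding power2_norm_eq_inner by (simp add: nrm_def inner_diff_left inner_diff_right power2_eq_square)

text \<open>Along a ray in direction \<open>v\<close> the height over the graph, divided by the
  time, tends to \<open>v \<bullet> nrm \<sigma>\<close>; its sign decides on which side the ray
  starts.\<close>

lemma graph_outer_normal:
  assumes y: "y \<in> ball p r" and \<sigma>: "\<sigma> = (y - p) \<bullet> e1" and on: "(y - p) \<bullet> e2 = g \<sigma>"
  shows "outer_normal S y (nrm \<sigma> /\<^sub>R norm (nrm \<sigma>))"
proof -
  have \<sigma>r: "\<sigma> \<in> {-r<..<r}" using coord_range[OF y] \<sigma> by simp
  have ev_ball: "\<forall>\<^sub>F t in at_right 0. y + t *\<^sub>R v \<in> ball p r" for v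
  proof -
    have "((\<lambda>t. y + t *\<^sub>R v) \<longlongrightarrow> y + 0 *\<^sub>R v) (at_right (0::real))"
      by (intro tendsto_intros)
    then show ?thesis using y by (intro topological_tendstoD) auto
  qed
  have lim: "((\<lambda>t. (t * (v \<bullet> e2) - (g (\<sigma> + t * (v \<bullet> e1)) - g \<sigma>)) / t) \<longlongrightarrow> v \<bullet> nrm \<sigma>) (at_right 0)" for v
  proof -
    have "((\<lambda>t. g (\<sigma> + t * (v \<bullet> e1))) has_real_derivative g1 \<sigma> * (v \<bullet> e1)) (at 0)"
    proof (rule DERIV_chain2[where f = g and g = "\<lambda>t. \<sigma> + t * (v \<bullet> e1)"])
      show "(g has_real_derivative g1 \<sigma>) (at (\<sigma> + 0 * (v \<bullet> e1)))"
        using g_deriv[OF \<sigma>r] by simp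
    qed (auto intro!: derivative_eq_intros)
    then have "((\<lambda>t. t * (v \<bullet> e2) - (g (\<sigma> + t * (v \<bullet> e1)) - g \<sigma>)) has_real_derivative v \<bullet> nrm \<sigma>) (at 0)"
      by (auto intro!: derivative_eq_intros simp: nrm_def inner_diff_right)
    then have "((\<lambda>t. (t * (v \<bullet> e2) - (g (\<sigma> + t * (v \<bullet> e1)) - g \<sigma>)) / t) \<longlongrightarrow> v \<bullet> nrm \<sigma>) (at 0)"
      unfolding has_field_derivative_iff by simp
    then show ?thesis by (rule tendsto_mono[rotated]) (simp add: at_le)
  qed
  have coords: "(y + t *\<^sub>R v - p) \<bullet> e2 - g ((y + t *\<^sub>R v - p) \<bullet> e1)
      = t * (v \<bullet> e2) - (g (\<sigma> + t * (v \<bullet> e1)) - g \<sigma>)" for t v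
  proof -
    have "(y + t *\<^sub>R v - p) \<bullet> e = (y - p) \<bullet> e + t * (v \<bullet> e)" for e
      by (simp add: inner_diff_left inner_add_left)
    then show ?thesis using on \<sigma> by simp
  qed
  have pos: "\<forall>\<^sub>F t in at_right (0::real). 0 < t" by (rule eventually_at_right_less)
  have "\<forall>\<^sub>F t in at_right 0. y + t *\<^sub>R v \<in> S" if "v \<bullet> nrm \<sigma> < 0" for v
    using order_tendstoD(2)[OF lim that] ev_ball[of v] pos
  proof eventually_elim
    case (elim t)
    then have "t * (v \<bullet> e2) - (g (\<sigma> + t * (v \<bullet> e1)) - g \<sigma>) < 0"
      by (simp add: divide_less_0_iff)
    then show ?case using graph[of "y + t *\<^sub>R v"] elim coords[of t v] by simp
  qed
  moreover have "\<forall>\<^sub>F t in at_right 0. y + t *\<^sub>R v \<notin> closure S" if "v \<bullet> nrm \<sigma> > 0" for v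
    using order_tendstoD(1)[OF lim that] ev_ball[of v] pos
  proof eventually_elim
    case (elim t)
    then have "0 < t * (v \<bullet> e2) - (g (\<sigma> + t * (v \<bullet> e1)) - g \<sigma>)"
      by (simp add: zero_less_divide_iff)
    then show ?case using above_not_closure[of "y + t *\<^sub>R v"] elim coords[of t v] by simp
  qed
  ultimately show ?thesis
    using nrm_nz[of \<sigma>] by (auto simp: outer_normal_def zero_less_mult_iff mult_less_0_iff divide_less_0_iff)
qed

lemma crv_outer_normal: "crv \<sigma> \<in> ball p r \<Longrightarrow> outer_normal S (crv \<sigma>) (nrm \<sigma> /\<^sub>R norm (nrm \<sigma>))"
  by (rule graph_outer_normal) (simp_all add: crv_coords)

text \<open>The point is not in \<open>S\<close>, and the ray along the inner normal approaches it
  from inside.\<close>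

lemma crv_frontier:
  assumes "crv \<sigma> \<in> ball p r"
  shows "crv \<sigma> \<in> frontier S"
proof -
  define \<nu> where "\<nu> = nrm \<sigma> /\<^sub>R norm (nrm \<sigma>)"
  have n: "outer_normal S (crv \<sigma>) \<nu>" unfolding \<nu>_def by (rule crv_outer_normal[OF assms])
  then have "(- \<nu>) \<bullet> \<nu> < 0" by (simp add: outer_normal_def norm_eq_1)
  then have "\<forall>\<^sub>F t in at_right 0. crv \<sigma> + t *\<^sub>R (- \<nu>) \<in> closure S"
    using n closure_subset unfolding outer_normal_def by (blast intro: eventually_mono)
  moreover have "((\<lambda>t. crv \<sigma> + t *\<^sub>R (- \<nu>)) \<longlongrightarrow> crv \<sigma> + 0 *\<^sub>R (- \<nu>)) (at_right (0::real))"
    by (intro tendsto_intros)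
  ultimately have "crv \<sigma> + 0 *\<^sub>R (- \<nu>) \<in> closure S"
    by (intro Lim_in_closed_set[OF closed_closure]) auto
  moreover have "crv \<sigma> \<notin> S" using graph[OF assms] by (simp add: crv_coords)
  ultimately show ?thesis by (simp add: frontier_def interior_open[OF open_S])
qed

lemma crv_near: "\<exists>\<rho>>0. \<rho> \<le> r \<and> (\<forall>\<sigma>. \<bar>\<sigma>\<bar> < \<rho> \<longrightarrow> crv \<sigma> \<in> ball p r)"
proof -
  have "isCont g 0" using g_deriv[of 0] r DERIV_isCont by simp
  then have "(crv \<longlongrightarrow> p + 0 *\<^sub>R e1 + g 0 *\<^sub>R e2) (at 0)"
    unfolding crv_def isCont_def by (intro tendsto_intros)
  then have "\<forall>\<^sub>F \<sigma> in at 0. crv \<sigma> \<in> ball p r"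
    using r g_0 by (intro topological_tendstoD) auto
  then obtain d where "0 < d" and d: "\<And>\<sigma>. \<sigma> \<noteq> 0 \<Longrightarrow> dist \<sigma> 0 < d \<Longrightarrow> crv \<sigma> \<in> ball p r"
    unfolding eventually_at by blast
  have "crv 0 \<in> ball p r" using r g_0 by (simp add: crv_def)
  then have "crv \<sigma> \<in> ball p r" if "\<bar>\<sigma>\<bar> < d" for \<sigma>
    using d[of \<sigma>] that by (cases "\<sigma> = 0") (simp_all add: dist_real_def del: mem_ball)
  then show ?thesis using r \<open>0 < d\<close> by (intro exI[of _ "min d r"]) simp
qed

end

text \<open>A Hoelder bound with positive exponent tends to 0 at each point and so gives continuity
  of the second derivative.\<close>

lemma C2_eps_boundary_chart:
  assumes "open S" "C2_eps_boundary \<epsilon> S" "0 < \<epsilon>" "p \<in> frontier S"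
  obtains e1 e2 r g where "boundary_chart S p e1 e2 r g"
proof -
  from assms(2,4) obtain e1 e2 r g where 1: "norm e1 = 1" "norm e2 = 1" "e1 \<bullet> e2 = 0" "r > 0"
    and 2: "\<And>s. s \<in> {-r<..<r} \<Longrightarrow> g differentiable (at s) \<and> deriv g differentiable (at s)"
    and 3: "\<exists>K. \<forall>s\<in>{-r<..<r}. \<forall>t\<in>{-r<..<r}. \<bar>deriv (deriv g) s - deriv (deriv g) t\<bar> \<le> K * \<bar>s - t\<bar> powr \<epsilon>"
    and 4: "\<And>y. y \<in> ball p r \<Longrightarrow> y \<in> S \<longleftrightarrow> (y - p) \<bullet> e2 < g ((y - p) \<bullet> e1)"
    unfolding C2_eps_boundary_def by metis
  obtain K where K: "\<And>s t. s \<in> {-r<..<r} \<Longrightarrow> t \<in> {-r<..<r} \<Longrightarrow> \<bar>deriv (deriv g) s - deriv (deriv g) t\<bar> \<le> K * \<bar>s - t\<bar> powr \<epsilon>"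
    using 3 by blast
  have "continuous_on {-r<..<r} (deriv (deriv g))"
    unfolding continuous_on_def
  proof
    fix t assume t: "t \<in> {-r<..<r}"
    have "((\<lambda>s. K * \<bar>s - t\<bar> powr \<epsilon>) \<longlongrightarrow> K * 0) (at t within {-r<..<r})"
    proof (intro tendsto_mult_left tendsto_zero_powrI)
      show "((\<lambda>s. \<bar>s - t\<bar>) \<longlongrightarrow> 0) (at t within {-r<..<r})"
        by (auto intro!: tendsto_eq_intros)
    qed (use assms(3) in \<open>auto intro: tendsto_const\<close>)
    then have 0: "((\<lambda>s. K * \<bar>s - t\<bar> powr \<epsilon>) \<longlongrightarrow> 0) (at t within {-r<..<r})" by simp
    have "\<forall>\<^sub>F s in at t within {-r<..<r}. norm (deriv (deriv g) s - deriv (deriv g) t) \<le> K * \<bar>s - t\<bar> powr \<epsilon>"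
      using K[OF _ t] by (auto simp: eventually_at_filter intro: always_eventually)
    then have "((\<lambda>s. deriv (deriv g) s - deriv (deriv g) t) \<longlongrightarrow> 0) (at t within {-r<..<r})"
      by (rule Lim_null_comparison[OF _ 0])
    then show "(deriv (deriv g) \<longlongrightarrow> deriv (deriv g) t) (at t within {-r<..<r})"
      by (simp add: LIM_zero_iff)
  qed
  then show ?thesis
    using that[of e1 e2 r g] 1 2 4 assms(1,4) by (simp add: boundary_chart_def)
qed

lemma C2_eps_boundary_outer_normal:
  assumes "open S" "C2_eps_boundary \<epsilon> S" "0 < \<epsilon>" "p \<in> frontier S"
  shows "\<exists>\<nu>. outer_normal S p \<nu>"
proof -
  obtain e1 e2 r g where "boundary_chart S p e1 e2 r g"
    using C2_eps_boundary_chart[OF assms] .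
  then interpret boundary_chart S p e1 e2 r g .
  show ?thesis using graph_outer_normal[of p 0] r g_0 by auto
qed

section \<open>Asymptotics at a point of positive curvature\<close>

locale centred_chart = boundary_chart +
  fixes z :: "real^2"
  assumes convex_S: "convex S" and bounded_S: "bounded S" and z_in: "z \<in> S"
    and symm: "\<And>x. x \<in> S \<Longrightarrow> 2 *\<^sub>R z - x \<in> S"
    and normals: "\<And>p. p \<in> frontier S \<Longrightarrow> \<exists>\<nu>. outer_normal S p \<nu>"
begin

context
  fixes s0 :: real
  assumes in_ball: "crv s0 \<in> ball p r" and neg: "g2 s0 < 0"
begin

lemma s0_range: "s0 \<in> {-r<..<r}"
  using coord_range[OF in_ball] by (simp add: crv_coords)

text \<open>Depth of the graph below its tangent line at \<open>s0\<close>; divided by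
  \<open>norm (nrm s0)\<close> it is the distance of the graph point to the supporting line.\<close>

definition gap :: "real \<Rightarrow> real" where "gap \<sigma> = g s0 + g1 s0 * (\<sigma> - s0) - g \<sigma>"

lemma near_range: "\<forall>\<^sub>F \<sigma> in at s0. \<sigma> \<in> {-r<..<r}"
  using s0_range eventually_at_in_open'[of "{-r<..<r}" s0] by simp

lemma slope_lim: "((\<lambda>\<sigma>. (g1 s0 - g1 \<sigma>) / (\<sigma> - s0)) \<longlongrightarrow> - g2 s0) (at s0)"
proof -
  have "((\<lambda>\<sigma>. (g1 \<sigma> - g1 s0) / (\<sigma> - s0)) \<longlongrightarrow> g2 s0) (at s0)"
    using g1_deriv[OF s0_range] by (simp add: has_field_derivative_iff)
  from tendsto_minus[OF this] show ?thesis
    by (simp add: minus_divide_left)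
qed

text \<open>A single use of l'Hopital's rule: the quotient of first derivatives is half a difference
  quotient of \<open>g1\<close> at \<open>s0\<close>, so only the derivative of \<open>g1\<close> at
  that one point enters.\<close>

lemma gap_lim: "((\<lambda>\<sigma>. gap \<sigma> / (\<sigma> - s0)\<^sup>2) \<longlongrightarrow> - g2 s0 / 2) (at s0)"
proof (rule lhopital)
  have "isCont g s0" using g_deriv[OF s0_range] by (rule DERIV_isCont)
  then have "(gap \<longlongrightarrow> g s0 + g1 s0 * (s0 - s0) - g s0) (at s0)"
    unfolding gap_def isCont_def by (intro tendsto_intros)
  then show "(gap \<longlongrightarrow> 0) (at s0)" by simp
  have "((\<lambda>\<sigma>. (\<sigma> - s0)\<^sup>2) \<longlongrightarrow> (s0 - s0)\<^sup>2) (at s0)" by (intro tendsto_intros)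
  then show "((\<lambda>\<sigma>. (\<sigma> - s0)\<^sup>2) \<longlongrightarrow> 0) (at s0)" by simp
  have ne: "\<forall>\<^sub>F \<sigma> in at s0. \<sigma> \<noteq> s0" by (rule eventually_neq_at_within)
  then show "\<forall>\<^sub>F \<sigma> in at s0. (\<sigma> - s0)\<^sup>2 \<noteq> 0" by eventually_elim simp
  show "\<forall>\<^sub>F \<sigma> in at s0. 2 * (\<sigma> - s0) \<noteq> 0" using ne by eventually_elim simp
  show "\<forall>\<^sub>F \<sigma> in at s0. (gap has_real_derivative g1 s0 - g1 \<sigma>) (at \<sigma>)"
    using near_range
  proof eventually_elim
    case (elim \<sigma>)
    show ?case unfolding gap_def
      by (rule derivative_eq_intros g_deriv[OF elim] refl | simp)+
  qed
  show "\<forall>\<^sub>F \<sigma> in at s0. ((\<lambda>\<sigma>. (\<sigma> - s0)\<^sup>2) has_real_derivative 2 * (\<sigma> - s0)) (at \<sigma>)"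
    by (intro always_eventually allI) (auto intro!: derivative_eq_intros)
  have "((\<lambda>\<sigma>. (g1 s0 - g1 \<sigma>) / (\<sigma> - s0) / 2) \<longlongrightarrow> - g2 s0 / 2) (at s0)"
    by (intro tendsto_divide slope_lim tendsto_const) simp
  then show "((\<lambda>\<sigma>. (g1 s0 - g1 \<sigma>) / (2 * (\<sigma> - s0))) \<longlongrightarrow> - g2 s0 / 2) (at s0)"
    by (simp add: mult.commute)
qed

lemma gap_pos: "\<forall>\<^sub>F \<sigma> in at s0. 0 < gap \<sigma>"
proof -
  have "0 < - g2 s0 / 2" using neg by simp
  from order_tendstoD(1)[OF gap_lim this] eventually_neq_at_within[of s0 s0 UNIV] show ?thesis
    by eventually_elim (simp add: zero_less_divide_iff)
qed

lemma gap_eq: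
  assumes "y \<in> ball p r" "(y - p) \<bullet> e2 = g ((y - p) \<bullet> e1)"
  shows "(crv s0 - y) \<bullet> nrm s0 = gap ((y - p) \<bullet> e1)"
proof -
  have "(crv s0 - y) \<bullet> nrm s0
      = ((crv s0 - p) \<bullet> e2 - g1 s0 * ((crv s0 - p) \<bullet> e1)) - ((y - p) \<bullet> e2 - g1 s0 * ((y - p) \<bullet> e1))"
    by (simp add: nrm_def algebra_simps inner_diff_right)
  then show ?thesis
    unfolding assms(2) crv_coords gap_def by (simp add: right_diff_distrib)
qed

lemma support_crv: "x \<in> closure S \<Longrightarrow> (x - crv s0) \<bullet> nrm s0 \<le> 0"
  using outer_normal_support[OF convex_S _ crv_outer_normal[OF in_ball], of x] crv_frontier[OF in_ball] nrm_nz[of s0]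
  by (auto simp: frontier_def mult_le_0_iff divide_le_0_iff)

lemma support_crv_strict: "x \<in> S \<Longrightarrow> (x - crv s0) \<bullet> nrm s0 < 0"
  using outer_normal_support_strict[OF open_S convex_S _ crv_outer_normal[OF in_ball], of x] crv_frontier[OF in_ball] nrm_nz[of s0]
  by (auto simp: frontier_def mult_less_0_iff divide_less_0_iff)

text \<open>A second point of contact would put a segment of the tangent line into the closure.
  Close to the tip that segment lies above the graph because \<open>gap\<close> is positive, which
  is impossible.\<close>

lemma support_unique:
  assumes x: "x \<in> closure S" "x \<noteq> crv s0"
  shows "(x - crv s0) \<bullet> nrm s0 < 0"
proof (rule ccontr)
  assume "\<not> ?thesis"
  then have perp: "(x - crv s0) \<bullet> nrm s0 = 0" using support_crv[OF x(1)] by linarith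
  define v where "v = x - crv s0"
  have v2: "v \<bullet> e2 = g1 s0 * (v \<bullet> e1)"
    using perp by (simp add: v_def nrm_def inner_diff_right)
  have v1: "v \<bullet> e1 \<noteq> 0"
  proof
    assume 0: "v \<bullet> e1 = 0"
    then have "v = 0" using orthonormal_expansion[OF norm_e1 norm_e2 orth, of v] v2 by simp
    then show False using x(2) by (simp add: v_def)
  qed
  have "((\<lambda>\<tau>. s0 + \<tau> * (v \<bullet> e1)) \<longlongrightarrow> s0 + 0 * (v \<bullet> e1)) (at_right 0)"
    by (intro tendsto_intros)
  moreover have pos: "\<forall>\<^sub>F \<tau> in at_right (0::real). 0 < \<tau>" by (rule eventually_at_right_less)
  then have "\<forall>\<^sub>F \<tau> in at_right 0. s0 + \<tau> * (v \<bullet> e1) \<noteq> s0"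
    by eventually_elim (use v1 in simp)
  ultimately have "filterlim (\<lambda>\<tau>. s0 + \<tau> * (v \<bullet> e1)) (at s0) (at_right 0)"
    by (simp add: filterlim_at)
  from eventually_compose_filterlim[OF gap_pos this]
  have gp: "\<forall>\<^sub>F \<tau> in at_right 0. 0 < gap (s0 + \<tau> * (v \<bullet> e1))" .
  have "((\<lambda>\<tau>. crv s0 + \<tau> *\<^sub>R v) \<longlongrightarrow> crv s0 + 0 *\<^sub>R v) (at_right (0::real))"
    by (intro tendsto_intros)
  then have ball: "\<forall>\<^sub>F \<tau> in at_right (0::real). crv s0 + \<tau> *\<^sub>R v \<in> ball p r"
    using in_ball by (intro topological_tendstoD) auto
  have lt1: "\<forall>\<^sub>F \<tau> in at_right (0::real). \<tau> < 1"
    by (intro order_tendstoD) (auto intro: tendsto_intros)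
  from gp ball lt1 pos have "\<forall>\<^sub>F \<tau> in at_right (0::real). False"
  proof eventually_elim
    case (elim \<tau>)
    have "(1 - \<tau>) *\<^sub>R crv s0 + \<tau> *\<^sub>R x \<in> closure S"
      using convex_closure[OF convex_S] crv_frontier[OF in_ball] x(1) elim
      by (intro convexD) (auto simp: frontier_def)
    then have cl: "crv s0 + \<tau> *\<^sub>R v \<in> closure S" by (simp add: v_def algebra_simps)
    have c: "(crv s0 + \<tau> *\<^sub>R v - p) \<bullet> e = (crv s0 - p) \<bullet> e + \<tau> * (v \<bullet> e)" for e
      by (simp add: inner_diff_left inner_add_left)
    show ?case
      using closure_below_graph[OF elim(2) cl] elim(1) unfolding c crv_coords v2 by (simp add: gap_def mult.left_commute)
  qed
  then show False by simp
qed

text \<open>Outside a ball about the tip the linear functional attains a maximum over the closure,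
  and this maximum is negative by \<open>support_unique\<close>.\<close>

lemma cap_shrinks:
  assumes "0 < \<delta>"
  shows "\<exists>\<eta>>0. \<forall>x\<in>closure S. - \<eta> < (x - crv s0) \<bullet> nrm s0 \<longrightarrow> dist x (crv s0) < \<delta>"
proof -
  define K where "K = closure S - ball (crv s0) \<delta>"
  have "compact K" unfolding K_def using bounded_S by (intro compact_diff) (auto simp: compact_closure)
  show ?thesis
  proof (cases "K = {}")
    case True
    then show ?thesis by (intro exI[of _ 1]) (auto simp: K_def dist_commute)
  next
    case False
    have "continuous_on K (\<lambda>x. (x - crv s0) \<bullet> nrm s0)" by (intro continuous_intros)
    then obtain x0 where x0: "x0 \<in> K" and max: "\<And>x. x \<in> K \<Longrightarrow> (x - crv s0) \<bullet> nrm s0 \<le> (x0 - crv s0) \<bullet> nrm s0"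
      using continuous_attains_sup[OF \<open>compact K\<close> False] by blast
    define \<eta> where "\<eta> = - ((x0 - crv s0) \<bullet> nrm s0)"
    have "x0 \<in> closure S" "x0 \<noteq> crv s0" using x0 assms by (auto simp: K_def)
    then have "0 < \<eta>" using support_unique[of x0] by (simp add: \<eta>_def)
    moreover have "dist x (crv s0) < \<delta>" if "x \<in> closure S" "- \<eta> < (x - crv s0) \<bullet> nrm s0" for x
    proof (rule ccontr)
      assume "\<not> dist x (crv s0) < \<delta>"
      then have "x \<in> K" using that by (simp add: K_def dist_commute)
      from max[OF this] that(2) show False by (simp add: \<eta>_def)
    qed
    ultimately show ?thesis by blast
  qed
qed

definition dirw :: "real^2" where "dirw = nrm s0 /\<^sub>R norm (nrm s0)"
definition dirt :: "real^2" where "dirt = (e1 + g1 s0 *\<^sub>R e2) /\<^sub>R norm (nrm s0)"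
text \<open>Height of the supporting line at \<open>crv s0\<close> above the centre: the support
  function h in direction \<open>dirw\<close>, and later the half length of the shadow.\<close>

definition width :: real where "width = (crv s0 - z) \<bullet> dirw"

lemma slices: "convex_slices S z dirw dirt"
proof
  have "(norm (e1 + g1 s0 *\<^sub>R e2))\<^sup>2 = 1 + (g1 s0)\<^sup>2"
    unfolding power2_norm_eq_inner by (simp add: inner_add_left inner_add_right power2_eq_square)
  with norm_nrm[of s0] have "norm (e1 + g1 s0 *\<^sub>R e2) = norm (nrm s0)"
    by (metis norm_ge_zero power2_eq_imp_eq)
  then show "norm dirt = 1" using nrm_nz[of s0] by (simp add: dirt_def)
  show "norm dirw = 1" using nrm_nz[of s0] by (simp add: dirw_def)
  show "dirw \<bullet> dirt = 0" by (simp add: dirw_def dirt_def nrm_def inner_diff_left inner_add_right)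
qed (use open_S convex_S bounded_S z_in normals in auto)

lemma width_pos: "0 < width"
  using support_crv_strict[OF z_in] nrm_nz[of s0]
  by (simp add: width_def dirw_def inner_diff_left zero_less_mult_iff zero_less_divide_iff)

text \<open>The arc length factor of one arc times \<open>sqrt (width - s)\<close>, in terms of the
  chart parameter: the factor is the reciprocal of the normal's component along the slice, and
  \<open>width - s\<close> is \<open>gap \<sigma> / norm (nrm s0)\<close>.\<close>

definition rate :: "real \<Rightarrow> real" where
  "rate \<sigma> = norm (nrm \<sigma>) * norm (nrm s0) / \<bar>g1 s0 - g1 \<sigma>\<bar> * sqrt (gap \<sigma> / norm (nrm s0))"

text \<open>This is 1 / sqrt (2 k), where k = - g2 s0 / norm (nrm s0)^3 is the curvature of the
  boundary at the tip.\<close>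

definition rate0 :: real where
  "rate0 = norm (nrm s0) * norm (nrm s0) / (- g2 s0) * sqrt ((- g2 s0 / 2) / norm (nrm s0))"

lemma rate0_pos: "0 < rate0"
  unfolding rate0_def using neg nrm_nz[of s0]
  by (intro mult_pos_pos divide_pos_pos real_sqrt_gt_zero) simp_all

lemma nrm_lim: "(nrm \<longlongrightarrow> nrm s0) (at s0)"
proof -
  have "isCont g1 s0" using g1_deriv[OF s0_range] by (rule DERIV_isCont)
  then show ?thesis unfolding nrm_def isCont_def by (intro tendsto_intros)
qed

lemma rate_lim: "(rate \<longlongrightarrow> rate0) (at s0)"
proof -
  \<comment> \<open>Dividing the slope difference by \<open>\<sigma> - s0\<close> and the gap by its
    square leaves the product unchanged, and each factor now has a finite limit, that of the slope
    quotient being nonzero.\<close>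
  have "((\<lambda>\<sigma>. norm (nrm \<sigma>) * norm (nrm s0) / \<bar>(g1 s0 - g1 \<sigma>) / (\<sigma> - s0)\<bar>
      * sqrt ((gap \<sigma> / (\<sigma> - s0)\<^sup>2) / norm (nrm s0))) \<longlongrightarrow>
      norm (nrm s0) * norm (nrm s0) / \<bar>- g2 s0\<bar> * sqrt ((- g2 s0 / 2) / norm (nrm s0))) (at s0)"
    using neg nrm_nz[of s0] by (intro tendsto_intros nrm_lim slope_lim gap_lim) auto
  then have lim: "((\<lambda>\<sigma>. norm (nrm \<sigma>) * norm (nrm s0) / \<bar>(g1 s0 - g1 \<sigma>) / (\<sigma> - s0)\<bar>
      * sqrt ((gap \<sigma> / (\<sigma> - s0)\<^sup>2) / norm (nrm s0))) \<longlongrightarrow> rate0) (at s0)"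
    using neg by (simp add: rate0_def)
  have "\<forall>\<^sub>F \<sigma> in at s0. norm (nrm \<sigma>) * norm (nrm s0) / \<bar>(g1 s0 - g1 \<sigma>) / (\<sigma> - s0)\<bar>
      * sqrt ((gap \<sigma> / (\<sigma> - s0)\<^sup>2) / norm (nrm s0)) = rate \<sigma>"
    using eventually_neq_at_within[of s0 s0 UNIV]
  proof eventually_elim
    case (elim \<sigma>)
    have "sqrt ((gap \<sigma> / (\<sigma> - s0)\<^sup>2) / norm (nrm s0)) = sqrt (gap \<sigma> / norm (nrm s0)) / \<bar>\<sigma> - s0\<bar>"
      by (simp add: real_sqrt_divide real_sqrt_mult mult.commute)
    then show ?case using elim by (simp add: rate_def abs_divide)
  qed
  from Lim_transform_eventually[OF lim this] show ?thesis .
qed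

lemma coord_minus_width: "(x - z) \<bullet> dirw - width = ((x - crv s0) \<bullet> nrm s0) / norm (nrm s0)"
proof -
  have "(x - z) \<bullet> dirw - width = (x - crv s0) \<bullet> dirw"
    by (simp add: width_def inner_diff_left)
  then show ?thesis by (simp add: dirw_def divide_inverse mult.commute)
qed

lemma near_tip:
  assumes "0 < \<delta>"
  shows "\<exists>\<eta>>0. \<forall>x\<in>closure S. width - \<eta> < (x - z) \<bullet> dirw \<longrightarrow> dist x (crv s0) < \<delta>"
proof -
  obtain \<eta> where "0 < \<eta>" and \<eta>: "\<And>x. x \<in> closure S \<Longrightarrow> - \<eta> < (x - crv s0) \<bullet> nrm s0 \<Longrightarrow> dist x (crv s0) < \<delta>"
    using cap_shrinks[OF assms] by blast
  show ?thesis
  proof (intro exI conjI ballI impI)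
    show "0 < \<eta> / norm (nrm s0)" using \<open>0 < \<eta>\<close> nrm_nz[of s0] by simp
    fix x assume x: "x \<in> closure S" and "width - \<eta> / norm (nrm s0) < (x - z) \<bullet> dirw"
    then have "(- \<eta>) / norm (nrm s0) < ((x - crv s0) \<bullet> nrm s0) / norm (nrm s0)"
      using coord_minus_width[of x] by simp
    then show "dist x (crv s0) < \<delta>"
      using \<eta>[OF x] nrm_nz[of s0] by (simp only: divide_less_cancel)
  qed
qed

text \<open>Applied with \<open>\<theta> = dirt\<close> to the upper and with \<open>\<theta> = - dirt\<close> to the lower boundary arc.\<close>
lemma tip_asymptotics:
  assumes \<theta>: "\<theta> = dirt \<or> \<theta> = - dirt" and "convex_slices S z dirw \<theta>"
    and shadow: "{0<..<width} \<subseteq> convex_slices.shadow S z dirw \<theta>"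
  shows "((\<lambda>s. sqrt (1 + (deriv (convex_slices.upper S z dirw \<theta>) s)\<^sup>2) * sqrt (width - s)) \<longlongrightarrow> rate0) (at_left width)"
    and "\<forall>\<^sub>F s in at_left width. deriv (convex_slices.upper S z dirw \<theta>) s < 0"
    and "((\<lambda>s. z + s *\<^sub>R dirw + convex_slices.upper S z dirw \<theta> s *\<^sub>R \<theta>) \<longlongrightarrow> crv s0) (at_left width)"
proof -
  interpret c: convex_slices S z dirw \<theta> by fact
  define P where "P = (\<lambda>s. c.pt s (c.upper s))"
  define \<sigma> where "\<sigma> = (\<lambda>s. (P s - p) \<bullet> e1)"
  have ev_sh: "\<forall>\<^sub>F s in at_left width. s \<in> c.shadow"
    using width_pos shadow unfolding eventually_at_left_field by (intro exI[of _ 0]) auto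
  have Pcl: "P s \<in> frontier S" if "s \<in> c.shadow" for s
    unfolding P_def by (rule c.upper_frontier[OF that])
  have Pw: "(P s - z) \<bullet> dirw = s" for s
    by (simp add: P_def c.pt_def inner_add_left)
  have Plim: "(P \<longlongrightarrow> crv s0) (at_left width)"
  proof (rule tendstoI)
    fix \<delta> :: real assume "0 < \<delta>"
    then obtain \<eta> where "0 < \<eta>" and \<eta>: "\<And>x. x \<in> closure S \<Longrightarrow> width - \<eta> < (x - z) \<bullet> dirw \<Longrightarrow> dist x (crv s0) < \<delta>"
      using near_tip by blast
    have "\<forall>\<^sub>F s in at_left width. width - \<eta> < s"
      using \<open>0 < \<eta>\<close> unfolding eventually_at_left_field by (intro exI[of _ "width - \<eta>"]) auto
    with ev_sh show "\<forall>\<^sub>F s in at_left width. dist (P s) (crv s0) < \<delta>"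
      by eventually_elim (use \<eta> Pcl Pw in \<open>auto simp: frontier_def\<close>)
  qed
  then show "((\<lambda>s. z + s *\<^sub>R dirw + c.upper s *\<^sub>R \<theta>) \<longlongrightarrow> crv s0) (at_left width)"
    by (simp add: P_def c.pt_def)
  have ball: "\<forall>\<^sub>F s in at_left width. P s \<in> ball p r"
    using Plim in_ball by (intro topological_tendstoD) auto
  have lt: "\<forall>\<^sub>F s in at_left width. s < width"
    by (simp add: eventually_at_filter)
  have "(\<sigma> \<longlongrightarrow> (crv s0 - p) \<bullet> e1) (at_left width)"
    unfolding \<sigma>_def by (intro tendsto_intros Plim)
  then have "(\<sigma> \<longlongrightarrow> s0) (at_left width)" by (simp add: crv_coords)
  moreover have "\<forall>\<^sub>F s in at_left width. \<sigma> s \<noteq> s0"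
    using ball ev_sh lt
  proof eventually_elim
    case (elim s)
    have "P s = crv (\<sigma> s)"
      unfolding \<sigma>_def using elim by (intro crv_eqI frontier_on_graph Pcl)
    then show ?case using Pw[of s] elim(3) by (auto simp: width_def)
  qed
  ultimately have \<sigma>lim: "filterlim \<sigma> (at s0) (at_left width)"
    by (simp add: filterlim_at)
  have "((\<lambda>\<sigma>. nrm \<sigma> \<bullet> nrm s0) \<longlongrightarrow> nrm s0 \<bullet> nrm s0) (at s0)"
    by (intro tendsto_intros nrm_lim)
  moreover have "0 < nrm s0 \<bullet> nrm s0" using nrm_nz[of s0] by simp
  ultimately have "\<forall>\<^sub>F \<sigma> in at s0. 0 < nrm \<sigma> \<bullet> nrm s0"
    by (rule order_tendstoD(1))
  from eventually_compose_filterlim[OF this \<sigma>lim]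
  have npos: "\<forall>\<^sub>F s in at_left width. 0 < nrm (\<sigma> s) \<bullet> nrm s0" .
  have normal: "outer_normal S (c.pt s (c.upper s)) (nrm (\<sigma> s) /\<^sub>R norm (nrm (\<sigma> s)))"
    if "P s \<in> ball p r" "s \<in> c.shadow" for s
    using graph_outer_normal[OF that(1) _ frontier_on_graph[OF that(1) Pcl[OF that(2)]]]
    by (simp add: \<sigma>_def P_def)
  show "\<forall>\<^sub>F s in at_left width. deriv c.upper s < 0"
    using ball ev_sh npos
  proof eventually_elim
    case (elim s)
    note n = normal[OF elim(1,2)]
    have "0 < (nrm (\<sigma> s) /\<^sub>R norm (nrm (\<sigma> s))) \<bullet> dirw"
      using elim(3) nrm_nz by (simp add: dirw_def)
    then show ?case
      unfolding c.deriv_upper[OF elim(2) n]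
      by (intro divide_neg_pos c.normal_pos[OF elim(2) n]) (simp only: neg_less_0_iff_less)
  qed
  have "\<forall>\<^sub>F s in at_left width. rate (\<sigma> s) = sqrt (1 + (deriv c.upper s)\<^sup>2) * sqrt (width - s)"
    using ball ev_sh
  proof eventually_elim
    case (elim s)
    note n = normal[OF elim]
    have "nrm (\<sigma> s) \<bullet> dirt = (g1 s0 - g1 (\<sigma> s)) / norm (nrm s0)"
      by (simp add: nrm_def dirt_def inner_diff_left inner_add_right divide_inverse mult.commute)
    \<comment> \<open>On either side of the tip only the modulus is known; the sign follows from
      \<open>normal_pos\<close>, which lets one argument serve both arcs.\<close>
    then have "\<bar>nrm (\<sigma> s) \<bullet> \<theta>\<bar> = \<bar>g1 s0 - g1 (\<sigma> s)\<bar> / norm (nrm s0)"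
      using \<theta> nrm_nz[of s0] by (auto simp: abs_divide)
    moreover have "0 < (nrm (\<sigma> s) /\<^sub>R norm (nrm (\<sigma> s))) \<bullet> \<theta>"
      by (rule c.normal_pos[OF elim(2) n])
    then have "0 < nrm (\<sigma> s) \<bullet> \<theta>" using nrm_nz[of "\<sigma> s"] by (simp add: zero_less_mult_iff zero_less_divide_iff)
    ultimately have "nrm (\<sigma> s) \<bullet> \<theta> = \<bar>g1 s0 - g1 (\<sigma> s)\<bar> / norm (nrm s0)" by simp
    then have 1: "sqrt (1 + (deriv c.upper s)\<^sup>2) = norm (nrm (\<sigma> s)) * norm (nrm s0) / \<bar>g1 s0 - g1 (\<sigma> s)\<bar>"
      unfolding c.sqrt_deriv_upper[OF elim(2) n] using nrm_nz[of "\<sigma> s"] by (simp add: field_simps)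
    have "s - width = ((P s - crv s0) \<bullet> nrm s0) / norm (nrm s0)"
      using coord_minus_width[of "P s"] unfolding Pw .
    moreover have "(crv s0 - P s) \<bullet> nrm s0 = gap (\<sigma> s)"
      unfolding \<sigma>_def by (rule gap_eq[OF elim(1) frontier_on_graph[OF elim(1) Pcl[OF elim(2)]]])
    ultimately have "width - s = gap (\<sigma> s) / norm (nrm s0)"
      by (simp add: inner_diff_left field_simps)
    then show ?case unfolding rate_def 1 by simp
  qed
  with filterlim_compose[OF rate_lim \<sigma>lim]
  show "((\<lambda>s. sqrt (1 + (deriv c.upper s)\<^sup>2) * sqrt (width - s)) \<longlongrightarrow> rate0) (at_left width)"
    by (rule Lim_transform_eventually)
qed

end

end

section \<open>Both arcs at the tip, and the resulting Fresnel bound\<close>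

context centred_chart
begin

text \<open>Strict support at the tip gives \<open>thin\<close>. The two arcs meet there with the
  same asymptotics, hence the factor 2 in the limit.\<close>

lemma symmetric_slices_tip:
  assumes in_ball: "crv s0 \<in> ball p r" and neg: "g2 s0 < 0"
  shows "symmetric_slices S z (dirw s0) (dirt s0) (width s0)"
    and "((\<lambda>s. symmetric_slices.profile S z (dirw s0) (dirt s0) s * sqrt (width s0 - s)) \<longlongrightarrow> 2 * rate0 s0) (at_left (width s0))"
proof -
  define w t a where "w = dirw s0" and "t = dirt s0" and "a = width s0"
  interpret c: convex_slices S z w t
    unfolding w_def t_def by (rule slices[OF in_ball neg])
  have neg_slices: "convex_slices S z w (- t)" by (rule c.reflect)
  have "0 < a" unfolding a_def by (rule width_pos[OF in_ball neg])
  have pt_w: "(c.pt s y - z) \<bullet> w = s" for s y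
    by (simp add: c.pt_def inner_add_left)
  have minus: "- s \<in> c.shadow" if s: "s \<in> c.shadow" for s
  proof -
    obtain y where "c.pt s y \<in> S" using s by (auto simp: c.shadow_def)
    from symm[OF this] have "c.pt (- s) (- y) \<in> S"
      by (simp add: c.pt_def scaleR_2 algebra_simps)
    then show ?thesis by (auto simp: c.shadow_def)
  qed
  have lt: "s < a" if s: "s \<in> c.shadow" for s
  proof -
    obtain y where y: "c.pt s y \<in> S" using s by (auto simp: c.shadow_def)
    have "(c.pt s y - z) \<bullet> w - a = ((c.pt s y - crv s0) \<bullet> nrm s0) / norm (nrm s0)"
      unfolding w_def a_def by (rule coord_minus_width[OF in_ball neg])
    also have "\<dots> < 0"
      by (intro divide_neg_pos support_crv_strict[OF in_ball neg y] nrm_nz)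
    finally show ?thesis unfolding pt_w by simp
  qed
  have shadow: "c.shadow = {-a<..<a}"
  proof (intro equalityI subsetI)
    fix s assume "s \<in> c.shadow"
    then show "s \<in> {-a<..<a}" using lt[of s] lt[OF minus, of s] by auto
  next
    fix s assume "s \<in> {-a<..<a}"
    \<comment> \<open>A point of \<open>S\<close> within \<open>a - \<bar>s\<bar>\<close> of the tip
      has height \<open>q\<close> above \<open>\<bar>s\<bar>\<close>; together with the mirrored
      height and convexity of the shadow this captures \<open>s\<close>.\<close>
    then have "0 < a - \<bar>s\<bar>" by auto
    moreover have "crv s0 \<in> closure S" using crv_frontier[OF in_ball] by (simp add: frontier_def)
    ultimately obtain x where x: "x \<in> S" "dist x (crv s0) < a - \<bar>s\<bar>"
      by (meson closure_approachable)
    define q where "q = (x - z) \<bullet> w"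
    have "a - q = (crv s0 - x) \<bullet> w"
      by (simp add: a_def q_def width_def[OF in_ball neg] w_def inner_diff_left)
    also have "\<dots> \<le> norm (crv s0 - x) * norm w" by (rule norm_cauchy_schwarz)
    also have "\<dots> < a - \<bar>s\<bar>" using x(2) c.norm_w by (simp add: dist_norm norm_minus_commute)
    finally have "\<bar>s\<bar> < q" by simp
    have "c.pt q ((x - z) \<bullet> t) \<in> S" using x(1) unfolding q_def c.pt_coords[of x, symmetric] .
    then have "q \<in> c.shadow" by (auto simp: c.shadow_def)
    then have "closed_segment (- q) q \<subseteq> c.shadow"
      using minus by (intro closed_segment_subset c.convex_shadow) auto
    then show "s \<in> c.shadow"
      using \<open>\<bar>s\<bar> < q\<close> by (auto simp: closed_segment_eq_real_ivl subset_iff abs_less_iff)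
  qed
  have sh: "{0<..<a} \<subseteq> c.shadow" "{0<..<a} \<subseteq> convex_slices.shadow S z w (- t)"
    using \<open>0 < a\<close> by (auto simp: c.reflect_eqs shadow)
  have t_cases: "t = dirt s0 \<or> t = - dirt s0" "- t = dirt s0 \<or> - t = - dirt s0"
    by (auto simp: t_def)
  note up = tip_asymptotics[OF in_ball neg t_cases(1), folded w_def a_def, OF c.convex_slices_axioms sh(1)]
  note lo = tip_asymptotics[OF in_ball neg t_cases(2), folded w_def a_def, OF neg_slices sh(2), unfolded c.reflect_eqs]
  have sym: "symmetric_slices S z w t a"
  proof
    have "((\<lambda>s. ((z + s *\<^sub>R w + c.upper s *\<^sub>R t) - (z + s *\<^sub>R w + - c.lower s *\<^sub>R - t)) \<bullet> t) \<longlongrightarrow>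
        (crv s0 - crv s0) \<bullet> t) (at_left a)"
      by (intro tendsto_inner tendsto_diff up(3) lo(3) tendsto_const)
    then show "((\<lambda>s. c.upper s - c.lower s) \<longlongrightarrow> 0) (at_left a)"
      by (simp add: inner_diff_left)
  qed (use \<open>0 < a\<close> shadow symm in auto)
  then show "symmetric_slices S z (dirw s0) (dirt s0) (width s0)"
    by (simp add: w_def t_def a_def)
  interpret y: symmetric_slices S z w t a by (rule sym)
  have ev: "\<forall>\<^sub>F s in at_left a. s \<in> c.shadow"
    using \<open>0 < a\<close> unfolding shadow eventually_at_left_field by (intro exI[of _ 0]) auto
  have "\<forall>\<^sub>F s in at_left a. sqrt (1 + (deriv c.upper s)\<^sup>2) * sqrt (a - s)
      + sqrt (1 + (deriv (\<lambda>s. - c.lower s) s)\<^sup>2) * sqrt (a - s) = y.profile s * sqrt (a - s)"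
    using ev up(2) lo(2)
  proof eventually_elim
    case (elim s)
    have d: "deriv (\<lambda>s. - c.lower s) s = - deriv c.lower s"
      using c.lower_deriv(3)[OF elim(1)] unfolding c.lower_deriv(2)[OF elim(1)] .
    \<comment> \<open>Close to the tip the upper arc falls and the lower one rises, so the
      truncations in \<open>profile\<close> change nothing.\<close>
    have "min (deriv c.upper s) 0 = deriv c.upper s" "max (deriv c.lower s) 0 = deriv c.lower s"
      using elim(2,3) unfolding d by simp_all
    then show ?case
      unfolding d by (simp add: y.profile_def y.hyp_def distrib_right)
  qed
  from Lim_transform_eventually[OF tendsto_add[OF up(1) lo(1)] this]
  show "((\<lambda>s. symmetric_slices.profile S z (dirw s0) (dirt s0) s * sqrt (width s0 - s)) \<longlongrightarrow> 2 * rate0 s0) (at_left (width s0))"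
    by (simp add: w_def t_def a_def)
qed

end

text \<open>As a combination of cosine and sine of the phase \<open>x\<close>, the truncated
  integral is visibly continuous and periodic, and at pi/2 only the sine integral remains.\<close>

lemma fresnel_eq:
  fixes x Y :: real
  assumes "0 \<le> Y"
  shows "integral {0..Y} (\<lambda>y. 2 * cos (x - y\<^sup>2))
    = 2 * (cos x * integral {0..Y} (\<lambda>y. cos (y\<^sup>2)) + sin x * integral {0..Y} (\<lambda>y. sin (y\<^sup>2)))"
proof -
  have int: "(\<lambda>y. cos (y\<^sup>2)) integrable_on {0..Y}" "(\<lambda>y. sin (y\<^sup>2)) integrable_on {0..Y}"
    by (intro integrable_continuous_real continuous_intros)+
  have "((\<lambda>y. 2 * (cos x * cos (y\<^sup>2) + sin x * sin (y\<^sup>2))) has_integral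
      2 * (cos x * integral {0..Y} (\<lambda>y. cos (y\<^sup>2)) + sin x * integral {0..Y} (\<lambda>y. sin (y\<^sup>2)))) {0..Y}"
    by (intro has_integral_mult_right has_integral_add integrable_integral int)
  then show ?thesis by (intro integral_unique) (simp add: cos_diff)
qed

text \<open>The threshold \<open>l0\<close> depends on \<open>s0\<close>; uniformity is never
  claimed and is replaced by \<open>periodic_bound_of_eventual_dilates\<close>.\<close>

lemma (in centred_chart) fresnel_bound:
  assumes in_ball: "crv s0 \<in> ball p r" and neg: "g2 s0 < 0" and "1 \<le> M"
  shows "\<exists>l0>0. \<forall>l>l0. (\<exists>c u. overdetermined_solution S (l\<^sup>2) c u \<and> (\<exists>x\<in>S. u x \<noteq> 0)) \<longrightarrow>
    \<bar>integral {0..sqrt M} (\<lambda>y. 2 * cos (l * width s0 - y\<^sup>2))\<bar> \<le> 12 / sqrt M"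
proof -
  interpret y: symmetric_slices S z "dirw s0" "dirt s0" "width s0"
    by (rule symmetric_slices_tip[OF in_ball neg])
  have "0 < 2 * rate0 s0" using rate0_pos[OF in_ball neg] by simp
  from oscillatory_endpoint_bound[OF y.a_pos y.profile_mono less_imp_le[OF y.profile_pos]
      symmetric_slices_tip(2)[OF in_ball neg] this \<open>1 \<le> M\<close>]
  obtain l0 where "0 < l0" and l0: "\<And>l. l0 < l \<Longrightarrow>
     ((\<lambda>b. integral {-b..b} (\<lambda>s. y.profile s * cos (l * s)) - 2 * sin (l * b) / l) \<longlongrightarrow> 0) (at_left (width s0)) \<Longrightarrow>
     \<bar>integral {0..sqrt M} (\<lambda>z. 2 * cos (l * width s0 - z\<^sup>2))\<bar> \<le> 12 / sqrt M"
    by blast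
  show ?thesis
  proof (intro exI conjI allI impI)
    show "0 < l0" by fact
    fix l assume l: "l0 < l" and "\<exists>c u. overdetermined_solution S (l\<^sup>2) c u \<and> (\<exists>x\<in>S. u x \<noteq> 0)"
    then obtain c u where sol: "overdetermined_solution S (l\<^sup>2) c u" "\<exists>x\<in>S. u x \<noteq> 0" by blast
    have "0 < l" using l \<open>0 < l0\<close> by simp
    then have "0 < l\<^sup>2" "sqrt (l\<^sup>2) = l" by auto
    from l0[OF l] y.overdetermined_profile_limit[OF sol(1) this(1) sol(2), unfolded this(2)]
    show "\<bar>integral {0..sqrt M} (\<lambda>z. 2 * cos (l * width s0 - z\<^sup>2))\<bar> \<le> 12 / sqrt M" by blast
  qed
qed

section \<open>Distance to the centre and support function along a chart\<close>

context centred_chart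
begin

text \<open>Half the derivative of the squared distance to \<open>z\<close> along the chart.\<close>

definition rad_deriv :: "real \<Rightarrow> real" where "rad_deriv \<sigma> = (crv \<sigma> - z) \<bullet> e1 + g1 \<sigma> * ((crv \<sigma> - z) \<bullet> e2)"

lemma crv_z: "(crv \<sigma> - z) \<bullet> e1 = (p - z) \<bullet> e1 + \<sigma>" "(crv \<sigma> - z) \<bullet> e2 = (p - z) \<bullet> e2 + g \<sigma>"
  by (simp_all add: crv_def inner_diff_left inner_add_left)

lemma norm_crv_has_derivative:
  assumes "\<sigma> \<in> {-r<..<r}"
  shows "((\<lambda>\<sigma>. (norm (crv \<sigma> - z))\<^sup>2) has_real_derivative 2 * rad_deriv \<sigma>) (at \<sigma>)"
proof -
  have eq: "(norm (crv \<sigma> - z))\<^sup>2 = ((p - z) \<bullet> e1 + \<sigma>)\<^sup>2 + ((p - z) \<bullet> e2 + g \<sigma>)\<^sup>2" for \<sigma>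
  proof -
    have "(norm (crv \<sigma> - z))\<^sup>2 = (crv \<sigma> - z) \<bullet> (((crv \<sigma> - z) \<bullet> e1) *\<^sub>R e1 + ((crv \<sigma> - z) \<bullet> e2) *\<^sub>R e2)"
      by (metis orthonormal_expansion[OF norm_e1 norm_e2 orth] power2_norm_eq_inner)
    then show ?thesis by (simp add: inner_add_right crv_z power2_eq_square)
  qed
  show ?thesis
    unfolding eq rad_deriv_def crv_z
    by (rule derivative_eq_intros g_deriv[OF assms] refl | simp)+
qed

lemma rad_deriv_has_derivative:
  assumes "\<sigma> \<in> {-r<..<r}"
  shows "(rad_deriv has_real_derivative 1 + g2 \<sigma> * ((crv \<sigma> - z) \<bullet> e2) + (g1 \<sigma>)\<^sup>2) (at \<sigma>)"
  unfolding rad_deriv_def crv_z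
  by (rule derivative_eq_intros g_deriv[OF assms] g1_deriv[OF assms] refl | simp add: power2_eq_square)+

text \<open>The same number as \<open>width\<close>, but defined without a curvature hypothesis, so
  that it can be differentiated along the whole chart.\<close>

definition support :: "real \<Rightarrow> real" where "support \<sigma> = (crv \<sigma> - z) \<bullet> nrm \<sigma> / norm (nrm \<sigma>)"

text \<open>Turning the normal changes the support function only through the tangential component of
  the position. Where \<open>g2\<close> is nonzero, \<open>support\<close> and the distance to
  \<open>z\<close> therefore have the same critical points.\<close>

lemma support_has_derivative:
  assumes "\<sigma> \<in> {-r<..<r}"
  shows "(support has_real_derivative - (g2 \<sigma> * rad_deriv \<sigma>) / norm (nrm \<sigma>) ^ 3) (at \<sigma>)"
proof -
  define n where "n = (\<lambda>\<sigma>. (p - z) \<bullet> e2 + g \<sigma> - g1 \<sigma> * ((p - z) \<bullet> e1 + \<sigma>))"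
  define m where "m = (\<lambda>\<sigma>. sqrt (1 + (g1 \<sigma>)\<^sup>2))"
  have m_eq: "norm (nrm \<sigma>) = m \<sigma>" for \<sigma>
    unfolding m_def norm_nrm[symmetric] by simp
  have n_eq: "(crv \<sigma> - z) \<bullet> nrm \<sigma> = n \<sigma>" for \<sigma>
    unfolding nrm_def inner_diff_right inner_scaleR_right crv_z n_def by simp
  have m_pos: "0 < m \<sigma>" using nrm_nz[of \<sigma>] by (simp only: m_eq)
  have m2: "m \<sigma> * m \<sigma> = 1 + (g1 \<sigma>)\<^sup>2" by (simp add: m_def)
  have dn: "(n has_real_derivative - g2 \<sigma> * ((p - z) \<bullet> e1 + \<sigma>)) (at \<sigma>)"
    unfolding n_def by (rule derivative_eq_intros g_deriv[OF assms] g1_deriv[OF assms] refl | simp)+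
  have "((\<lambda>\<sigma>. 1 + (g1 \<sigma>)\<^sup>2) has_real_derivative 2 * g1 \<sigma> * g2 \<sigma>) (at \<sigma>)"
    by (rule derivative_eq_intros g1_deriv[OF assms] refl | simp)+
  from DERIV_chain2[OF DERIV_real_sqrt this]
  have dm: "(m has_real_derivative g1 \<sigma> * g2 \<sigma> / m \<sigma>) (at \<sigma>)"
    unfolding m_def by (simp add: add_pos_nonneg field_simps)
  have "(support has_real_derivative
      (- g2 \<sigma> * ((p - z) \<bullet> e1 + \<sigma>) * m \<sigma> - n \<sigma> * (g1 \<sigma> * g2 \<sigma> / m \<sigma>)) / (m \<sigma> * m \<sigma>)) (at \<sigma>)"
    unfolding support_def[abs_def] m_eq n_eq
    using DERIV_divide[OF dn dm] m_pos by simp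
  moreover have "(- g2 \<sigma> * ((p - z) \<bullet> e1 + \<sigma>) * m \<sigma> - n \<sigma> * (g1 \<sigma> * g2 \<sigma> / m \<sigma>)) / (m \<sigma> * m \<sigma>)
      = - (g2 \<sigma> * rad_deriv \<sigma>) / m \<sigma> ^ 3"
  proof -
    have "(- g2 \<sigma> * ((p - z) \<bullet> e1 + \<sigma>) * m \<sigma> - n \<sigma> * (g1 \<sigma> * g2 \<sigma> / m \<sigma>)) / (m \<sigma> * m \<sigma>)
      = (- g2 \<sigma> * (((p - z) \<bullet> e1 + \<sigma>) * (m \<sigma> * m \<sigma>) + n \<sigma> * g1 \<sigma>)) / m \<sigma> ^ 3"
      using m_pos by (simp add: field_simps power3_eq_cube)
    also have "((p - z) \<bullet> e1 + \<sigma>) * (m \<sigma> * m \<sigma>) + n \<sigma> * g1 \<sigma> = rad_deriv \<sigma>"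
      unfolding m2 n_def rad_deriv_def crv_z by (simp add: algebra_simps power2_eq_square)
    finally show ?thesis by simp
  qed
  ultimately show ?thesis by (simp only: m_eq)
qed

end

section \<open>The farthest boundary point\<close>

context centred_chart
begin

lemma width_eq_support:
  assumes "crv \<sigma> \<in> ball p r" "g2 \<sigma> < 0"
  shows "width \<sigma> = support \<sigma>"
  by (simp add: width_def[OF assms] dirw_def[OF assms] support_def divide_inverse mult.commute)

text \<open>The second derivative test at the maximum of the distance makes
  \<open>g2 0 * ((p - z) \<bullet> e2)\<close> negative. The other factor is positive:
  \<open>p - z\<close> is normal to the boundary there and, by strict support at \<open>z\<close>,
  points outwards.\<close>

lemma farthest_point_curvature:
  assumes far: "\<And>x. x \<in> closure S \<Longrightarrow> norm (x - z) \<le> norm (p - z)"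
  shows "g2 0 < 0"
proof -
  obtain \<rho> where \<rho>: "0 < \<rho>" "\<rho> \<le> r" "\<And>\<sigma>. \<bar>\<sigma>\<bar> < \<rho> \<Longrightarrow> crv \<sigma> \<in> ball p r"
    using crv_near by blast
  have crv0: "crv 0 = p" by (simp add: crv_def g_0)
  have le: "(norm (crv \<sigma> - z))\<^sup>2 \<le> (norm (crv 0 - z))\<^sup>2" if "\<bar>\<sigma>\<bar> < \<rho>" for \<sigma>
    using far[of "crv \<sigma>"] crv_frontier[OF \<rho>(3)[OF that]] unfolding crv0 by (auto simp: frontier_def intro: power_mono)
  have r0: "0 \<in> {-r<..<r}" using r by simp
  have "2 * rad_deriv 0 = 0"
    using DERIV_local_max[OF norm_crv_has_derivative[OF r0] \<rho>(1)] le by simp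
  then have rd0: "rad_deriv 0 = 0" by simp
  have "1 + g2 0 * ((crv 0 - z) \<bullet> e2) + (g1 0)\<^sup>2 \<le> 0"
  proof (rule ccontr)
    assume "\<not> ?thesis"
    \<comment> \<open>\<open>rad_deriv\<close> vanishes at 0, so with positive slope it would be
      positive just to the right and the distance would grow beyond its maximum.\<close>
    then obtain d where "0 < d" and d: "\<And>h. 0 < h \<Longrightarrow> h < d \<Longrightarrow> rad_deriv 0 < rad_deriv (0 + h)"
      using DERIV_pos_inc_right[OF rad_deriv_has_derivative[OF r0]] by auto
    define h where "h = min d \<rho> / 2"
    have h: "0 < h" "h < d" "h < \<rho>" using \<open>0 < d\<close> \<rho>(1) by (auto simp: h_def)
    have "(norm (crv 0 - z))\<^sup>2 < (norm (crv h - z))\<^sup>2"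
    proof (rule DERIV_pos_imp_increasing_open[OF h(1)])
      fix x assume x: "0 < x" "x < h"
      then have "x \<in> {-r<..<r}" using h \<rho>(2) by auto
      then show "\<exists>y. ((\<lambda>\<sigma>. (norm (crv \<sigma> - z))\<^sup>2) has_real_derivative y) (at x) \<and> 0 < y"
        using norm_crv_has_derivative d[of x] x h rd0 by (intro exI[of _ "2 * rad_deriv x"]) auto
    next
      have "x \<in> {-r<..<r}" if "x \<in> {0..h}" for x using that h \<rho>(2) by auto
      then show "continuous_on {0..h} (\<lambda>\<sigma>. (norm (crv \<sigma> - z))\<^sup>2)"
        by (intro continuous_at_imp_continuous_on ballI DERIV_isCont[OF norm_crv_has_derivative]) auto
    qed
    moreover have "\<bar>h\<bar> < \<rho>" using h by simp
    ultimately show False using le[of h] by linarith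
  qed
  then have neg: "g2 0 * ((p - z) \<bullet> e2) < 0"
    unfolding crv0 by (smt (verit) zero_le_power2)
  have p0: "p \<in> ball p r" using r by simp
  have "(z - p) \<bullet> (nrm 0 /\<^sub>R norm (nrm 0)) < 0"
    using outer_normal_support_strict[OF open_S convex_S _ crv_outer_normal[of 0] z_in] p p0
    unfolding crv0 by (simp add: frontier_def)
  then have "0 < (p - z) \<bullet> nrm 0"
    using nrm_nz[of 0] by (simp add: inner_diff_left mult_less_0_iff divide_less_0_iff zero_less_mult_iff)
  then have "0 < (p - z) \<bullet> e2 - g1 0 * ((p - z) \<bullet> e1)"
    by (simp add: nrm_def inner_diff_right)
  moreover have "(p - z) \<bullet> e1 = - g1 0 * ((p - z) \<bullet> e2)"
    using rd0 unfolding rad_deriv_def crv0 by simp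
  moreover have "x - a * (- a * x) = x * (1 + a * a)" for x a :: real
    by (simp add: algebra_simps)
  ultimately have "0 < (p - z) \<bullet> e2 * (1 + g1 0 * g1 0)"
    by (simp only:)
  moreover have "0 < 1 + g1 0 * g1 0"
    by (simp add: add_pos_nonneg)
  ultimately have "0 < (p - z) \<bullet> e2"
    by (simp add: zero_less_mult_iff)
  then show ?thesis using neg by (simp add: mult_less_0_iff)
qed

text \<open>If \<open>support\<close> were constant near the farthest point,
  \<open>rad_deriv\<close> would vanish because \<open>g2\<close> is nonzero there, and the boundary
  would be a circular arc about \<open>z\<close>, contrary to \<open>near\<close>. A nonconstant
  continuous function on an interval takes an interval of values.\<close>

lemma support_interval:
  assumes far: "\<And>x. x \<in> closure S \<Longrightarrow> norm (x - z) \<le> norm (p - z)"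
    and near: "\<And>e. 0 < e \<Longrightarrow> \<exists>q\<in>frontier S. dist q p < e \<and> norm (q - z) \<noteq> norm (p - z)"
  shows "\<exists>t0 t1. t0 < t1 \<and> (\<forall>t\<in>{t0..t1}. \<exists>\<sigma>. crv \<sigma> \<in> ball p r \<and> g2 \<sigma> < 0 \<and> support \<sigma> = t)"
proof -
  obtain \<rho> where \<rho>: "0 < \<rho>" "\<rho> \<le> r" "\<And>\<sigma>. \<bar>\<sigma>\<bar> < \<rho> \<Longrightarrow> crv \<sigma> \<in> ball p r"
    using crv_near by blast
  have crv0: "crv 0 = p" by (simp add: crv_def g_0)
  have "0 \<in> {-r<..<r}" using r by simp
  then have "(g2 \<longlongrightarrow> g2 0) (at 0)"
    using cddg by (simp add: continuous_on_eq_continuous_at isCont_def)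
  then have "\<forall>\<^sub>F \<sigma> in at 0. g2 \<sigma> < 0"
    using farthest_point_curvature[OF far] by (rule order_tendstoD(2))
  then obtain d where "0 < d" and d: "\<And>\<sigma>. \<sigma> \<noteq> 0 \<Longrightarrow> dist \<sigma> 0 < d \<Longrightarrow> g2 \<sigma> < 0"
    unfolding eventually_at by blast
  define e where "e = min d \<rho>"
  have e: "0 < e" "e \<le> \<rho>" "e \<le> d" using \<open>0 < d\<close> \<rho>(1) by (auto simp: e_def)
  define I where "I = {-e<..<e}"
  have I: "\<sigma> \<in> {-r<..<r}" "crv \<sigma> \<in> ball p r" "g2 \<sigma> < 0" if "\<sigma> \<in> I" for \<sigma>
  proof -
    show "\<sigma> \<in> {-r<..<r}" using that e \<rho>(2) by (auto simp: I_def)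
    have "\<bar>\<sigma>\<bar> < e" using that by (auto simp: I_def abs_less_iff)
    then show "crv \<sigma> \<in> ball p r" using \<rho>(3)[of \<sigma>] e by simp
    show "g2 \<sigma> < 0"
      using d[of \<sigma>] farthest_point_curvature[OF far] \<open>\<bar>\<sigma>\<bar> < e\<close> e by (cases "\<sigma> = 0") (auto simp: dist_real_def)
  qed
  have "0 \<in> I" using e by (simp add: I_def)
  have "\<exists>\<sigma>\<in>I. support \<sigma> \<noteq> support 0"
  proof (rule ccontr)
    assume "\<not> ?thesis"
    then have const: "support \<sigma> = support 0" if "\<sigma> \<in> I" for \<sigma> using that by blast
    have rd: "rad_deriv \<sigma> = 0" if \<sigma>: "\<sigma> \<in> I" for \<sigma>
    proof -
      have "\<forall>\<^sub>F x in nhds \<sigma>. x \<in> I"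
        using \<sigma> by (intro eventually_nhds_in_open) (auto simp: I_def)
      then have "\<forall>\<^sub>F x in nhds \<sigma>. support x = support 0"
        by eventually_elim (rule const)
      then have "((\<lambda>x. support 0) has_real_derivative - (g2 \<sigma> * rad_deriv \<sigma>) / norm (nrm \<sigma>) ^ 3) (at \<sigma>)"
        using support_has_derivative[OF I(1)[OF \<sigma>]] by (subst (asm) DERIV_cong_ev[OF refl _ refl])
      then have "- (g2 \<sigma> * rad_deriv \<sigma>) / norm (nrm \<sigma>) ^ 3 = 0"
        using DERIV_unique DERIV_const by blast
      then show ?thesis using I(3)[OF \<sigma>] nrm_nz[of \<sigma>] by auto
    qed
    have "\<exists>k. \<forall>\<sigma>\<in>I. (norm (crv \<sigma> - z))\<^sup>2 = k"
    proof (rule has_field_derivative_zero_constant)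
      show "convex I" by (simp add: I_def)
      fix \<sigma> assume \<sigma>: "\<sigma> \<in> I"
      show "((\<lambda>\<sigma>. (norm (crv \<sigma> - z))\<^sup>2) has_real_derivative 0) (at \<sigma> within I)"
        using has_field_derivative_at_within[OF norm_crv_has_derivative[OF I(1)[OF \<sigma>]], of I] by (simp add: rd[OF \<sigma>])
    qed
    then have norm_const: "(norm (crv \<sigma> - z))\<^sup>2 = (norm (p - z))\<^sup>2" if "\<sigma> \<in> I" for \<sigma>
      using that \<open>0 \<in> I\<close> crv0 by metis
    obtain q where q: "q \<in> frontier S" "dist q p < e" "norm (q - z) \<noteq> norm (p - z)"
      using near[OF e(1)] by blast
    have q_ball: "q \<in> ball p r" using q(2) e(2) \<rho>(2) by (simp add: dist_commute)
    define \<sigma> where "\<sigma> = (q - p) \<bullet> e1"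
    have "q = crv \<sigma>" unfolding \<sigma>_def by (intro crv_eqI frontier_on_graph q_ball q)
    moreover have "\<bar>\<sigma>\<bar> \<le> norm (q - p) * norm e1" unfolding \<sigma>_def by (rule Cauchy_Schwarz_ineq2)
    then have "\<sigma> \<in> I" using q(2) norm_e1 by (auto simp: I_def dist_norm abs_le_iff)
    ultimately show False using norm_const[of \<sigma>] q(3) by simp
  qed
  then obtain \<sigma>1 where \<sigma>1: "\<sigma>1 \<in> I" "support \<sigma>1 \<noteq> support 0" by blast
  have "connected (support ` I)"
    by (intro connected_continuous_image continuous_at_imp_continuous_on ballI DERIV_isCont[OF support_has_derivative] I(1))
       (auto simp: I_def)
  then have "{min (support \<sigma>1) (support 0)..max (support \<sigma>1) (support 0)} \<subseteq> support ` I"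
    using \<sigma>1(1) \<open>0 \<in> I\<close> by (intro connected_contains_Icc) (auto simp: min_def max_def)
  then have "\<exists>\<sigma>. crv \<sigma> \<in> ball p r \<and> g2 \<sigma> < 0 \<and> support \<sigma> = t"
    if "t \<in> {min (support \<sigma>1) (support 0)..max (support \<sigma>1) (support 0)}" for t
    using that I(2,3) by blast
  moreover have "min (support \<sigma>1) (support 0) < max (support \<sigma>1) (support 0)"
    using \<sigma>1(2) by linarith
  ultimately show ?thesis by blast
qed

text \<open>Each support value in the interval belongs to a point of positive curvature with its own
  threshold. Unbounded frequencies would then make the truncated Fresnel integral small at every
  phase, including pi/2.\<close>

lemma solution_frequencies_bounded:
  assumes far: "\<And>x. x \<in> closure S \<Longrightarrow> norm (x - z) \<le> norm (p - z)"
    and near: "\<And>e. 0 < e \<Longrightarrow> \<exists>q\<in>frontier S. dist q p < e \<and> norm (q - z) \<noteq> norm (p - z)"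
  shows "\<exists>K. \<forall>l>K. \<not> (\<exists>c u. overdetermined_solution S (l\<^sup>2) c u \<and> (\<exists>x\<in>S. u x \<noteq> 0))"
proof (rule ccontr)
  assume unb: "\<not> ?thesis"
  define L where "L = {l. \<exists>c u. overdetermined_solution S (l\<^sup>2) c u \<and> (\<exists>x\<in>S. u x \<noteq> 0)}"
  \<comment> \<open>Large enough for \<open>12 / sqrt M = 0.06\<close> to lie below 1/10, which is
    twice the bound of \<open>integral_sin_square_ge\<close>.\<close>
  define M :: real where "M = 40000"
  define f where "f = (\<lambda>x. integral {0..sqrt M} (\<lambda>y. 2 * cos (x - y\<^sup>2)))"
  have f_eq: "f x = 2 * (cos x * integral {0..sqrt M} (\<lambda>y. cos (y\<^sup>2)) + sin x * integral {0..sqrt M} (\<lambda>y. sin (y\<^sup>2)))" for x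
    unfolding f_def by (rule fresnel_eq) (simp add: M_def)
  have sqrtM: "sqrt M = 200" by (rule real_sqrt_unique) (simp_all add: M_def)
  obtain t0 t1 where t: "t0 < t1" "\<And>t. t \<in> {t0..t1} \<Longrightarrow> \<exists>\<sigma>. crv \<sigma> \<in> ball p r \<and> g2 \<sigma> < 0 \<and> support \<sigma> = t"
    using support_interval[OF far near] by blast
  have "\<bar>f (pi / 2)\<bar> \<le> 12 / sqrt M"
  proof (rule periodic_bound_of_eventual_dilates[OF t(1), where L = L and f = f])
    show "\<exists>l\<in>L. K < l" for K using unb unfolding L_def by blast
    have "f = (\<lambda>x. 2 * (cos x * integral {0..sqrt M} (\<lambda>y. cos (y\<^sup>2)) + sin x * integral {0..sqrt M} (\<lambda>y. sin (y\<^sup>2))))"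
      by (rule ext) (rule f_eq)
    then show "continuous_on UNIV f" by (simp only:) (intro continuous_intros)
    show "f (x + 2 * pi * of_int n) = f x" for x n
      unfolding f_eq using sin_cos_eq_iff sin.plus_of_int[of x n] cos.plus_of_int[of x n] by (simp add: mult_ac)
    fix s assume "s \<in> {t0..t1}"
    then obtain \<sigma> where \<sigma>: "crv \<sigma> \<in> ball p r" "g2 \<sigma> < 0" "support \<sigma> = s" using t(2) by blast
    have "1 \<le> M" by (simp add: M_def)
    from fresnel_bound[OF \<sigma>(1,2) this] show "\<exists>K. \<forall>l\<in>L. K < l \<longrightarrow> \<bar>f (l * s)\<bar> \<le> 12 / sqrt M"
      unfolding width_eq_support[OF \<sigma>(1,2)] \<sigma>(3) f_def L_def by blast
  qed
  moreover have "1 / 10 \<le> f (pi / 2)"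
    using integral_sin_square_ge[of "sqrt M"] unfolding f_eq sqrtM by simp
  ultimately show False unfolding sqrtM by simp
qed

end

text \<open>The open ball is connected, meets \<open>S\<close> and misses its frontier, so it lies
  inside \<open>S\<close>; the reverse inclusion holds as \<open>S\<close> is an open subset of the
  closed ball.\<close>

lemma disk_of_frontier_in_sphere:
  fixes S :: "(real^2) set"
  assumes "open S" "bounded S" "z \<in> S" and eq: "\<And>x. x \<in> frontier S \<Longrightarrow> dist z x = R"
    and le: "\<And>x. x \<in> closure S \<Longrightarrow> dist z x \<le> R"
  shows "S = ball z R"
proof
  show "S \<subseteq> ball z R"
  proof
    fix x assume x: "x \<in> S"
    have "S \<subseteq> cball z R" using le closure_subset[of S] unfolding cball_def by blast
    then have "S \<subseteq> interior (cball z R)" by (rule interior_maximal[OF _ assms(1)])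
    then show "x \<in> ball z R" using x by (simp add: interior_cball subset_iff)
  qed
  show "ball z R \<subseteq> S"
  proof (rule ccontr)
    assume "\<not> ball z R \<subseteq> S"
    moreover have "ball z R \<inter> S \<noteq> {}"
      using \<open>S \<subseteq> ball z R\<close> assms(3) by blast
    ultimately have "ball z R \<inter> frontier S \<noteq> {}"
      by (intro connected_Int_frontier) auto
    then show False using eq by auto
  qed
qed

theorem theorem1p1:
  fixes \<Omega> :: "(real^2) set"
  assumes "open \<Omega>" and "connected \<Omega>" and "\<Omega> \<noteq> {}"
    and "bounded \<Omega>" and "convex \<Omega>"
    and "centrally_symmetric \<Omega>"
    and "connected (frontier \<Omega>)"
    and "0 < \<epsilon>" and "\<epsilon> < 1" and "C2_eps_boundary \<epsilon> \<Omega>"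
  shows "\<exists>\<alpha>s > 0. \<forall>\<alpha> > \<alpha>s. \<forall>u c.
           overdetermined_solution \<Omega> \<alpha> c u \<and> (\<exists>x\<in>\<Omega>. u x \<noteq> 0)
           \<longrightarrow> (\<exists>x0 r. \<Omega> = ball x0 r)"
proof (cases "\<exists>x0 r. \<Omega> = ball x0 r")
  case True
  \<comment> \<open>For a disk the conclusion holds whatever the constant, so any positive one will
    do.\<close>
  then show ?thesis by (intro exI[of _ 1]) auto
next
  case False
  obtain z where z: "(\<lambda>x. 2 *\<^sub>R z - x) ` \<Omega> = \<Omega>"
    using assms(6) unfolding centrally_symmetric_def by blast
  have symm: "2 *\<^sub>R z - x \<in> \<Omega>" if "x \<in> \<Omega>" for x using z that by blast
  have z_in: "z \<in> \<Omega>"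
  proof -
    obtain x where "x \<in> \<Omega>" using assms(3) by blast
    then have "(1 / 2) *\<^sub>R x + (1 / 2) *\<^sub>R (2 *\<^sub>R z - x) \<in> \<Omega>"
      using symm by (intro convexD[OF assms(5)]) auto
    then show ?thesis by (simp add: scaleR_diff_right)
  qed
  have "compact (closure \<Omega>)" "closure \<Omega> \<noteq> {}" using assms(3,4) by (auto simp: compact_closure)
  then obtain p0 where p0: "p0 \<in> closure \<Omega>" "\<And>x. x \<in> closure \<Omega> \<Longrightarrow> dist z x \<le> dist z p0"
    using distance_attains_sup by metis
  define R where "R = dist z p0"
  have le_R: "dist z x \<le> R" if "x \<in> closure \<Omega>" for x using p0(2) that by (simp add: R_def)
  have "\<Omega> \<subseteq> cball z R" using le_R closure_subset[of \<Omega>] unfolding cball_def by blast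
  then have "\<Omega> \<subseteq> interior (cball z R)" by (rule interior_maximal[OF _ assms(1)])
  then have "p0 \<notin> \<Omega>" by (auto simp: interior_cball R_def)
  then have p0_fr: "p0 \<in> frontier \<Omega>" using p0(1) by (simp add: frontier_def interior_open[OF assms(1)])
  \<comment> \<open>The farthest points form a nonempty closed proper subset of the connected
    frontier, hence not an open one. This yields a farthest point \<open>p\<close> at which frontier
    points off the circle accumulate, as \<open>support_interval\<close> demands.\<close>
  define A where "A = frontier \<Omega> \<inter> {x. dist z x = R}"
  have "closedin (top_of_set (frontier \<Omega>)) A"
    unfolding A_def by (intro closedin_closed_Int closed_Collect_eq continuous_intros)
  moreover have "A \<noteq> {}" using p0_fr by (auto simp: A_def R_def)
  moreover have "A \<noteq> frontier \<Omega>"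
  proof
    assume "A = frontier \<Omega>"
    then have "\<Omega> = ball z R"
      using le_R by (intro disk_of_frontier_in_sphere assms(1,4) z_in) (auto simp: A_def)
    then show False using False by blast
  qed
  ultimately have "\<not> openin (top_of_set (frontier \<Omega>)) A"
    using assms(7) unfolding connected_clopen by blast
  then obtain p where pA: "p \<in> A" "\<And>e. 0 < e \<Longrightarrow> \<not> ball p e \<inter> frontier \<Omega> \<subseteq> A"
    unfolding openin_contains_ball A_def by blast
  have p_fr: "p \<in> frontier \<Omega>" and p_R: "norm (p - z) = R"
    using pA(1) by (auto simp: A_def dist_norm norm_minus_commute)
  obtain e1 e2 r g where chart: "boundary_chart \<Omega> p e1 e2 r g"
    using C2_eps_boundary_chart[OF assms(1,10,8) p_fr] .
  interpret centred_chart \<Omega> p e1 e2 r g z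
    using assms(4,5) z_in symm C2_eps_boundary_outer_normal[OF assms(1,10,8)]
    by (intro centred_chart.intro[OF chart] centred_chart_axioms.intro) auto
  have "\<exists>K. \<forall>l>K. \<not> (\<exists>c u. overdetermined_solution \<Omega> (l\<^sup>2) c u \<and> (\<exists>x\<in>\<Omega>. u x \<noteq> 0))"
  proof (rule solution_frequencies_bounded)
    show "norm (x - z) \<le> norm (p - z)" if "x \<in> closure \<Omega>" for x
      using le_R[OF that] by (simp add: p_R dist_norm norm_minus_commute)
    show "\<exists>q\<in>frontier \<Omega>. dist q p < e \<and> norm (q - z) \<noteq> norm (p - z)" if "0 < e" for e
      using pA(2)[OF that] by (auto simp: A_def p_R dist_norm norm_minus_commute)
  qed
  then obtain K where K: "\<And>l. K < l \<Longrightarrow> \<not> (\<exists>c u. overdetermined_solution \<Omega> (l\<^sup>2) c u \<and> (\<exists>x\<in>\<Omega>. u x \<noteq> 0))"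
    by blast
  \<comment> \<open>Squared because \<open>K\<close> bounds frequencies, which are square roots of
    \<alpha>; modulus and added 1 make it positive whatever the sign of \<open>K\<close>.\<close>
  define \<alpha>s where "\<alpha>s = (\<bar>K\<bar> + 1)\<^sup>2"
  show ?thesis
  proof (rule exI[of _ \<alpha>s], intro conjI allI impI)
    show "0 < \<alpha>s" by (simp add: \<alpha>s_def)
    fix \<alpha> u c assume \<alpha>: "\<alpha>s < \<alpha>" and sol: "overdetermined_solution \<Omega> \<alpha> c u \<and> (\<exists>x\<in>\<Omega>. u x \<noteq> 0)"
    have "\<bar>K\<bar> + 1 < sqrt \<alpha>" using \<alpha> by (intro real_less_rsqrt) (simp add: \<alpha>s_def)
    moreover have "(sqrt \<alpha>)\<^sup>2 = \<alpha>" using \<alpha> \<open>0 < \<alpha>s\<close> by simp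
    ultimately show "\<exists>x0 r. \<Omega> = ball x0 r"
      using K[of "sqrt \<alpha>"] sol by auto
  qed
qed

end
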